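(* Let $X\subset\mathbb{P}^4$ be a smooth three-dimensional quadric over $k$, and let $\mathsf{SO}_5$ be the special orthogonal group of a quadratic form defining $X$. Suppose that a finite subgroup $G\subset\mathsf{SO}_5$ acts on $X$ generically freely. Let $\widetilde{G}\subset\mathsf{Sp}_4$ be the preimage of $G$ under the double cover $\mathsf{Sp}_4\to\mathsf{SO}_5$. If the induced central extension $$1\to\mu_2\to\widetilde{G}\to G\to 1$$ is trivial (splits), i.e., if the restriction homomorphism $\mathrm{H}^2(\mathsf{SO}_5,\mu_2)\to\mathrm{H}^2(G,\mu_2)$ vanishes on the class of the extension $1\to\mu_2\to\mathsf{Sp}_4\to\mathsf{SO}_5\to 1$, then the action of $G$ on $X$ is stably linearizable.
   Context: The base field $k$ is algebraically closed of characteristic zero. The extension $1\to\mu_2\to\mathsf{Sp}_4\to\mathsf{SO}_5\to1$ is the one coming from the exceptional isomorphism $\mathsf{Spin}_5\simeq\mathsf{Sp}_4$. For a finite group $G$, a smooth variety $X$ over $k$ with a generically free regular action of $G$ is called linearizable if there is a $G$-equivariant birational map $\mathbb{P}(V)\dashrightarrow X$ for some linear representation $V$ of $G$. It is called stably linearizable if $X\times\mathbb{P}^m$, with trivial action on the second factor, is linearizable for some $m$. *)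

theory Defs
  imports "HOL-Algebra.Coset" "HOL-Computational_Algebra.Polynomial"
    "Jordan_Normal_Form.Determinant"
begin

section \<open>Projective varieties over an algebraically closed field\<close>

text \<open>
  The base field is always infinite, so homogeneous polynomials in \<open>n\<close> variables are identified
  with the functions they define on \<^term>\<open>carrier_vec n\<close>; values outside
  \<^term>\<open>carrier_vec n\<close> play no role. \<open>hom_poly n d f\<close>: \<open>f\<close> is homogeneous of degree \<open>d\<close>
  (or zero).
\<close>

inductive hom_poly :: "nat \<Rightarrow> nat \<Rightarrow> ('a :: comm_ring_1 vec \<Rightarrow> 'a) \<Rightarrow> bool" for n where
  const: "hom_poly n 0 (\<lambda>x. c)"
| coord: "i < n \<Longrightarrow> hom_poly n 1 (\<lambda>x. x $ i)"
| add: "hom_poly n d f \<Longrightarrow> hom_poly n d g \<Longrightarrow> hom_poly n d (\<lambda>x. f x + g x)"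
| mult: "hom_poly n d f \<Longrightarrow> hom_poly n e g \<Longrightarrow> hom_poly n (d + e) (\<lambda>x. f x * g x)"

text \<open>
  A point of the projective space of lines in \<open>k^n\<close> is the set of nonzero vectors of the line, so
  \<open>proj_space n\<close> has dimension \<open>n - 1\<close>.
\<close>

definition proj_point :: "'a :: field vec \<Rightarrow> 'a vec set" where
  "proj_point x = {c \<cdot>\<^sub>v x | c. c \<noteq> 0}"

definition proj_space :: "nat \<Rightarrow> 'a :: field vec set set" where
  "proj_space n = proj_point ` (carrier_vec n - {0\<^sub>v n})"

definition proj_zero_locus :: "nat \<Rightarrow> ('a :: field vec \<Rightarrow> 'a) set \<Rightarrow> 'a vec set set" where
  "proj_zero_locus n S = {p \<in> proj_space n. \<forall>x\<in>p. \<forall>f\<in>S. f x = 0}"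

definition zariski_closed :: "nat \<Rightarrow> 'a :: field vec set set \<Rightarrow> bool" where
  "zariski_closed n C \<longleftrightarrow> (\<exists>S. (\<forall>f\<in>S. \<exists>d. hom_poly n d f) \<and> C = proj_zero_locus n S)"

text \<open>\<open>U\<close> is open in \<open>Z\<close> for the Zariski topology that \<open>Z\<close> inherits from \<open>proj_space n\<close>.\<close>

definition zariski_open_in ::
    "nat \<Rightarrow> 'a :: field vec set set \<Rightarrow> 'a vec set set \<Rightarrow> bool" where
  "zariski_open_in n Z U \<longleftrightarrow> (\<exists>C. zariski_closed n C \<and> U = Z - C)"

definition regular_map ::
    "nat \<Rightarrow> 'a :: field vec set set \<Rightarrow> nat \<Rightarrow> ('a vec set \<Rightarrow> 'a vec set) \<Rightarrow> bool" where
  "regular_map n U r f \<longleftrightarrow>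
     (\<forall>p\<in>U. \<exists>W d F. zariski_open_in n U W \<and> p \<in> W \<and>
        (\<forall>i<r. hom_poly n d (\<lambda>x. F x $ i)) \<and>
        (\<forall>q\<in>W. \<forall>x\<in>q. F x \<in> carrier_vec r - {0\<^sub>v r} \<and> f q = proj_point (F x)))"

text \<open>
  The partial derivative is the linear coefficient of the one-variable polynomial
  \<open>t \<mapsto> f (x + t e\<^sub>i)\<close>.
\<close>

definition partial_deriv :: "nat \<Rightarrow> nat \<Rightarrow> ('a :: field vec \<Rightarrow> 'a) \<Rightarrow> 'a vec \<Rightarrow> 'a" where
  "partial_deriv n i f x =
     (THE c. \<exists>p. (\<forall>t. poly p t = f (x + t \<cdot>\<^sub>v unit_vec n i)) \<and> c = poly (pderiv p) 0)"

text \<open>Jacobian criterion for the projective hypersurface (as a scheme) defined by \<open>f\<close>.\<close>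

definition smooth_hypersurface :: "nat \<Rightarrow> ('a :: field vec \<Rightarrow> 'a) \<Rightarrow> bool" where
  "smooth_hypersurface n f \<longleftrightarrow>
     (\<forall>p \<in> proj_zero_locus n {f}. \<forall>x\<in>p. \<exists>i<n. partial_deriv n i f x \<noteq> 0)"

text \<open>
  Products of projective varieties are formed by the Segre embedding
  \<open>(x, y) \<mapsto> x \<otimes> y\<close>.
\<close>

definition tensor_vec :: "'a :: field vec \<Rightarrow> 'a vec \<Rightarrow> 'a vec" where
  "tensor_vec x y =
     vec (dim_vec x * dim_vec y) (\<lambda>k. x $ (k div dim_vec y) * y $ (k mod dim_vec y))"

definition segre_point :: "'a :: field vec set \<Rightarrow> 'a vec set \<Rightarrow> 'a vec set" where
  "segre_point p q = {tensor_vec x y | x y. x \<in> p \<and> y \<in> q}"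

definition segre_product ::
    "'a :: field vec set set \<Rightarrow> 'a vec set set \<Rightarrow> 'a vec set set" where
  "segre_product Z W = {segre_point p q | p q. p \<in> Z \<and> q \<in> W}"


section \<open>Group actions and linearizability\<close>

definition GL :: "nat \<Rightarrow> 'a :: field mat monoid" where
  "GL n = units_of (ring_mat TYPE('a) n ())"

definition proj_act :: "'a :: field mat \<Rightarrow> 'a vec set \<Rightarrow> 'a vec set" where
  "proj_act A p = (\<lambda>x. A *\<^sub>v x) ` p"

text \<open>
  All varieties to which the following notions are applied (smooth quadrics of positive
  dimension, projective spaces, and products of these) are irreducible, so that
  nonempty open subsets are dense.
\<close>

definition generically_free ::
    "('g, 'b) monoid_scheme \<Rightarrow> nat \<Rightarrow> 'a :: field vec set set \<Rightarrow>
     ('g \<Rightarrow> 'a vec set \<Rightarrow> 'a vec set) \<Rightarrow> bool" where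
  "generically_free G n Z act \<longleftrightarrow>
     (\<exists>U. zariski_open_in n Z U \<and> U \<noteq> {} \<and>
        (\<forall>p\<in>U. \<forall>g\<in>carrier G. act g p = p \<longrightarrow> g = \<one>\<^bsub>G\<^esub>))"

text \<open>
  A birational map is an isomorphism between nonempty open subsets. Its equivariance is an
  equality of rational maps, hence is only tested where both sides are defined.
\<close>

definition equivariantly_birational ::
    "('g, 'b) monoid_scheme \<Rightarrow>
     nat \<Rightarrow> 'a :: field vec set set \<Rightarrow> ('g \<Rightarrow> 'a vec set \<Rightarrow> 'a vec set) \<Rightarrow>
     nat \<Rightarrow> 'a vec set set \<Rightarrow> ('g \<Rightarrow> 'a vec set \<Rightarrow> 'a vec set) \<Rightarrow> bool" where
  "equivariantly_birational G n Z act n' Z' act' \<longleftrightarrow>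
     (\<exists>U U' f f'.
        zariski_open_in n Z U \<and> U \<noteq> {} \<and> zariski_open_in n' Z' U' \<and> U' \<noteq> {} \<and>
        regular_map n U n' f \<and> f ` U \<subseteq> U' \<and>
        regular_map n' U' n f' \<and> f' ` U' \<subseteq> U \<and>
        (\<forall>p\<in>U. f' (f p) = p) \<and> (\<forall>q\<in>U'. f (f' q) = q) \<and>
        (\<forall>g\<in>carrier G. \<forall>p\<in>U. act g p \<in> U \<longrightarrow> f (act g p) = act' g (f p)))"

definition linearizable ::
    "('g, 'b) monoid_scheme \<Rightarrow> nat \<Rightarrow> 'a :: field vec set set \<Rightarrow>
     ('g \<Rightarrow> 'a vec set \<Rightarrow> 'a vec set) \<Rightarrow> bool" where
  "linearizable G n Z act \<longleftrightarrow>
     (\<exists>r \<rho>. \<rho> \<in> hom G (GL r) \<and>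
        equivariantly_birational G r (proj_space r) (\<lambda>g. proj_act (\<rho> g)) n Z act)"

text \<open>
  The action on \<open>segre_product Z W\<close> given by an action on \<open>Z\<close> and the trivial action on \<open>W\<close>.
\<close>

definition left_act ::
    "'a :: field vec set set \<Rightarrow> 'a vec set set \<Rightarrow> ('g \<Rightarrow> 'a vec set \<Rightarrow> 'a vec set) \<Rightarrow>
     'g \<Rightarrow> 'a vec set \<Rightarrow> 'a vec set" where
  "left_act Z W act g z =
     (THE w. \<exists>p\<in>Z. \<exists>q\<in>W. z = segre_point p q \<and> w = segre_point (act g p) q)"

definition stably_linearizable ::
    "('g, 'b) monoid_scheme \<Rightarrow> nat \<Rightarrow> 'a :: field vec set set \<Rightarrow>
     ('g \<Rightarrow> 'a vec set \<Rightarrow> 'a vec set) \<Rightarrow> bool" where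
  "stably_linearizable G n Z act \<longleftrightarrow>
     (\<exists>m. linearizable G (n * (m + 1)) (segre_product Z (proj_space (m + 1)))
            (left_act Z (proj_space (m + 1)) act))"


section \<open>The double cover of the special orthogonal group in dimension five\<close>

definition SO5 :: "('a :: field vec \<Rightarrow> 'a) \<Rightarrow> 'a mat monoid" where
  "SO5 q = (GL 5)\<lparr>carrier :=
     {A \<in> carrier (GL 5). det A = 1 \<and> (\<forall>x\<in>carrier_vec 5. q (A *\<^sub>v x) = q x)}\<rparr>"

definition symp_mat :: "'a :: field mat" where
  "symp_mat = four_block_mat (0\<^sub>m 2 2) (1\<^sub>m 2) (- 1\<^sub>m 2) (0\<^sub>m 2 2)"

definition Sp4 :: "'a :: field mat monoid" where
  "Sp4 = (GL 4)\<lparr>carrier :=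
     {A \<in> carrier (GL 4). transpose_mat A * symp_mat * A = symp_mat}\<rparr>"

text \<open>
  Let \<open>W = k^4\<close> with the symplectic form \<open>\<omega> v w = v\<^sup>T J w\<close>, \<open>J = symp_mat\<close>. The exterior square
  of \<open>W\<close> is identified with the alternating matrices by \<open>v \<and> w \<mapsto> v w\<^sup>T - w v\<^sup>T\<close>; then \<open>g\<close> acts
  by \<open>M \<mapsto> g M g\<^sup>T\<close>, and contraction with \<open>\<omega>\<close> is half of \<open>M \<mapsto> \<Sum>\<^sub>i\<^sub>j J\<^sub>i\<^sub>j M\<^sub>i\<^sub>j\<close>. Its
  kernel is the five-dimensional irreducible representation of \<^term>\<open>Sp4\<close>. The
  invariant quadratic form on it is the Pfaffian: \<open>M \<and> M = 2 pf M e\<^sub>0 \<and> e\<^sub>1 \<and> e\<^sub>2 \<and> e\<^sub>3\<close>.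
\<close>

definition primitive_bivectors :: "'a :: field mat set" where
  "primitive_bivectors = {M \<in> carrier_mat 4 4. transpose_mat M = - M \<and> (\<forall>i<4. M $$ (i, i) = 0) \<and>
     (\<Sum>i<4. \<Sum>j<4. symp_mat $$ (i, j) * M $$ (i, j)) = 0}"

definition pf :: "'a :: field mat \<Rightarrow> 'a" where
  "pf M = M $$ (0, 1) * M $$ (2, 3) - M $$ (0, 2) * M $$ (1, 3) + M $$ (0, 3) * M $$ (1, 2)"

definition isometry_from_primitive ::
    "('a :: field vec \<Rightarrow> 'a) \<Rightarrow> ('a mat \<Rightarrow> 'a vec) \<Rightarrow> bool" where
  "isometry_from_primitive q \<phi> \<longleftrightarrow>
     bij_betw \<phi> primitive_bivectors (carrier_vec 5) \<and>
     (\<forall>M\<in>primitive_bivectors. \<forall>N\<in>primitive_bivectors. \<phi> (M + N) = \<phi> M + \<phi> N) \<and>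
     (\<forall>c. \<forall>M\<in>primitive_bivectors. \<phi> (c \<cdot>\<^sub>m M) = c \<cdot>\<^sub>v \<phi> M) \<and>
     (\<forall>M\<in>primitive_bivectors. q (\<phi> M) = pf M)"

text \<open>
  The map \<open>\<pi>\<close> from \<^term>\<open>Sp4\<close> to \<^term>\<open>SO5 q\<close> of the exceptional isomorphism: the action on
  primitive bivectors, transported to \<open>k^5\<close> by some isometry \<open>\<phi>\<close>. For a nondegenerate \<open>q\<close> over an
  algebraically closed field of characteristic not 2 such isometries exist, and any two choices
  give covers that differ by conjugation in the orthogonal group of \<open>q\<close>.
\<close>

definition exceptional_double_cover ::
    "('a :: field vec \<Rightarrow> 'a) \<Rightarrow> ('a mat \<Rightarrow> 'a mat) \<Rightarrow> bool" where
  "exceptional_double_cover q \<pi> \<longleftrightarrow>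
     (\<exists>\<phi>. isometry_from_primitive q \<phi> \<and>
        (\<forall>g\<in>carrier Sp4. \<pi> g \<in> carrier_mat 5 5 \<and>
           (\<forall>M\<in>primitive_bivectors. \<pi> g *\<^sub>v \<phi> M = \<phi> (g * M * transpose_mat g))))"

definition cover_preimage :: "('a :: field mat \<Rightarrow> 'a mat) \<Rightarrow> 'a mat set \<Rightarrow> 'a mat set" where
  "cover_preimage \<pi> H = {g \<in> carrier Sp4. \<pi> g \<in> H}"

text \<open>
  The extension given by \<open>\<pi>\<close> from \<open>E\<close> onto \<open>G\<close> has a homomorphic section. For a central
  extension this is equivalent to triviality.
\<close>

definition extension_splits ::
    "('e, 'b) monoid_scheme \<Rightarrow> ('g, 'c) monoid_scheme \<Rightarrow> ('e \<Rightarrow> 'g) \<Rightarrow> bool" where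
  "extension_splits E G \<pi> \<longleftrightarrow> (\<exists>s\<in>hom G E. \<forall>h\<in>carrier G. \<pi> (s h) = h)"

end

theory Submission
  imports Defs
begin

text \<open>
  Let \<open>W\<close> be the symplectic space \<open>k\<^sup>4\<close> with form \<open>\<omega>\<close>. The zeros of the Pfaffian on the primitive
  bivectors are the decomposable bivectors \<open>v \<and> w\<close> with \<open>\<omega>(v, w) = 0\<close>, so the quadric \<open>X\<close> is the
  Grassmannian of Lagrangian planes of \<open>W\<close>. A splitting \<open>s\<close> of the central extension makes \<open>W\<close> a
  linear representation of \<open>G\<close> itself, and therefore the tautological rank two bundle \<open>U\<close> on \<open>X\<close> a
  \<open>G\<close>-linearized bundle. The variety \<open>Z = {(v, w). \<omega>(v, w) = 0}\<close> is then compared with two spaces.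

  \<^item> Over \<open>X\<close> it is birational to \<open>U \<oplus> U\<close>. As \<open>G\<close> acts generically freely on \<open>X\<close>, the bundle \<open>U\<close> is
    equivariantly trivial over an open set, so that \<open>Z\<close> is birational to \<open>X \<times> k\<^sup>4\<close> with the trivial
    action on \<open>k\<^sup>4\<close>.
  \<^item> Over the first factor of \<open>W \<oplus> W\<close> it is the bundle of the hyperplanes \<open>v\<^sup>\<bottom>\<close>. As \<open>s\<close> is
    injective, \<open>G\<close> acts generically freely on \<open>W\<close>, and there is an equivariant \<open>w\<^sub>0\<close> with
    \<open>\<omega>(v, w\<^sub>0(v)) \<noteq> 0\<close>. Projecting \<open>w\<close> to \<open>v\<^sup>\<bottom>\<close> along \<open>w\<^sub>0(v)\<close> shows that \<open>W \<oplus> W\<close> is birational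
    to \<open>Z \<times> k\<close>.

  Hence \<open>X \<times> k\<^sup>5\<close> is equivariantly birational to \<open>W \<oplus> W\<close>, and, after homogenizing, \<open>X \<times> \<P>\<^sup>5\<close> to
  the projective space of \<open>W \<oplus> W \<oplus> k\<close>.

  Both trivialisations are instances of the no-name lemma, which here only takes an average: if a
  homogeneous polynomial \<open>f\<close> vanishes at \<open>g x\<^sub>0\<close> for every \<open>g \<noteq> 1\<close> but not at \<open>x\<^sub>0\<close>, then
  \<open>c(x) = \<Sum>\<^sub>g f(g x) s(g)\<^sup>T \<epsilon>\<close> is an equivariant polynomial family of covectors on \<open>W\<close> with a
  prescribed direction \<open>\<epsilon>\<close> at \<open>x\<^sub>0\<close> (\<open>average_covector_equivariant\<close>, \<open>average_at_free_point\<close>).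
  Two such families \<open>c\<^sub>1\<close>, \<open>c\<^sub>2\<close> on \<open>X\<close> give invariant coordinates \<open>\<langle>v, c\<^sub>i\<rangle>\<close> on the fibres of \<open>U\<close>. They
  are inverted in closed form: if \<open>M\<close> is the bivector of a point of \<open>X\<close> and \<open>\<gamma> = \<langle>c\<^sub>1, M c\<^sub>2\<rangle>\<close>, then
  the vector of the plane with coordinates \<open>a\<^sub>1\<close>, \<open>a\<^sub>2\<close> is \<open>(a\<^sub>1 M c\<^sub>2 - a\<^sub>2 M c\<^sub>1) / \<gamma>\<close>, and the Pluecker
  relations give \<open>M c\<^sub>1 \<and> M c\<^sub>2 = \<gamma> M\<close> (\<open>wedge_contract\<close>). After clearing denominators both maps are
  polynomial, and \<open>backward_forward\<close> and \<open>forward_backward\<close> verify that they are mutually inverse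
  up to scalars. The criterion \<open>equivariantly_birational_segreI\<close> turns such a pair of polynomial maps
  into an equivariant birational map onto a Segre product.
\<close>


section \<open>Homogeneous and bihomogeneous polynomial functions\<close>

lemma hom_poly_mult_deg:
  "hom_poly n d f \<Longrightarrow> hom_poly n e g \<Longrightarrow> k = d + e \<Longrightarrow> hom_poly n k (\<lambda>x. f x * g x)"
  by (simp add: hom_poly.mult)

lemma hom_poly_cmult: "hom_poly n d f \<Longrightarrow> hom_poly n d (\<lambda>x. c * f x)"
  by (rule hom_poly_mult_deg[OF hom_poly.const]) simp_all

lemma hom_poly_cmult_right: "hom_poly n d f \<Longrightarrow> hom_poly n d (\<lambda>x. f x * c)"
  by (rule hom_poly_mult_deg[OF _ hom_poly.const]) simp_all

lemma hom_poly_diff: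
  assumes "hom_poly n d f" "hom_poly n d g"
  shows "hom_poly n d (\<lambda>x. f x - g x)"
  using hom_poly.add[OF assms(1) hom_poly_cmult[OF assms(2), of "- 1"]] by simp

lemma hom_poly_sum:
  assumes "finite I" "I \<noteq> {}" "\<And>i. i \<in> I \<Longrightarrow> hom_poly n d (f i)"
  shows "hom_poly n d (\<lambda>x. \<Sum>i\<in>I. f i x)"
  using assms
proof (induction I rule: finite_ne_induct)
  case (insert i I)
  then show ?case using hom_poly.add[of n d "f i"] by simp
qed simp

lemma hom_poly_prod:
  assumes "finite I" "\<And>i. i \<in> I \<Longrightarrow> hom_poly n (d i) (f i)"
  shows "hom_poly n (\<Sum>i\<in>I. d i) (\<lambda>x. \<Prod>i\<in>I. f i x)"
  using assms
proof (induction I rule: finite_induct)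
  case empty
  then show ?case using hom_poly.const by simp
next
  case (insert i I)
  then show ?case using hom_poly.mult[of n "d i" "f i"] by simp
qed

lemma hom_poly_compose:
  assumes "hom_poly m e g" "\<And>i. i < m \<Longrightarrow> hom_poly n d (\<lambda>x. F x $ i)"
  shows "hom_poly n (e * d) (\<lambda>x. g (F x))"
  using assms
proof induction
  case (const c)
  show ?case using hom_poly.const by simp
next
  case (mult d' f e g)
  then show ?case by (auto simp: distrib_right intro!: hom_poly.mult)
qed (auto intro: hom_poly.add)

lemma hom_poly_scale:
  assumes "hom_poly n d f" "x \<in> carrier_vec n"
  shows "f (c \<cdot>\<^sub>v x) = c ^ d * f x"
  using assms by induction (auto simp: algebra_simps power_add)

lemma hom_poly_on_line:
  assumes "hom_poly n d f" "a \<in> carrier_vec n" "b \<in> carrier_vec n"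
  obtains p where "\<And>u. poly p u = f (a + u \<cdot>\<^sub>v b)"
proof -
  have "\<exists>p. \<forall>u. poly p u = f (a + u \<cdot>\<^sub>v b)"
    using assms
  proof induction
    case (const c)
    then show ?case by (intro exI[of _ "[:c:]"]) simp
  next
    case (coord i)
    then show ?case by (intro exI[of _ "[:a $ i, b $ i:]"]) simp
  next
    case (add d f g)
    then obtain p p' where "\<forall>u. poly p u = f (a + u \<cdot>\<^sub>v b)" "\<forall>u. poly p' u = g (a + u \<cdot>\<^sub>v b)"
      by blast
    then show ?case by (intro exI[of _ "p + p'"]) simp
  next
    case (mult d f e g)
    then obtain p p' where "\<forall>u. poly p u = f (a + u \<cdot>\<^sub>v b)" "\<forall>u. poly p' u = g (a + u \<cdot>\<^sub>v b)"
      by blast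
    then show ?case by (intro exI[of _ "p * p'"]) simp
  qed
  then show ?thesis using that by blast
qed

text \<open>
  On the line through a nonzero of \<open>f\<close> and a nonzero of \<open>g\<close> both functions are nonzero polynomials in one
  variable, so all but finitely many points of that line are common nonzeros.
\<close>

lemma hom_poly_common_nonzero:
  fixes f :: "'a :: field_char_0 vec \<Rightarrow> 'a"
  assumes f: "hom_poly n d f" "a \<in> carrier_vec n" "f a \<noteq> 0"
    and g: "hom_poly n e g" "b \<in> carrier_vec n" "g b \<noteq> 0"
  obtains c where "c \<in> carrier_vec n" "f c \<noteq> 0" "g c \<noteq> 0"
proof -
  obtain p where p: "\<And>u. poly p u = f (a + u \<cdot>\<^sub>v (b - a))"
    using hom_poly_on_line[OF f(1,2), of "b - a"] f(2) g(2) by auto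
  obtain p' where p': "\<And>u. poly p' u = g (a + u \<cdot>\<^sub>v (b - a))"
    using hom_poly_on_line[OF g(1) f(2), of "b - a"] f(2) g(2) by auto
  have ends: "a + 0 \<cdot>\<^sub>v (b - a) = a" "a + 1 \<cdot>\<^sub>v (b - a) = b"
    using f(2) g(2) by auto
  have "poly p 0 \<noteq> 0" "poly p' 1 \<noteq> 0"
    unfolding p p' ends using f g by auto
  then have "p * p' \<noteq> 0" by auto
  then have "finite {u. poly (p * p') u = 0}" by (rule poly_roots_finite)
  then obtain u where "poly (p * p') u \<noteq> 0"
    using infinite_UNIV_char_0 by (metis (mono_tags) UNIV_I ex_new_if_finite mem_Collect_eq)
  then show ?thesis
    using that[of "a + u \<cdot>\<^sub>v (b - a)"] p p' f(2) g(2) by auto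
qed

lemma hom_poly_family_nonzero:
  fixes F :: "('a :: field_char_0 vec \<Rightarrow> 'a) set"
  assumes "finite F" and "\<And>f. f \<in> F \<Longrightarrow> \<exists>d. hom_poly n d f"
    and "\<And>f. f \<in> F \<Longrightarrow> \<exists>x\<in>carrier_vec n. f x \<noteq> 0"
  obtains c where "c \<in> carrier_vec n" "\<And>f. f \<in> F \<Longrightarrow> f c \<noteq> 0"
proof -
  have "\<exists>d P. hom_poly n d P \<and> (\<exists>x\<in>carrier_vec n. P x \<noteq> 0) \<and> (\<forall>x. P x \<noteq> 0 \<longrightarrow> (\<forall>f\<in>F. f x \<noteq> 0))"
    using assms
  proof (induction F rule: finite_induct)
    case empty
    have "hom_poly n 0 (\<lambda>x::'a vec. 1)" by (rule hom_poly.const)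
    then show ?case
      by (intro exI[of _ 0] exI[of _ "\<lambda>x. 1"]) (auto intro: zero_carrier_vec)
  next
    case (insert f F)
    have "\<exists>d P. hom_poly n d P \<and> (\<exists>x\<in>carrier_vec n. P x \<noteq> 0) \<and> (\<forall>x. P x \<noteq> 0 \<longrightarrow> (\<forall>f\<in>F. f x \<noteq> 0))"
      by (rule insert.IH) (use insert.prems in auto)
    then obtain d P where P: "hom_poly n d P" "\<exists>x\<in>carrier_vec n. P x \<noteq> 0"
        "\<forall>x. P x \<noteq> 0 \<longrightarrow> (\<forall>f\<in>F. f x \<noteq> 0)" by blast
    obtain e where f: "hom_poly n e f" using insert.prems(1)[of f] by blast
    obtain a b where a: "a \<in> carrier_vec n" "P a \<noteq> 0" and b: "b \<in> carrier_vec n" "f b \<noteq> 0"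
      using P(2) insert.prems(2)[of f] by blast
    obtain c where "c \<in> carrier_vec n" "P c \<noteq> 0" "f c \<noteq> 0"
      using hom_poly_common_nonzero[OF P(1) a f b] .
    then have "\<exists>x\<in>carrier_vec n. P x * f x \<noteq> 0" by auto
    then show ?case
      using hom_poly.mult[OF P(1) f] P(3)
      by (intro exI[of _ "d + e"] exI[of _ "\<lambda>x. P x * f x"]) auto
  qed
  then show ?thesis using that by blast
qed

text \<open>
  Homogeneity in two blocks of variables, \<open>n\<close> and \<open>m\<close> many. The inverse of the birational map is
  written in terms of a point of the quadric and a point of \<open>\<P>\<^sup>5\<close>, while regularity of a map on a
  Segre product asks for polynomials in the coordinates of the tensor; the lemma
  \<open>bihom_poly_subst\<close> passes from one to the other.
\<close>

inductive bihom_poly ::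
    "nat \<Rightarrow> nat \<Rightarrow> nat \<Rightarrow> nat \<Rightarrow> ('a :: comm_ring_1 vec \<Rightarrow> 'a vec \<Rightarrow> 'a) \<Rightarrow> bool" for n m where
  const: "bihom_poly n m 0 0 (\<lambda>x y. c)"
| fst: "i < n \<Longrightarrow> bihom_poly n m 1 0 (\<lambda>x y. x $ i)"
| snd: "i < m \<Longrightarrow> bihom_poly n m 0 1 (\<lambda>x y. y $ i)"
| add: "bihom_poly n m a b f \<Longrightarrow> bihom_poly n m a b g \<Longrightarrow> bihom_poly n m a b (\<lambda>x y. f x y + g x y)"
| mult: "bihom_poly n m a b f \<Longrightarrow> bihom_poly n m a' b' g \<Longrightarrow>
    bihom_poly n m (a + a') (b + b') (\<lambda>x y. f x y * g x y)"

lemma bihom_poly_mult_deg: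
  "bihom_poly n m a b f \<Longrightarrow> bihom_poly n m a' b' g \<Longrightarrow> A = a + a' \<Longrightarrow> B = b + b' \<Longrightarrow>
    bihom_poly n m A B (\<lambda>x y. f x y * g x y)"
  by (simp add: bihom_poly.mult)

lemma bihom_poly_cmult: "bihom_poly n m a b f \<Longrightarrow> bihom_poly n m a b (\<lambda>x y. c * f x y)"
  by (rule bihom_poly_mult_deg[OF bihom_poly.const]) simp_all

lemma bihom_poly_diff:
  assumes "bihom_poly n m a b f" "bihom_poly n m a b g"
  shows "bihom_poly n m a b (\<lambda>x y. f x y - g x y)"
  using bihom_poly.add[OF assms(1) bihom_poly_cmult[OF assms(2), of "- 1"]] by simp

lemma bihom_poly_sum:
  assumes "finite I" "I \<noteq> {}" "\<And>i. i \<in> I \<Longrightarrow> bihom_poly n m a b (f i)"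
  shows "bihom_poly n m a b (\<lambda>x y. \<Sum>i\<in>I. f i x y)"
  using assms
proof (induction I rule: finite_ne_induct)
  case (insert i I)
  then show ?case using bihom_poly.add[of n m a b "f i"] by simp
qed simp

lemma bihom_poly_compose:
  assumes "hom_poly r e g" "\<And>i. i < r \<Longrightarrow> bihom_poly n m a b (\<lambda>x y. F x y $ i)"
  shows "bihom_poly n m (e * a) (e * b) (\<lambda>x y. g (F x y))"
  using assms
proof induction
  case (const c)
  show ?case using bihom_poly.const by simp
next
  case (mult d f e g)
  then show ?case by (auto simp: distrib_right intro!: bihom_poly.mult)
qed (auto intro: bihom_poly.add)

lemma bihom_poly_subst:
  assumes "bihom_poly n m a b f" "\<And>i. i < n \<Longrightarrow> hom_poly r d (\<lambda>z. X z $ i)"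
    "\<And>i. i < m \<Longrightarrow> hom_poly r d' (\<lambda>z. Y z $ i)"
  shows "hom_poly r (a * d + b * d') (\<lambda>z. f (X z) (Y z))"
  using assms
proof induction
  case (const c)
  show ?case using hom_poly.const by simp
next
  case (mult a b f a' b' g)
  then have "hom_poly r (a * d + b * d' + (a' * d + b' * d')) (\<lambda>z. f (X z) (Y z) * g (X z) (Y z))"
    by (intro hom_poly.mult) auto
  then show ?case by (simp add: algebra_simps)
qed (auto intro: hom_poly.add)

lemma bihom_poly_scale:
  assumes "bihom_poly n m a b f" "x \<in> carrier_vec n" "y \<in> carrier_vec m"
  shows "f (c \<cdot>\<^sub>v x) (d \<cdot>\<^sub>v y) = c ^ a * d ^ b * f x y"
  using assms by induction (auto simp: algebra_simps power_add)

lemma bihom_poly_power: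
  "bihom_poly n m a b f \<Longrightarrow> A = e * a \<Longrightarrow> B = e * b \<Longrightarrow> bihom_poly n m A B (\<lambda>x y. f x y ^ e)"
proof (induction e arbitrary: A B)
  case 0
  then show ?case using bihom_poly.const by simp
next
  case (Suc e)
  then show ?case by (auto intro: bihom_poly.mult)
qed


section \<open>Points of projective spaces and of Segre products\<close>

lemma proj_point_self: "x \<in> proj_point x"
  unfolding proj_point_def by (auto intro!: exI[of _ 1])

lemma proj_point_scale:
  assumes "c \<noteq> 0"
  shows "proj_point (c \<cdot>\<^sub>v x) = proj_point x"
proof (intro Set.set_eqI iffI)
  fix y assume "y \<in> proj_point (c \<cdot>\<^sub>v x)"
  then obtain d where "d \<noteq> 0" "y = (d * c) \<cdot>\<^sub>v x"
    unfolding proj_point_def by (auto simp: smult_smult_assoc)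
  then show "y \<in> proj_point x" using assms unfolding proj_point_def by auto
next
  fix y assume "y \<in> proj_point x"
  then obtain d where "d \<noteq> 0" "y = d \<cdot>\<^sub>v x" unfolding proj_point_def by auto
  then have "y = (d / c) \<cdot>\<^sub>v (c \<cdot>\<^sub>v x)" "d / c \<noteq> 0"
    using assms by (auto simp: smult_smult_assoc)
  then show "y \<in> proj_point (c \<cdot>\<^sub>v x)" unfolding proj_point_def by blast
qed

lemma mem_proj_pointD: "y \<in> proj_point x \<Longrightarrow> \<exists>c. c \<noteq> 0 \<and> y = c \<cdot>\<^sub>v x"
  unfolding proj_point_def by auto

lemma proj_spaceE:
  assumes "p \<in> proj_space n"
  obtains x where "x \<in> carrier_vec n" "x \<noteq> 0\<^sub>v n" "p = proj_point x"
  using assms unfolding proj_space_def by auto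

lemma proj_space_memI: "x \<in> carrier_vec n \<Longrightarrow> x \<noteq> 0\<^sub>v n \<Longrightarrow> proj_point x \<in> proj_space n"
  unfolding proj_space_def by auto

lemma proj_act_point:
  assumes "A \<in> carrier_mat n m" "x \<in> carrier_vec m"
  shows "proj_act A (proj_point x) = proj_point (A *\<^sub>v x)"
proof -
  have "A *\<^sub>v (c \<cdot>\<^sub>v x) = c \<cdot>\<^sub>v (A *\<^sub>v x)" for c
    using assms by (simp add: mult_mat_vec)
  then show ?thesis unfolding proj_act_def proj_point_def image_Collect by metis
qed

lemma proj_point_in_zero_locus:
  assumes "x \<in> carrier_vec n" "x \<noteq> 0\<^sub>v n" "\<And>f. f \<in> S \<Longrightarrow> \<exists>d. hom_poly n d f"
  shows "proj_point x \<in> proj_zero_locus n S \<longleftrightarrow> (\<forall>f\<in>S. f x = 0)"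
proof
  assume "proj_point x \<in> proj_zero_locus n S"
  then show "\<forall>f\<in>S. f x = 0" unfolding proj_zero_locus_def using proj_point_self by blast
next
  assume *: "\<forall>f\<in>S. f x = 0"
  have "f (c \<cdot>\<^sub>v x) = 0" if "f \<in> S" for f c
    using * assms(3)[OF that] hom_poly_scale[OF _ assms(1)] that by fastforce
  then show "proj_point x \<in> proj_zero_locus n S"
    using proj_space_memI[OF assms(1,2)] unfolding proj_zero_locus_def
    by (auto dest!: mem_proj_pointD)
qed

lemma tensor_vec_carrier:
  "x \<in> carrier_vec n \<Longrightarrow> y \<in> carrier_vec m \<Longrightarrow> tensor_vec x y \<in> carrier_vec (n * m)"
  unfolding tensor_vec_def by auto

lemma tensor_index_bound:
  assumes "i < n" "j < (m::nat)"
  shows "m * i + j < n * m"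
proof -
  have "m * i + j < m * (i + 1)" using assms by simp
  also have "\<dots> \<le> m * n" using assms by (intro mult_le_mono2) simp
  finally show ?thesis by (simp add: mult.commute)
qed

lemma tensor_vec_index:
  assumes "x \<in> carrier_vec n" "y \<in> carrier_vec m" "i < n" "j < m"
  shows "tensor_vec x y $ (m * i + j) = x $ i * y $ j"
  using assms tensor_index_bound[OF assms(3,4)] unfolding tensor_vec_def by simp

lemma tensor_vec_smult:
  assumes "x \<in> carrier_vec n" "y \<in> carrier_vec m"
  shows "tensor_vec (c \<cdot>\<^sub>v x) (d \<cdot>\<^sub>v y) = (c * d) \<cdot>\<^sub>v tensor_vec x y"
proof (intro eq_vecI)
  fix i assume i: "i < dim_vec ((c * d) \<cdot>\<^sub>v tensor_vec x y)"
  then have "i < n * m" using assms by (simp add: tensor_vec_def)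
  then have "0 < m" "i div m < n" by (auto simp: less_mult_imp_div_less intro: Nat.gr0I)
  then show "tensor_vec (c \<cdot>\<^sub>v x) (d \<cdot>\<^sub>v y) $ i = ((c * d) \<cdot>\<^sub>v tensor_vec x y) $ i"
    using assms i unfolding tensor_vec_def by (auto simp: mult_ac)
qed (auto simp: tensor_vec_def)

lemma nonzero_vecE:
  assumes "x \<in> carrier_vec n" "x \<noteq> 0\<^sub>v n"
  obtains i where "i < n" "x $ i \<noteq> 0"
  using assms by (metis carrier_vecD eq_vecI index_zero_vec(1) index_zero_vec(2))

lemma tensor_vec_nonzero:
  assumes "x \<in> carrier_vec n" "x \<noteq> 0\<^sub>v n" "y \<in> carrier_vec m" "y \<noteq> 0\<^sub>v m"
  shows "tensor_vec x y \<noteq> 0\<^sub>v (n * m)"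
proof -
  obtain i j where "i < n" "x $ i \<noteq> 0" "j < m" "y $ j \<noteq> 0"
    using nonzero_vecE assms by metis
  then have "tensor_vec x y $ (m * i + j) \<noteq> 0" "m * i + j < n * m"
    using tensor_vec_index[OF assms(1,3)] tensor_index_bound by auto
  then show ?thesis by auto
qed

lemma segre_point_proj_point:
  assumes "x \<in> carrier_vec n" "y \<in> carrier_vec m"
  shows "segre_point (proj_point x) (proj_point y) = proj_point (tensor_vec x y)"
proof (intro Set.set_eqI iffI)
  fix z assume "z \<in> segre_point (proj_point x) (proj_point y)"
  then obtain c d where "z = tensor_vec (c \<cdot>\<^sub>v x) (d \<cdot>\<^sub>v y)" "c \<noteq> 0" "d \<noteq> 0"
    unfolding segre_point_def proj_point_def by auto
  then show "z \<in> proj_point (tensor_vec x y)"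
    using tensor_vec_smult[OF assms] unfolding proj_point_def by auto
next
  fix z assume "z \<in> proj_point (tensor_vec x y)"
  then obtain c where c: "c \<noteq> 0" "z = c \<cdot>\<^sub>v tensor_vec x y" using mem_proj_pointD by blast
  then have "z = tensor_vec (c \<cdot>\<^sub>v x) (1 \<cdot>\<^sub>v y)"
    using tensor_vec_smult[OF assms, of c 1] by simp
  then show "z \<in> segre_point (proj_point x) (proj_point y)"
    unfolding segre_point_def proj_point_def using c(1) one_neq_zero by blast
qed

text \<open>
  The Segre embedding is injective: a column of \<open>x \<otimes> y\<close> at a nonzero coordinate of \<open>y\<close> is a multiple
  of \<open>x\<close>, and likewise for the rows.
\<close>

lemma tensor_vec_eqD:
  fixes x :: "'a :: field vec"
  assumes x: "x \<in> carrier_vec n" "x \<noteq> 0\<^sub>v n" and y: "y \<in> carrier_vec m" "y \<noteq> 0\<^sub>v m"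
    and x': "x' \<in> carrier_vec n" "x' \<noteq> 0\<^sub>v n" and y': "y' \<in> carrier_vec m" "y' \<noteq> 0\<^sub>v m"
    and eq: "proj_point (tensor_vec x y) = proj_point (tensor_vec x' y')"
  obtains a b where "a \<noteq> 0" "b \<noteq> 0" "x' = a \<cdot>\<^sub>v x" "y' = b \<cdot>\<^sub>v y"
proof -
  obtain c where c: "c \<noteq> 0" "tensor_vec x y = c \<cdot>\<^sub>v tensor_vec x' y'"
    using proj_point_self[of "tensor_vec x y"] mem_proj_pointD unfolding eq by blast
  have entry: "x $ i * y $ j = c * (x' $ i * y' $ j)" if "i < n" "j < m" for i j
  proof -
    have "(c \<cdot>\<^sub>v tensor_vec x' y') $ (m * i + j) = c * tensor_vec x' y' $ (m * i + j)"
      using tensor_index_bound[OF that] tensor_vec_carrier[OF x'(1) y'(1)] by simp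
    then show ?thesis
      using c(2) tensor_vec_index[OF x(1) y(1) that] tensor_vec_index[OF x'(1) y'(1) that] by simp
  qed
  obtain i where i: "i < n" "x' $ i \<noteq> 0" using nonzero_vecE[OF x'] .
  obtain j where j: "j < m" "y' $ j \<noteq> 0" using nonzero_vecE[OF y'] .
  have nz: "x $ i \<noteq> 0" "y $ j \<noteq> 0"
    using entry[OF i(1) j(1)] i(2) j(2) c(1) by auto
  have "x' = (y $ j / (c * y' $ j)) \<cdot>\<^sub>v x"
    using x(1) x'(1) entry[OF _ j(1)] j(2) c(1) by (intro eq_vecI) (auto simp: field_simps)
  moreover have "y' = (x $ i / (c * x' $ i)) \<cdot>\<^sub>v y"
    using y(1) y'(1) entry[OF i(1)] i(2) c(1) by (intro eq_vecI) (auto simp: field_simps)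
  ultimately show ?thesis using that nz c(1) i(2) j(2) by (metis divide_eq_0_iff mult_eq_0_iff)
qed

lemma segre_productE:
  assumes "p \<in> segre_product Z (proj_space m)" "Z \<subseteq> proj_space n"
  obtains x y where "x \<in> carrier_vec n" "x \<noteq> 0\<^sub>v n" "proj_point x \<in> Z"
    "y \<in> carrier_vec m" "y \<noteq> 0\<^sub>v m" "p = proj_point (tensor_vec x y)"
proof -
  obtain a b where ab: "a \<in> Z" "b \<in> proj_space m" "p = segre_point a b"
    using assms(1) unfolding segre_product_def by auto
  obtain x where x: "x \<in> carrier_vec n" "x \<noteq> 0\<^sub>v n" "a = proj_point x"
    using ab(1) assms(2) proj_spaceE by blast
  obtain y where y: "y \<in> carrier_vec m" "y \<noteq> 0\<^sub>v m" "b = proj_point y"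
    using ab(2) proj_spaceE by blast
  then show ?thesis using that x ab segre_point_proj_point[OF x(1) y(1)] by blast
qed

lemma segre_product_memI:
  assumes "x \<in> carrier_vec n" "proj_point x \<in> Z" "y \<in> carrier_vec m" "y \<noteq> 0\<^sub>v m"
  shows "proj_point (tensor_vec x y) \<in> segre_product Z (proj_space m)"
  unfolding segre_product_def
  using assms segre_point_proj_point[OF assms(1,3)] proj_space_memI[OF assms(3,4)] by blast

text \<open>
  The definite description in \<open>left_act\<close> is meaningful because a point of a Segre product determines
  both of its factors.
\<close>

lemma left_act_point:
  assumes A: "A \<in> carrier_mat n n" and Z: "Z \<subseteq> proj_space n"
    and x: "x \<in> carrier_vec n" "proj_point x \<in> Z" and y: "y \<in> carrier_vec m" "y \<noteq> 0\<^sub>v m"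
    and act: "act g = proj_act A"
  shows "left_act Z (proj_space m) act g (proj_point (tensor_vec x y)) =
    proj_point (tensor_vec (A *\<^sub>v x) y)"
  unfolding left_act_def act
proof (rule the_equality)
  have Ax: "A *\<^sub>v x \<in> carrier_vec n" using A x(1) by auto
  show "\<exists>p\<in>Z. \<exists>q\<in>proj_space m. proj_point (tensor_vec x y) = segre_point p q \<and>
      proj_point (tensor_vec (A *\<^sub>v x) y) = segre_point (proj_act A p) q"
    using x(2) proj_space_memI[OF y] segre_point_proj_point[OF x(1) y(1)]
      segre_point_proj_point[OF Ax y(1)] proj_act_point[OF A x(1)] by metis
  fix w
  assume "\<exists>p\<in>Z. \<exists>q\<in>proj_space m. proj_point (tensor_vec x y) = segre_point p q \<and>
      w = segre_point (proj_act A p) q"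
  then obtain p q where pq: "p \<in> Z" "q \<in> proj_space m"
      "proj_point (tensor_vec x y) = segre_point p q" "w = segre_point (proj_act A p) q" by blast
  obtain x' where x': "x' \<in> carrier_vec n" "x' \<noteq> 0\<^sub>v n" "p = proj_point x'"
    using pq(1) Z proj_spaceE by blast
  obtain y' where y': "y' \<in> carrier_vec m" "y' \<noteq> 0\<^sub>v m" "q = proj_point y'"
    using pq(2) proj_spaceE by blast
  have "x \<noteq> 0\<^sub>v n"
  proof
    assume "x = 0\<^sub>v n"
    then have "proj_point x = {0\<^sub>v n}" unfolding proj_point_def by (auto intro!: exI[of _ 1])
    moreover obtain u where "u \<in> carrier_vec n" "u \<noteq> 0\<^sub>v n" "proj_point x = proj_point u"
      using x(2) Z proj_spaceE by blast
    ultimately show False using proj_point_self[of u] by auto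
  qed
  then obtain a b where ab: "a \<noteq> 0" "b \<noteq> 0" "x' = a \<cdot>\<^sub>v x" "y' = b \<cdot>\<^sub>v y"
    using tensor_vec_eqD[OF x(1) _ y x'(1,2) y'(1,2)] pq(3)
      segre_point_proj_point[OF x'(1) y'(1)] x'(3) y'(3) by metis
  have "p = proj_point x" "q = proj_point y"
    using ab proj_point_scale x'(3) y'(3) by auto
  then show "w = proj_point (tensor_vec (A *\<^sub>v x) y)"
    using pq(4) segre_point_proj_point[OF Ax y(1)] proj_act_point[OF A x(1)] by simp
qed


section \<open>Birational maps onto Segre products\<close>

text \<open>
  Column \<open>j\<close> of the tensor \<open>x \<otimes> y\<close> is \<open>y\<^sub>j x\<close> and row \<open>i\<close> is \<open>x\<^sub>i y\<close>. Evaluating a bihomogeneous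
  polynomial at this column and this row therefore gives a polynomial in the tensor that agrees with
  the original one up to powers of \<open>x\<^sub>i\<close> and \<open>y\<^sub>j\<close>.
\<close>

lemma bihom_poly_on_segre:
  fixes f :: "'a :: field vec \<Rightarrow> 'a vec \<Rightarrow> 'a"
  assumes f: "bihom_poly n m a b f" and ij: "i < n" "j < m"
  shows "hom_poly (n * m) (a + b)
      (\<lambda>z. f (vec n (\<lambda>k. z $ (m * k + j))) (vec m (\<lambda>l. z $ (m * i + l))))"
    and "\<lbrakk>x \<in> carrier_vec n; y \<in> carrier_vec m\<rbrakk> \<Longrightarrow>
      f (vec n (\<lambda>k. tensor_vec x y $ (m * k + j))) (vec m (\<lambda>l. tensor_vec x y $ (m * i + l))) =
        y $ j ^ a * x $ i ^ b * f x y"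
proof -
  show "hom_poly (n * m) (a + b)
      (\<lambda>z. f (vec n (\<lambda>k. z $ (m * k + j))) (vec m (\<lambda>l. z $ (m * i + l))))"
  proof -
    have "hom_poly (n * m) 1 (\<lambda>z::'a vec. vec n (\<lambda>k. z $ (m * k + j)) $ k)" if "k < n" for k
      using that hom_poly.coord[OF tensor_index_bound[OF that ij(2)]] by simp
    moreover have "hom_poly (n * m) 1 (\<lambda>z::'a vec. vec m (\<lambda>l. z $ (m * i + l)) $ l)" if "l < m" for l
      using that hom_poly.coord[OF tensor_index_bound[OF ij(1) that]] by simp
    ultimately show ?thesis using bihom_poly_subst[OF f, of "n * m" 1 _ 1] by simp
  qed
  assume xy: "x \<in> carrier_vec n" "y \<in> carrier_vec m"
  have "vec n (\<lambda>k. tensor_vec x y $ (m * k + j)) = (y $ j) \<cdot>\<^sub>v x"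
    using xy by (intro eq_vecI) (simp_all add: tensor_vec_index[OF xy _ ij(2)])
  moreover have "vec m (\<lambda>l. tensor_vec x y $ (m * i + l)) = (x $ i) \<cdot>\<^sub>v y"
    using xy by (intro eq_vecI) (simp_all add: tensor_vec_index[OF xy ij(1)])
  ultimately show "f (vec n (\<lambda>k. tensor_vec x y $ (m * k + j)))
      (vec m (\<lambda>l. tensor_vec x y $ (m * i + l))) = y $ j ^ a * x $ i ^ b * f x y"
    using bihom_poly_scale[OF f xy] by simp
qed

lemma bihom_poly_vec_scale:
  assumes "\<And>i. i < r \<Longrightarrow> bihom_poly n m a b (\<lambda>x y. B x y $ i)" "\<And>x y. B x y \<in> carrier_vec r"
    and "x \<in> carrier_vec n" "y \<in> carrier_vec m"
  shows "B (c \<cdot>\<^sub>v x) (d \<cdot>\<^sub>v y) = (c ^ a * d ^ b) \<cdot>\<^sub>v B x y"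
proof (rule eq_vecI)
  have dim: "dim_vec (B x y) = r" for x y using assms(2)[of x y] by simp
  show "dim_vec (B (c \<cdot>\<^sub>v x) (d \<cdot>\<^sub>v y)) = dim_vec ((c ^ a * d ^ b) \<cdot>\<^sub>v B x y)" by (simp add: dim)
  show "B (c \<cdot>\<^sub>v x) (d \<cdot>\<^sub>v y) $ i = ((c ^ a * d ^ b) \<cdot>\<^sub>v B x y) $ i"
    if "i < dim_vec ((c ^ a * d ^ b) \<cdot>\<^sub>v B x y)" for i
    using that bihom_poly_scale[OF assms(1,3,4), of i c d] by (simp add: dim)
qed

lemma hom_poly_vec_scale:
  assumes "\<And>i. i < r \<Longrightarrow> hom_poly n d (\<lambda>x. F x $ i)" "\<And>x. F x \<in> carrier_vec r"
    and "x \<in> carrier_vec n"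
  shows "F (c \<cdot>\<^sub>v x) = c ^ d \<cdot>\<^sub>v F x"
proof (rule eq_vecI)
  have dim: "dim_vec (F x) = r" for x using assms(2)[of x] by simp
  show "dim_vec (F (c \<cdot>\<^sub>v x)) = dim_vec (c ^ d \<cdot>\<^sub>v F x)" by (simp add: dim)
  show "F (c \<cdot>\<^sub>v x) $ i = (c ^ d \<cdot>\<^sub>v F x) $ i" if "i < dim_vec (c ^ d \<cdot>\<^sub>v F x)" for i
    using that hom_poly_scale[OF assms(1,3), of i c] by (simp add: dim)
qed

lemma smult_vec_nonzero:
  fixes c :: "'a :: field"
  assumes "c \<noteq> 0" "x \<in> carrier_vec n" "x \<noteq> 0\<^sub>v n"
  shows "c \<cdot>\<^sub>v x \<noteq> 0\<^sub>v n"
proof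
  obtain i where "i < n" "x $ i \<noteq> 0" using nonzero_vecE assms by blast
  moreover assume "c \<cdot>\<^sub>v x = 0\<^sub>v n"
  ultimately show False
    using assms by (metis carrier_vecD index_smult_vec(1) index_zero_vec(1) mult_eq_0_iff)
qed

text \<open>
  Criterion for birationality in terms of affine cones. The forward map sends \<open>z\<close> to \<open>fx z \<otimes> fy z\<close>, the
  backward map sends \<open>x \<otimes> y\<close> to \<open>B x y\<close>, and \<open>P\<close>, \<open>Q\<close> are the polynomials outside whose zeros
  the two maps are defined. Since each map sends nonzeros of its own polynomial to nonzeros of the other
  one, these two open sets are exchanged without any further shrinking, and it suffices to exhibit a
  single point \<open>z0\<close>. A coordinate \<open>j\<close> of \<open>y\<close> that vanishes nowhere on the open set gives one fixed
  column from which \<open>x\<close> is read off; only the row used for \<open>y\<close> varies with the chart.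
\<close>

theorem equivariantly_birational_segreI:
  fixes fx fy :: "'a :: field vec \<Rightarrow> 'a vec" and B :: "'a vec \<Rightarrow> 'a vec \<Rightarrow> 'a vec"
    and \<Gamma> :: "('g, 'b) monoid_scheme"
  assumes Z: "Z \<subseteq> proj_space n" and j: "j < m"
    and fx: "\<And>z. fx z \<in> carrier_vec n" "\<And>i. i < n \<Longrightarrow> hom_poly r dx (\<lambda>z. fx z $ i)"
    and fy: "\<And>z. fy z \<in> carrier_vec m" "\<And>i. i < m \<Longrightarrow> hom_poly r dy (\<lambda>z. fy z $ i)"
    and B: "\<And>x y. B x y \<in> carrier_vec r" "\<And>i. i < r \<Longrightarrow> bihom_poly n m ex ey (\<lambda>x y. B x y $ i)"
    and P: "hom_poly r dP P" and Q: "bihom_poly n m qx qy Q"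
    and fwd: "\<And>z. \<lbrakk>z \<in> carrier_vec r; z \<noteq> 0\<^sub>v r; P z \<noteq> 0\<rbrakk> \<Longrightarrow>
      fx z \<noteq> 0\<^sub>v n \<and> proj_point (fx z) \<in> Z \<and> fy z \<noteq> 0\<^sub>v m \<and> Q (fx z) (fy z) \<noteq> 0 \<and>
      (\<exists>c. c \<noteq> 0 \<and> B (fx z) (fy z) = c \<cdot>\<^sub>v z)"
    and bwd: "\<And>x y. \<lbrakk>x \<in> carrier_vec n; proj_point x \<in> Z; y \<in> carrier_vec m; Q x y \<noteq> 0\<rbrakk> \<Longrightarrow>
      y $ j \<noteq> 0 \<and> B x y \<noteq> 0\<^sub>v r \<and> P (B x y) \<noteq> 0 \<and>
      (\<exists>a b. a \<noteq> 0 \<and> b \<noteq> 0 \<and> fx (B x y) = a \<cdot>\<^sub>v x \<and> fy (B x y) = b \<cdot>\<^sub>v y)"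
    and nonempty: "z0 \<in> carrier_vec r" "z0 \<noteq> 0\<^sub>v r" "P z0 \<noteq> 0"
    and A: "\<And>g. g \<in> carrier \<Gamma> \<Longrightarrow> A g \<in> carrier_mat n n"
      "\<And>g. g \<in> carrier \<Gamma> \<Longrightarrow> act g = proj_act (A g)"
    and \<rho>: "\<And>g. g \<in> carrier \<Gamma> \<Longrightarrow> \<rho> g \<in> carrier_mat r r"
    and equiv: "\<And>g z. \<lbrakk>g \<in> carrier \<Gamma>; z \<in> carrier_vec r\<rbrakk> \<Longrightarrow>
      fx (\<rho> g *\<^sub>v z) = A g *\<^sub>v fx z \<and> fy (\<rho> g *\<^sub>v z) = fy z"
  shows "equivariantly_birational \<Gamma> r (proj_space r) (\<lambda>g. proj_act (\<rho> g))
    (n * m) (segre_product Z (proj_space m)) (left_act Z (proj_space m) act)"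
proof -
  define F where "F z = tensor_vec (fx z) (fy z)" for z
  define row where "row i = (\<lambda>z :: 'a vec. vec m (\<lambda>l. z $ (m * i + l)))" for i
  define col where "col = (\<lambda>z :: 'a vec. vec n (\<lambda>k. z $ (m * k + j)))"
  define S where "S = (\<lambda>i z. Q (col z) (row i z)) ` {..<n}"
  let ?Z' = "segre_product Z (proj_space m)"
  define U where "U = proj_space r - proj_zero_locus r {P}"
  define U' where "U' = ?Z' - proj_zero_locus (n * m) S"
  define f where "f p = proj_point (F (SOME z. z \<in> p))" for p
  define rep where "rep p xy \<longleftrightarrow> fst xy \<in> carrier_vec n \<and> fst xy \<noteq> 0\<^sub>v n \<and> snd xy \<in> carrier_vec m \<and>
    snd xy \<noteq> 0\<^sub>v m \<and> p = proj_point (tensor_vec (fst xy) (snd xy))"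
    for p and xy :: "'a vec \<times> 'a vec"
  \<comment> \<open>A point of the Segre product is represented by an arbitrary pair of vectors; the value does not
    depend on the choice because \<open>B\<close> is bihomogeneous.\<close>
  define f' where "f' p = proj_point (B (fst (SOME xy. rep p xy)) (snd (SOME xy. rep p xy)))" for p

  have F_carrier: "F z \<in> carrier_vec (n * m)" for z
    unfolding F_def using tensor_vec_carrier[OF fx(1) fy(1)] .
  have F_poly: "hom_poly r (dx + dy) (\<lambda>z. F z $ k)" if "k < n * m" for k
  proof -
    have "0 < m" "k div m < n" using that by (auto simp: less_mult_imp_div_less intro: Nat.gr0I)
    then have "hom_poly r (dx + dy) (\<lambda>z. fx z $ (k div m) * fy z $ (k mod m))"
      by (intro hom_poly.mult fx(2) fy(2)) auto
    moreover have "F z $ k = fx z $ (k div m) * fy z $ (k mod m)" for z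
      unfolding F_def tensor_vec_def using fx(1)[of z] fy(1)[of z] that by auto
    ultimately show ?thesis by simp
  qed
  have F_scale: "F (c \<cdot>\<^sub>v z) = c ^ (dx + dy) \<cdot>\<^sub>v F z" if "z \<in> carrier_vec r" for c z
    using F_poly F_carrier that by (rule hom_poly_vec_scale)
  have B_scale: "B (c \<cdot>\<^sub>v x) (d \<cdot>\<^sub>v y) = (c ^ ex * d ^ ey) \<cdot>\<^sub>v B x y"
    if "x \<in> carrier_vec n" "y \<in> carrier_vec m" for c d x y
    using B(2,1) that by (rule bihom_poly_vec_scale)
  have f_point: "f (proj_point z) = proj_point (F z)" if z: "z \<in> carrier_vec r" for z
  proof -
    have "(SOME z'. z' \<in> proj_point z) \<in> proj_point z"
      using proj_point_self[of z] by (rule someI)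
    then obtain c where c: "c \<noteq> 0" "(SOME z'. z' \<in> proj_point z) = c \<cdot>\<^sub>v z"
      using mem_proj_pointD by blast
    show ?thesis
      unfolding f_def c(2) F_scale[OF z]
      using c(1) by (intro proj_point_scale) auto
  qed
  have f'_point: "f' (proj_point (tensor_vec x y)) = proj_point (B x y)"
    if x: "x \<in> carrier_vec n" "x \<noteq> 0\<^sub>v n" and y: "y \<in> carrier_vec m" "y \<noteq> 0\<^sub>v m" for x y
  proof -
    let ?xy = "SOME xy. rep (proj_point (tensor_vec x y)) xy"
    have "rep (proj_point (tensor_vec x y)) (x, y)" unfolding rep_def using x y by simp
    then have xy: "rep (proj_point (tensor_vec x y)) ?xy" by (rule someI)
    then have r: "fst ?xy \<in> carrier_vec n" "fst ?xy \<noteq> 0\<^sub>v n" "snd ?xy \<in> carrier_vec m"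
      "snd ?xy \<noteq> 0\<^sub>v m" "proj_point (tensor_vec x y) = proj_point (tensor_vec (fst ?xy) (snd ?xy))"
      unfolding rep_def by simp_all
    obtain a b where ab: "a \<noteq> 0" "b \<noteq> 0" "fst ?xy = a \<cdot>\<^sub>v x" "snd ?xy = b \<cdot>\<^sub>v y"
      using tensor_vec_eqD[OF x y r] .
    show ?thesis
      unfolding f'_def ab(3,4) B_scale[OF x(1) y(1)]
      using ab(1,2) by (intro proj_point_scale) auto
  qed
  have U_iff: "proj_point z \<in> U \<longleftrightarrow> P z \<noteq> 0" if "z \<in> carrier_vec r" "z \<noteq> 0\<^sub>v r" for z
    unfolding U_def using proj_point_in_zero_locus[OF that, of "{P}"] P proj_space_memI[OF that]
    by auto
  have S_poly: "\<exists>d. hom_poly (n * m) d s" if "s \<in> S" for s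
    using that bihom_poly_on_segre(1)[OF Q _ j] unfolding S_def col_def row_def by auto
  have S_val: "Q (col (tensor_vec x y)) (row i (tensor_vec x y)) = y $ j ^ qx * x $ i ^ qy * Q x y"
    if "i < n" "x \<in> carrier_vec n" "y \<in> carrier_vec m" for x y i
    using bihom_poly_on_segre(2)[OF Q that(1) j that(2,3)] unfolding col_def row_def .
  have U'_iff: "proj_point (tensor_vec x y) \<in> U' \<longleftrightarrow> Q x y \<noteq> 0"
    if x: "x \<in> carrier_vec n" "x \<noteq> 0\<^sub>v n" "proj_point x \<in> Z" and y: "y \<in> carrier_vec m" "y \<noteq> 0\<^sub>v m"
    for x y
  proof -
    obtain i where i: "i < n" "x $ i \<noteq> 0" using nonzero_vecE[OF x(1,2)] .
    have "proj_point (tensor_vec x y) \<in> U' \<longleftrightarrow> (\<exists>s\<in>S. s (tensor_vec x y) \<noteq> 0)"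
      unfolding U'_def using proj_point_in_zero_locus[OF tensor_vec_carrier[OF x(1) y(1)]
          tensor_vec_nonzero[OF x(1,2) y] S_poly] segre_product_memI[OF x(1,3) y] by auto
    also have "\<dots> \<longleftrightarrow> (\<exists>i<n. y $ j ^ qx * x $ i ^ qy * Q x y \<noteq> 0)"
      unfolding S_def using S_val[OF _ x(1) y(1)] by auto
    also have "\<dots> \<longleftrightarrow> Q x y \<noteq> 0"
      using i bwd[OF x(1,3) y(1)] by auto
    finally show ?thesis .
  qed
  have U'E: thesis
    if "p \<in> U'" and "\<And>x y. \<lbrakk>x \<in> carrier_vec n; x \<noteq> 0\<^sub>v n; proj_point x \<in> Z; y \<in> carrier_vec m; y \<noteq> 0\<^sub>v m;
      Q x y \<noteq> 0; p = proj_point (tensor_vec x y)\<rbrakk> \<Longrightarrow> thesis" for p thesis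
  proof -
    have "p \<in> ?Z'" using that(1) unfolding U'_def by blast
    then show ?thesis using that U'_iff segre_productE[OF _ Z] by (metis (no_types, lifting))
  qed
  have UE: thesis
    if "p \<in> U" and "\<And>z. \<lbrakk>z \<in> carrier_vec r; z \<noteq> 0\<^sub>v r; P z \<noteq> 0; p = proj_point z\<rbrakk> \<Longrightarrow> thesis"
    for p thesis
  proof -
    have "p \<in> proj_space r" using that(1) unfolding U_def by blast
    then show ?thesis using that U_iff proj_spaceE by (metis (no_types, lifting))
  qed
  have F_nz: "F z \<noteq> 0\<^sub>v (n * m)" if "z \<in> carrier_vec r" "z \<noteq> 0\<^sub>v r" "P z \<noteq> 0" for z
    unfolding F_def using tensor_vec_nonzero[OF fx(1) _ fy(1)] fwd[OF that] by blast
  have fU: "f p \<in> U'" "f' (f p) = p" if p: "p \<in> U" for p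
  proof -
    obtain z where z: "z \<in> carrier_vec r" "z \<noteq> 0\<^sub>v r" "P z \<noteq> 0" "p = proj_point z"
      using UE[OF p] .
    note * = fwd[OF z(1-3)]
    have f: "f p = proj_point (tensor_vec (fx z) (fy z))"
      unfolding z(4) f_point[OF z(1)] F_def ..
    show "f p \<in> U'" unfolding f using U'_iff[OF fx(1) _ _ fy(1)] * by blast
    have "f' (f p) = proj_point (B (fx z) (fy z))"
      unfolding f using f'_point[OF fx(1) _ fy(1)] * by blast
    then show "f' (f p) = p" unfolding z(4) using * proj_point_scale by metis
  qed
  have f'U: "f' p \<in> U" "f (f' p) = p" if p': "p \<in> U'" for p
  proof -
    obtain x y where x: "x \<in> carrier_vec n" "x \<noteq> 0\<^sub>v n" "proj_point x \<in> Z"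
      and y: "y \<in> carrier_vec m" "y \<noteq> 0\<^sub>v m" and Qxy: "Q x y \<noteq> 0"
      and p: "p = proj_point (tensor_vec x y)"
      using U'E[OF p'] .
    note * = bwd[OF x(1,3) y(1) Qxy]
    have f': "f' p = proj_point (B x y)" unfolding p using f'_point[OF x(1,2) y] .
    show "f' p \<in> U" unfolding f' using U_iff[OF B(1)] * by blast
    obtain a b where ab: "a \<noteq> 0" "b \<noteq> 0" "fx (B x y) = a \<cdot>\<^sub>v x" "fy (B x y) = b \<cdot>\<^sub>v y"
      using * by blast
    show "f (f' p) = p"
      unfolding f' f_point[OF B(1)] F_def ab(3,4) tensor_vec_smult[OF x(1) y(1)]
      using ab(1,2) p by (simp add: proj_point_scale)
  qed
  have open_U: "zariski_open_in r (proj_space r) U"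
    unfolding zariski_open_in_def zariski_closed_def U_def using P by (auto intro!: exI[of _ "{P}"])
  have open_U': "zariski_open_in (n * m) ?Z' U'"
    unfolding zariski_open_in_def zariski_closed_def U'_def
    using S_poly by (intro exI[of _ "proj_zero_locus (n * m) S"] conjI exI[of _ S]) auto
  have regular_f: "regular_map r U (n * m) f"
    unfolding regular_map_def
  proof
    fix p assume p: "p \<in> U"
    have "zariski_open_in r U U"
      unfolding zariski_open_in_def zariski_closed_def U_def
      using P by (intro exI[of _ "proj_zero_locus r {P}"] conjI exI[of _ "{P}"]) auto
    moreover have "F z \<in> carrier_vec (n * m) - {0\<^sub>v (n * m)} \<and> f p' = proj_point (F z)"
      if p': "p' \<in> U" and z: "z \<in> p'" for p' z
    proof -
      obtain z' where z': "z' \<in> carrier_vec r" "z' \<noteq> 0\<^sub>v r" "P z' \<noteq> 0" "p' = proj_point z'"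
        using UE[OF p'] .
      obtain c where c: "c \<noteq> 0" "z = c \<cdot>\<^sub>v z'" using z z'(4) mem_proj_pointD by blast
      have z_carr: "z \<in> carrier_vec r" "z \<noteq> 0\<^sub>v r" using c z' smult_vec_nonzero by auto
      have p'z: "p' = proj_point z" unfolding c(2) z'(4) proj_point_scale[OF c(1)] ..
      then show ?thesis
        using F_carrier F_nz[OF z_carr] U_iff[OF z_carr] p' f_point[OF z_carr(1)] by auto
    qed
    ultimately show "\<exists>W d F. zariski_open_in r U W \<and> p \<in> W \<and>
        (\<forall>i<n * m. hom_poly r d (\<lambda>x. F x $ i)) \<and>
        (\<forall>q\<in>W. \<forall>x\<in>q. F x \<in> carrier_vec (n * m) - {0\<^sub>v (n * m)} \<and> f q = proj_point (F x))"
      using p F_poly by (intro exI[of _ U] exI[of _ "dx + dy"] exI[of _ F]) auto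
  qed
  have regular_f': "regular_map (n * m) U' r f'"
    unfolding regular_map_def
  proof
    fix p assume p: "p \<in> U'"
    obtain x y where x: "x \<in> carrier_vec n" "x \<noteq> 0\<^sub>v n" "proj_point x \<in> Z"
      and y: "y \<in> carrier_vec m" "y \<noteq> 0\<^sub>v m" and Qxy: "Q x y \<noteq> 0"
      and pxy: "p = proj_point (tensor_vec x y)"
      using U'E[OF p] .
    obtain i where i: "i < n" "x $ i \<noteq> 0" using nonzero_vecE[OF x(1,2)] .
    \<comment> \<open>On the chart \<open>x\<^sub>i \<noteq> 0\<close> the tensor \<open>x \<otimes> y\<close> has the row \<open>x\<^sub>i y\<close>, and the column \<open>y\<^sub>j x\<close> does
      not vanish on all of \<open>U'\<close>: both factors are read off linearly.\<close>
    define c where "c = (\<lambda>z::'a vec. z $ (m * i + j))"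
    define W where "W = U' - proj_zero_locus (n * m) {c}"
    have c_poly: "hom_poly (n * m) 1 c"
      unfolding c_def using hom_poly.coord[OF tensor_index_bound[OF i(1) j]] .
    have W_iff: "proj_point (tensor_vec x y) \<in> W \<longleftrightarrow> x $ i \<noteq> 0"
      if x: "x \<in> carrier_vec n" "x \<noteq> 0\<^sub>v n" "proj_point x \<in> Z" and y: "y \<in> carrier_vec m" "y \<noteq> 0\<^sub>v m"
      and Qxy: "Q x y \<noteq> 0" for x y
    proof -
      have "proj_point (tensor_vec x y) \<in> W \<longleftrightarrow> c (tensor_vec x y) \<noteq> 0"
        unfolding W_def using proj_point_in_zero_locus[OF tensor_vec_carrier[OF x(1) y(1)]
            tensor_vec_nonzero[OF x(1,2) y], of "{c}"] c_poly U'_iff[OF x y] Qxy by auto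
      also have "\<dots> \<longleftrightarrow> x $ i \<noteq> 0"
        unfolding c_def tensor_vec_index[OF x(1) y(1) i(1) j] using bwd[OF x(1,3) y(1) Qxy] by simp
      finally show ?thesis .
    qed
    define G where "G z = B (col z) (row i z)" for z
    have G_val: "G (tensor_vec x y) = (y $ j ^ ex * x $ i ^ ey) \<cdot>\<^sub>v B x y"
      if "x \<in> carrier_vec n" "y \<in> carrier_vec m" for x y
    proof (rule eq_vecI)
      have dim: "dim_vec (B x y) = r" for x y using B(1)[of x y] by simp
      let ?c = "y $ j ^ ex * x $ i ^ ey"
      show "dim_vec (G (tensor_vec x y)) = dim_vec (?c \<cdot>\<^sub>v B x y)" by (simp add: dim G_def)
      show "G (tensor_vec x y) $ k = (?c \<cdot>\<^sub>v B x y) $ k" if "k < dim_vec (?c \<cdot>\<^sub>v B x y)" for k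
        using that bihom_poly_on_segre(2)[OF B(2) i(1) j \<open>x \<in> carrier_vec n\<close> \<open>y \<in> carrier_vec m\<close>, of k]
        unfolding G_def col_def row_def by (simp add: dim)
    qed
    have "zariski_open_in (n * m) U' W"
      unfolding zariski_open_in_def zariski_closed_def W_def
      using c_poly by (intro exI[of _ "proj_zero_locus (n * m) {c}"] conjI exI[of _ "{c}"]) auto
    moreover have "p \<in> W" unfolding pxy using W_iff[OF x y Qxy] i(2) by blast
    moreover have "hom_poly (n * m) (ex + ey) (\<lambda>z. G z $ k)" if "k < r" for k
      unfolding G_def col_def row_def using bihom_poly_on_segre(1)[OF B(2)[OF that] i(1) j] .
    moreover have "G z \<in> carrier_vec r - {0\<^sub>v r} \<and> f' p' = proj_point (G z)"
      if p': "p' \<in> W" and z: "z \<in> p'" for p' z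
    proof -
      have "p' \<in> U'" using p' unfolding W_def by blast
      then obtain x y where x: "x \<in> carrier_vec n" "x \<noteq> 0\<^sub>v n" "proj_point x \<in> Z"
        and y: "y \<in> carrier_vec m" "y \<noteq> 0\<^sub>v m" and Qxy: "Q x y \<noteq> 0"
        and pxy: "p' = proj_point (tensor_vec x y)"
        by (rule U'E)
      obtain d where d: "d \<noteq> 0" "z = d \<cdot>\<^sub>v tensor_vec x y"
        using z unfolding pxy using mem_proj_pointD by blast
      let ?x = "d \<cdot>\<^sub>v x"
      have x': "?x \<in> carrier_vec n" "?x \<noteq> 0\<^sub>v n" "proj_point ?x \<in> Z"
        using x d(1) smult_vec_nonzero proj_point_scale[OF d(1)] by auto
      have z': "z = tensor_vec ?x y" using d(2) tensor_vec_smult[OF x(1) y(1), of d 1] by simp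
      have p'z: "p' = proj_point (tensor_vec ?x y)"
        unfolding pxy z'[symmetric] d(2) proj_point_scale[OF d(1)] ..
      have Q': "Q ?x y \<noteq> 0" using U'_iff[OF x' y] \<open>p' \<in> U'\<close> p'z by blast
      have nz: "?x $ i \<noteq> 0" "y $ j \<noteq> 0" "B ?x y \<noteq> 0\<^sub>v r"
        using W_iff[OF x' y Q'] p' p'z bwd[OF x'(1,3) y(1) Q'] by blast+
      have s: "y $ j ^ ex * ?x $ i ^ ey \<noteq> 0" using nz by simp
      show ?thesis
        unfolding p'z f'_point[OF x'(1,2) y] z' G_val[OF x'(1) y(1)] proj_point_scale[OF s]
        using smult_vec_nonzero[OF s B(1) nz(3)] B(1)[of ?x y] by simp
    qed
    ultimately show "\<exists>W d F. zariski_open_in (n * m) U' W \<and> p \<in> W \<and>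
        (\<forall>i<r. hom_poly (n * m) d (\<lambda>x. F x $ i)) \<and>
        (\<forall>q\<in>W. \<forall>x\<in>q. F x \<in> carrier_vec r - {0\<^sub>v r} \<and> f' q = proj_point (F x))"
      by (intro exI[of _ W] exI[of _ "ex + ey"] exI[of _ G]) auto
  qed
  have equivariant: "f (proj_act (\<rho> g) p) = left_act Z (proj_space m) act g (f p)"
    if g: "g \<in> carrier \<Gamma>" and p: "p \<in> U" for g p
  proof -
    obtain z where z: "z \<in> carrier_vec r" "z \<noteq> 0\<^sub>v r" "P z \<noteq> 0" "p = proj_point z"
      using UE[OF p] .
    note * = fwd[OF z(1-3)]
    have \<rho>z: "\<rho> g *\<^sub>v z \<in> carrier_vec r" using \<rho>[OF g] z(1) by auto
    have "f (proj_act (\<rho> g) p) = proj_point (tensor_vec (A g *\<^sub>v fx z) (fy z))"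
      unfolding z(4) proj_act_point[OF \<rho>[OF g] z(1)] f_point[OF \<rho>z] F_def
      using equiv[OF g z(1)] by simp
    also have "\<dots> = left_act Z (proj_space m) act g (f p)"
      unfolding z(4) f_point[OF z(1)] F_def
      using left_act_point[where act = act, OF A(1)[OF g] Z fx(1) _ fy(1) _ A(2)[OF g]] * by metis
    finally show ?thesis .
  qed
  have p0: "proj_point z0 \<in> U" using U_iff[OF nonempty(1,2)] nonempty(3) by blast
  then have ne: "U \<noteq> {}" "U' \<noteq> {}" using fU(1) by blast+
  have sub: "f ` U \<subseteq> U'" "f' ` U' \<subseteq> U" using fU(1) f'U(1) by blast+
  show ?thesis
    unfolding equivariantly_birational_def
    by (intro exI[of _ U] exI[of _ U'] exI[of _ f] exI[of _ f'] conjI ballI impI)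
      (use open_U open_U' ne sub regular_f regular_f' fU(2) f'U(2) equivariant in simp_all)
qed


section \<open>Block matrices and averages over a finite group\<close>

definition block_diag :: "'a :: field mat \<Rightarrow> 'a mat \<Rightarrow> 'a mat" where
  "block_diag A B =
     four_block_mat A (0\<^sub>m (dim_row A) (dim_col B)) (0\<^sub>m (dim_row B) (dim_col A)) B"

lemma block_diag_carrier:
  "A \<in> carrier_mat n n \<Longrightarrow> B \<in> carrier_mat m m \<Longrightarrow> block_diag A B \<in> carrier_mat (n + m) (n + m)"
  unfolding block_diag_def by auto

lemma block_diag_one: "block_diag (1\<^sub>m n) (1\<^sub>m m) = 1\<^sub>m (n + m)"
  unfolding block_diag_def by (intro eq_matI) auto

lemma block_diag_mult:
  assumes "A \<in> carrier_mat n n" "B \<in> carrier_mat m m" "A' \<in> carrier_mat n n" "B' \<in> carrier_mat m m"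
  shows "block_diag A B * block_diag A' B' = block_diag (A * A') (B * B')"
  unfolding block_diag_def using assms
  by (subst mult_four_block_mat[where ?nr1.0 = n and ?n1.0 = n and ?n2.0 = m and ?nr2.0 = m and ?nc1.0 = n and ?nc2.0 = m]) auto

lemma block_diag_mult_vec:
  assumes A: "A \<in> carrier_mat n n" and B: "B \<in> carrier_mat m m" and z: "z \<in> carrier_vec (n + m)"
  shows "i < n \<Longrightarrow> (block_diag A B *\<^sub>v z) $ i = (\<Sum>j<n. A $$ (i, j) * z $ j)"
    and "i < m \<Longrightarrow> (block_diag A B *\<^sub>v z) $ (n + i) = (\<Sum>j<m. B $$ (i, j) * z $ (n + j))"
proof -
  let ?a = "vec_first z n" and ?b = "vec_last z m"
  have ab: "?a \<in> carrier_vec n" "?b \<in> carrier_vec m" by auto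
  have "z = ?a @\<^sub>v ?b" using z by simp
  then have "block_diag A B *\<^sub>v z = block_diag A B *\<^sub>v (?a @\<^sub>v ?b)" by simp
  also have "\<dots> = (A *\<^sub>v ?a) @\<^sub>v (B *\<^sub>v ?b)"
    using mult_mat_vec_split[OF A B ab] A B unfolding block_diag_def by simp
  finally have *: "block_diag A B *\<^sub>v z = (A *\<^sub>v ?a) @\<^sub>v (B *\<^sub>v ?b)" .
  show "(block_diag A B *\<^sub>v z) $ i = (\<Sum>j<n. A $$ (i, j) * z $ j)" if "i < n"
    unfolding * using A B z that
    by (auto simp: scalar_prod_def vec_first_def lessThan_atLeast0 intro!: sum.cong)
  show "(block_diag A B *\<^sub>v z) $ (n + i) = (\<Sum>j<m. B $$ (i, j) * z $ (n + j))" if "i < m"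
    unfolding * using A B z that
    by (auto simp: scalar_prod_def vec_last_def lessThan_atLeast0 intro!: sum.cong)
qed

definition transp_act :: "'a :: field mat \<Rightarrow> (nat \<Rightarrow> 'a) \<Rightarrow> nat \<Rightarrow> 'a" where
  "transp_act A c j = (\<Sum>i<4. A $$ (i, j) * c i)"

definition mat_act :: "'a :: field mat \<Rightarrow> (nat \<Rightarrow> 'a) \<Rightarrow> nat \<Rightarrow> 'a" where
  "mat_act A v i = (\<Sum>j<4. A $$ (i, j) * v j)"

lemma transp_act_mult:
  assumes "A \<in> carrier_mat 4 4" "B \<in> carrier_mat 4 4" "i < 4"
  shows "transp_act B (transp_act A c) i = transp_act (A * B) c i"
proof -
  have "transp_act B (transp_act A c) i = (\<Sum>j<4. \<Sum>k<4. A $$ (k, j) * B $$ (j, i) * c k)"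
    unfolding transp_act_def by (simp add: sum_distrib_left mult_ac)
  also have "\<dots> = (\<Sum>k<4. \<Sum>j<4. A $$ (k, j) * B $$ (j, i) * c k)" by (rule sum.swap)
  also have "\<dots> = transp_act (A * B) c i"
    unfolding transp_act_def using assms
    by (auto simp: scalar_prod_def lessThan_atLeast0 sum_distrib_right intro!: sum.cong)
  finally show ?thesis .
qed

text \<open>
  For each \<open>g\<close> some \<open>2 \<times> 2\<close> minor of \<open>(x\<^sub>0, y\<^sub>g)\<close> is nonzero. Replacing \<open>x\<^sub>0\<close> by a variable in
  that minor gives a linear form that vanishes at \<open>y\<^sub>g\<close> and not at \<open>x\<^sub>0\<close>; the product of these forms is
  the required polynomial.
\<close>

lemma exists_separating_form:
  fixes x0 :: "'a :: field vec"
  assumes fin: "finite K"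
    and sep: "\<And>g. g \<in> K \<Longrightarrow> \<exists>i<n. \<exists>j<n. x0 $ i * y g $ j \<noteq> x0 $ j * y g $ i"
  obtains d f where "hom_poly n d f" "f x0 \<noteq> 0" "\<And>g. g \<in> K \<Longrightarrow> f (y g) = 0"
proof -
  have "\<exists>i j. i < n \<and> j < n \<and> x0 $ i * y g $ j \<noteq> x0 $ j * y g $ i" if "g \<in> K" for g
    using sep[OF that] by blast
  then obtain i j where ij: "\<And>g. g \<in> K \<Longrightarrow> i g < n \<and> j g < n \<and> x0 $ i g * y g $ j g \<noteq> x0 $ j g * y g $ i g"
    by metis
  define l where "l g x = x $ i g * y g $ j g - x $ j g * y g $ i g" for g and x :: "'a vec"
  have "hom_poly n 1 (l g)" if "g \<in> K" for g
    unfolding l_def using ij[OF that] by (intro hom_poly_diff hom_poly_cmult_right hom_poly.coord) auto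
  then have "hom_poly n (\<Sum>g\<in>K. 1) (\<lambda>x. \<Prod>g\<in>K. l g x)"
    using fin by (intro hom_poly_prod) auto
  moreover have "(\<Prod>g\<in>K. l g x0) \<noteq> 0" using fin ij unfolding l_def by (auto simp: prod_zero_iff)
  moreover have "(\<Prod>g\<in>K. l g (y k)) = 0" if "k \<in> K" for k
    using that fin unfolding l_def by (intro prod_zero bexI[of _ k]) (auto simp: mult.commute)
  ultimately show ?thesis using that by blast
qed

text \<open>
  Agrees with \<open>A *\<^sub>v x\<close> on vectors of the right dimension. Since every sum has a fixed range, its
  entries are polynomial functions also at vectors of other dimensions, as the predicate \<open>hom_poly\<close>
  requires.
\<close>

definition mat_apply :: "'a :: field mat \<Rightarrow> 'a vec \<Rightarrow> 'a vec" where
  "mat_apply A x = vec (dim_row A) (\<lambda>i. \<Sum>j<dim_col A. A $$ (i, j) * x $ j)"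

lemma mat_apply_eq:
  assumes "A \<in> carrier_mat n m" "x \<in> carrier_vec m"
  shows "mat_apply A x = A *\<^sub>v x"
  unfolding mat_apply_def using assms
  by (intro eq_vecI) (auto simp: scalar_prod_def lessThan_atLeast0 intro!: sum.cong)

lemma hom_poly_mat_apply:
  assumes "A \<in> carrier_mat n n" "hom_poly n d f"
  shows "hom_poly n d (\<lambda>x. f (mat_apply A x))"
proof -
  have "hom_poly n 1 (\<lambda>x::'a vec. mat_apply A x $ i)" if i: "i < n" for i
  proof -
    have "hom_poly n 1 (\<lambda>x::'a vec. \<Sum>j<n. A $$ (i, j) * x $ j)"
      using i by (intro hom_poly_sum hom_poly_cmult hom_poly.coord) auto
    then show ?thesis using i assms(1) unfolding mat_apply_def by auto
  qed
  then show ?thesis using hom_poly_compose[OF assms(2), of n 1] by simp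
qed

definition average_form ::
    "('g, 'b) monoid_scheme \<Rightarrow> ('g \<Rightarrow> 'a :: field mat) \<Rightarrow> ('a vec \<Rightarrow> 'a) \<Rightarrow> 'a vec \<Rightarrow> 'a" where
  "average_form \<Gamma> R f x = (\<Sum>g\<in>carrier \<Gamma>. f (mat_apply (R g) x))"

definition average_covector :: "('g, 'b) monoid_scheme \<Rightarrow> ('g \<Rightarrow> 'a :: field mat) \<Rightarrow>
    ('g \<Rightarrow> 'a mat) \<Rightarrow> ('a vec \<Rightarrow> 'a) \<Rightarrow> (nat \<Rightarrow> 'a) \<Rightarrow> 'a vec \<Rightarrow> nat \<Rightarrow> 'a" where
  "average_covector \<Gamma> R S f e x i = (\<Sum>g\<in>carrier \<Gamma>. f (mat_apply (R g) x) * transp_act (S g) e i)"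

definition matrix_rep :: "('g, 'b) monoid_scheme \<Rightarrow> nat \<Rightarrow> ('g \<Rightarrow> 'a :: field mat) \<Rightarrow> bool" where
  "matrix_rep \<Gamma> n R \<longleftrightarrow> R \<one>\<^bsub>\<Gamma>\<^esub> = 1\<^sub>m n \<and> (\<forall>g\<in>carrier \<Gamma>. R g \<in> carrier_mat n n) \<and>
     (\<forall>g\<in>carrier \<Gamma>. \<forall>h\<in>carrier \<Gamma>. R (g \<otimes>\<^bsub>\<Gamma>\<^esub> h) = R g * R h)"

lemma matrix_repD:
  assumes "matrix_rep \<Gamma> n R"
  shows "R \<one>\<^bsub>\<Gamma>\<^esub> = 1\<^sub>m n" "g \<in> carrier \<Gamma> \<Longrightarrow> R g \<in> carrier_mat n n"
    "g \<in> carrier \<Gamma> \<Longrightarrow> h \<in> carrier \<Gamma> \<Longrightarrow> R (g \<otimes>\<^bsub>\<Gamma>\<^esub> h) = R g * R h"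
  using assms unfolding matrix_rep_def by auto

lemma (in group) matrix_rep_apply_mult:
  assumes R: "matrix_rep G n R" and g: "g \<in> carrier G" and h: "h \<in> carrier G" and x: "x \<in> carrier_vec n"
  shows "mat_apply (R g) (R h *\<^sub>v x) = mat_apply (R (g \<otimes> h)) x"
proof -
  note Rg = matrix_repD(2)[OF R g] and Rh = matrix_repD(2)[OF R h]
  have "R h *\<^sub>v x \<in> carrier_vec n" using Rh x by auto
  then show ?thesis
    using mat_apply_eq[OF Rg] mat_apply_eq[OF mult_carrier_mat[OF Rg Rh] x]
      assoc_mult_mat_vec[OF Rg Rh x] matrix_repD(3)[OF R g h] by simp
qed

lemma GL_carrierI:
  assumes "A \<in> carrier_mat n n" "B \<in> carrier_mat n n" "A * B = 1\<^sub>m n" "B * A = 1\<^sub>m n"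
  shows "A \<in> carrier (GL n)"
  using assms unfolding GL_def units_of_def Units_def ring_mat_def by auto

lemma GL_mult: "A \<otimes>\<^bsub>GL n\<^esub> B = A * B"
  unfolding GL_def units_of_def ring_mat_def by simp

lemma (in group) matrix_rep_hom_GL:
  assumes "matrix_rep G n R"
  shows "R \<in> hom G (GL n)"
proof (rule homI)
  fix g assume g: "g \<in> carrier G"
  then have "R g * R (inv g) = 1\<^sub>m n" "R (inv g) * R g = 1\<^sub>m n"
    using matrix_repD[OF assms] by (metis inv_closed r_inv, metis inv_closed l_inv)
  then show "R g \<in> carrier (GL n)"
    using matrix_repD(2)[OF assms] g by (intro GL_carrierI[of _ _ "R (inv g)"]) auto
next
  fix g h assume "g \<in> carrier G" "h \<in> carrier G"
  then show "R (g \<otimes> h) = R g \<otimes>\<^bsub>GL n\<^esub> R h"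
    using matrix_repD(3)[OF assms] by (simp add: GL_mult)
qed

lemma matrix_rep_block_diag:
  assumes "matrix_rep \<Gamma> n R" "matrix_rep \<Gamma> m S"
  shows "matrix_rep \<Gamma> (n + m) (\<lambda>g. block_diag (R g) (S g))"
  using matrix_repD[OF assms(1)] matrix_repD[OF assms(2)] unfolding matrix_rep_def
  by (auto simp: block_diag_one intro!: block_diag_carrier block_diag_mult[symmetric])

lemma matrix_rep_trivial: "matrix_rep \<Gamma> n (\<lambda>g. 1\<^sub>m n)"
  unfolding matrix_rep_def by auto

lemma (in group) sum_right_translate:
  assumes "h \<in> carrier G"
  shows "(\<Sum>g\<in>carrier G. F (g \<otimes> h)) = (\<Sum>g\<in>carrier G. F g)"
  using assms
  by (intro sum.reindex_bij_witness[of _ "\<lambda>g. g \<otimes> inv h" "\<lambda>g. g \<otimes> h"]) (auto simp: m_assoc)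

lemma (in group) average_form_invariant:
  assumes R: "matrix_rep G n R" and h: "h \<in> carrier G" and x: "x \<in> carrier_vec n"
  shows "average_form G R f (R h *\<^sub>v x) = average_form G R f x"
proof -
  have "average_form G R f (R h *\<^sub>v x) = (\<Sum>g\<in>carrier G. f (mat_apply (R (g \<otimes> h)) x))"
    unfolding average_form_def
  proof (intro sum.cong refl)
    fix g assume g: "g \<in> carrier G"
    show "f (mat_apply (R g) (R h *\<^sub>v x)) = f (mat_apply (R (g \<otimes> h)) x)"
      using matrix_rep_apply_mult[OF R g h x] by simp
  qed
  then show ?thesis unfolding average_form_def sum_right_translate[OF h, of "\<lambda>g. f (mat_apply (R g) x)"] .
qed

text \<open>
  Covectors are moved by transposes, which reverse the order of multiplication, so the translation
  \<open>g \<mapsto> g h\<close> of the summation index absorbs \<open>S h\<close>. Stated with the transpose of \<open>S h\<close> on the left,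
  equivariance involves no inverse.
\<close>

lemma (in group) average_covector_equivariant:
  assumes R: "matrix_rep G n R" and S: "matrix_rep G 4 S" and h: "h \<in> carrier G"
    and x: "x \<in> carrier_vec n" and i: "i < 4"
  shows "transp_act (S h) (average_covector G R S f e (R h *\<^sub>v x)) i = average_covector G R S f e x i"
proof -
  have "transp_act (S h) (average_covector G R S f e (R h *\<^sub>v x)) i =
      (\<Sum>g\<in>carrier G. f (mat_apply (R g) (R h *\<^sub>v x)) * transp_act (S h) (transp_act (S g) e) i)"
    unfolding transp_act_def[of "S h"] average_covector_def
    by (subst sum_distrib_left, subst sum.swap)
      (simp add: transp_act_def sum_distrib_left sum_distrib_right mult_ac)
  also have "\<dots> = (\<Sum>g\<in>carrier G. f (mat_apply (R (g \<otimes> h)) x) * transp_act (S (g \<otimes> h)) e i)"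
  proof (intro sum.cong refl)
    fix g assume g: "g \<in> carrier G"
    show "f (mat_apply (R g) (R h *\<^sub>v x)) * transp_act (S h) (transp_act (S g) e) i =
        f (mat_apply (R (g \<otimes> h)) x) * transp_act (S (g \<otimes> h)) e i"
      using matrix_rep_apply_mult[OF R g h x] matrix_repD(3)[OF S g h]
        transp_act_mult[OF matrix_repD(2)[OF S g] matrix_repD(2)[OF S h] i] by simp
  qed
  also have "\<dots> = average_covector G R S f e x i"
    unfolding average_covector_def
    by (rule sum_right_translate[OF h, of "\<lambda>g. f (mat_apply (R g) x) * transp_act (S g) e i"])
  finally show ?thesis .
qed

lemma average_form_hom_poly:
  assumes "finite (carrier \<Gamma>)" "carrier \<Gamma> \<noteq> {}" "matrix_rep \<Gamma> n R" "hom_poly n d f"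
  shows "hom_poly n d (average_form \<Gamma> R f)"
  unfolding average_form_def
  by (intro hom_poly_sum assms(1,2) hom_poly_mat_apply[OF _ assms(4)] matrix_repD(2)[OF assms(3)])

lemma average_covector_hom_poly:
  assumes "finite (carrier \<Gamma>)" "carrier \<Gamma> \<noteq> {}" "matrix_rep \<Gamma> n R" "hom_poly n d f"
  shows "hom_poly n d (\<lambda>x. average_covector \<Gamma> R S f e x i)"
  unfolding average_covector_def
  by (intro hom_poly_sum assms(1,2) hom_poly_cmult_right hom_poly_mat_apply[OF _ assms(4)]
      matrix_repD(2)[OF assms(3)])


section \<open>Lagrangian planes in symplectic four-space\<close>

text \<open>
  Vectors of \<open>W\<close> and covectors are functions on the indices below 4, whose other values never enter.
  This keeps all formulas polynomial in the entries; \<open>mat4\<close> passes to matrices where the group acts.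
\<close>

definition dot :: "(nat \<Rightarrow> 'a :: comm_ring_1) \<Rightarrow> (nat \<Rightarrow> 'a) \<Rightarrow> 'a" where
  "dot a b = (\<Sum>i<4. a i * b i)"

definition symp_form :: "(nat \<Rightarrow> 'a :: comm_ring_1) \<Rightarrow> (nat \<Rightarrow> 'a) \<Rightarrow> 'a" where
  "symp_form a b = a 0 * b 2 + a 1 * b 3 - a 2 * b 0 - a 3 * b 1"

text \<open>
  The vector that represents the covector \<open>c\<close> through the symplectic form, see \<open>symp_sharp\<close>.
\<close>

definition sharp :: "(nat \<Rightarrow> 'a :: comm_ring_1) \<Rightarrow> nat \<Rightarrow> 'a" where
  "sharp c i = (if i < 2 then - c (i + 2) else c (i - 2))"

definition wedge :: "(nat \<Rightarrow> 'a :: comm_ring_1) \<Rightarrow> (nat \<Rightarrow> 'a) \<Rightarrow> nat \<Rightarrow> nat \<Rightarrow> 'a" where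
  "wedge a b i j = a i * b j - a j * b i"

text \<open>
  A bivector as a map from covectors to vectors. For the bivector of a plane its image is that plane.
\<close>

definition contract :: "(nat \<Rightarrow> nat \<Rightarrow> 'a :: comm_ring_1) \<Rightarrow> (nat \<Rightarrow> 'a) \<Rightarrow> nat \<Rightarrow> 'a" where
  "contract M c i = (\<Sum>j<4. M i j * c j)"

abbreviation mat4 :: "(nat \<Rightarrow> nat \<Rightarrow> 'a) \<Rightarrow> 'a mat" where
  "mat4 M \<equiv> mat 4 4 (\<lambda>(i, j). M i j)"

lemma sum_less4: "(\<Sum>i<4. f i) = f 0 + f 1 + f 2 + f (3::nat)"
  for f :: "nat \<Rightarrow> 'a :: comm_monoid_add"
  by (simp add: numeral_eq_Suc add.assoc)

lemma less4_cases: "i < 4 \<longleftrightarrow> i = 0 \<or> i = 1 \<or> i = 2 \<or> i = (3::nat)"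
  by auto

lemma dot_cong:
  "(\<And>i. i < 4 \<Longrightarrow> a i = a' i) \<Longrightarrow> (\<And>i. i < 4 \<Longrightarrow> b i = b' i) \<Longrightarrow> dot a b = dot a' b'"
  unfolding dot_def by simp

lemma symp_cong:
  "(\<And>i. i < 4 \<Longrightarrow> a i = a' i) \<Longrightarrow> (\<And>i. i < 4 \<Longrightarrow> b i = b' i) \<Longrightarrow> symp_form a b = symp_form a' b'"
  unfolding symp_form_def by simp

lemma contract_cong:
  "(\<And>j. j < 4 \<Longrightarrow> M i j = M' i j) \<Longrightarrow> (\<And>j. j < 4 \<Longrightarrow> c j = c' j) \<Longrightarrow> contract M c i = contract M' c' i"
  unfolding contract_def by simp

lemma sharp_simps:
  "sharp c 0 = - c 2" "sharp c (Suc 0) = - c 3" "sharp c 2 = c 0" "sharp c 3 = c (Suc 0)"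
  by (simp_all add: sharp_def eval_nat_numeral)

lemma symp_sharp: "symp_form a (sharp c) = dot a c"
  unfolding symp_form_def dot_def sum_less4 by (simp add: sharp_simps)

lemma dot_transp_act: "dot (mat_act A a) c = dot a (transp_act A c)"
  unfolding dot_def mat_act_def transp_act_def sum_less4 by (simp add: algebra_simps)

lemma contract_wedge: "contract (wedge a b) c i = a i * dot b c - b i * dot a c"
  unfolding contract_def wedge_def dot_def sum_less4 by (simp add: algebra_simps)

lemma symp_mat_index:
  "i < 4 \<Longrightarrow> j < 4 \<Longrightarrow> symp_mat $$ (i, j) = (if j = i + 2 then 1 else if i = j + 2 then - 1 else 0)"
  unfolding symp_mat_def less4_cases by (elim disjE) simp_all

lemma symp_mat_carrier [simp]: "symp_mat \<in> carrier_mat 4 4"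
  unfolding symp_mat_def by auto

lemma Sp4D:
  assumes "A \<in> carrier Sp4"
  shows "A \<in> carrier_mat 4 4" "transpose_mat A * symp_mat * A = symp_mat"
  using assms unfolding Sp4_def GL_def units_of_def Units_def ring_mat_def by auto

lemma symp_mat_square: "symp_mat * symp_mat = - 1\<^sub>m 4"
  by (intro eq_matI) (auto simp: symp_mat_def scalar_prod_def less4_cases numeral_eq_Suc)

lemma mat_congruence_index:
  fixes A :: "'a :: field mat"
  assumes A: "A \<in> carrier_mat 4 4" and ij: "i < 4" "j < 4"
  shows "(A * symp_mat * transpose_mat A) $$ (i, j) = symp_form (\<lambda>k. A $$ (i, k)) (\<lambda>k. A $$ (j, k))"
proof -
  have "(A * symp_mat * transpose_mat A) $$ (i, j) =
      (\<Sum>l<4. (\<Sum>k<4. A $$ (i, k) * symp_mat $$ (k, l)) * A $$ (j, l))"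
    using A ij by (simp add: scalar_prod_def lessThan_atLeast0 carrier_matD[OF symp_mat_carrier])
  then show ?thesis unfolding sum_less4 symp_form_def by (simp add: symp_mat_index)
qed

text \<open>
  The symplectic group is closed under transposition: \<open>A\<^sup>T J A = J\<close> says that \<open>- J A\<^sup>T J\<close> is a left
  inverse of \<open>A\<close>, hence it is also a right inverse.
\<close>

lemma transpose_Sp4:
  fixes A :: "'a :: field mat"
  assumes "A \<in> carrier Sp4"
  shows "A * symp_mat * transpose_mat A = symp_mat"
proof -
  note A = Sp4D[OF assms]
  let ?J = "symp_mat :: 'a mat"
  have AT: "transpose_mat A \<in> carrier_mat 4 4" using A(1) by auto
  have J: "?J \<in> carrier_mat 4 4" by simp
  define K where "K = - ?J * transpose_mat A"
  have K: "K \<in> carrier_mat 4 4" unfolding K_def using J AT by (intro mult_carrier_mat) (simp only: uminus_carrier_iff_mat)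
  have "K * ?J * A = - ?J * (transpose_mat A * ?J * A)"
    using assoc_mult_mat[OF K J A(1)] assoc_mult_mat[OF uminus_carrier_mat[OF J] AT mult_carrier_mat[OF J A(1)]]
      assoc_mult_mat[OF AT J A(1)] unfolding K_def by metis
  also have "\<dots> = - (?J * ?J)"
    unfolding A(2) by (rule uminus_mult_left_mat) (simp add: carrier_matD[OF J])
  also have "\<dots> = 1\<^sub>m 4" unfolding symp_mat_square by simp
  finally have "A * (K * ?J) = 1\<^sub>m 4"
    by (rule mat_mult_left_right_inverse[OF mult_carrier_mat[OF K J] A(1)])
  then have "A * K * ?J = 1\<^sub>m 4" using assoc_mult_mat[OF A(1) K J] by simp
  then have "?J * (A * K) = 1\<^sub>m 4"
    by (rule mat_mult_left_right_inverse[OF mult_carrier_mat[OF A(1) K] J])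
  then have "?J * (?J * (A * K)) = ?J" by (simp only: right_mult_one_mat[OF J])
  then have "(?J * ?J) * (A * K) = ?J"
    using assoc_mult_mat[OF J J mult_carrier_mat[OF A(1) K]] by simp
  then have *: "- (A * K) = ?J"
    unfolding symp_mat_square using mult_carrier_mat[OF A(1) K] by (simp add: carrier_matD[OF A(1)])
  have "A * K = A * (- (?J * transpose_mat A))"
    unfolding K_def by (intro arg_cong[of _ _ "(*) A"] uminus_mult_left_mat)
      (simp only: index_transpose_mat carrier_matD[OF J] carrier_matD[OF A(1)])
  also have "\<dots> = - (A * (?J * transpose_mat A))"
    by (rule uminus_mult_right_mat) (use A(1) in \<open>simp add: carrier_matD[OF J]\<close>)
  also have "A * (?J * transpose_mat A) = A * ?J * transpose_mat A"
    using assoc_mult_mat[OF A(1) J AT] by simp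
  finally show ?thesis using * by simp
qed

lemma symp_columns:
  fixes A :: "'a :: field mat"
  assumes "A \<in> carrier Sp4" "i < 4" "j < 4"
  shows "symp_form (\<lambda>k. A $$ (k, i)) (\<lambda>k. A $$ (k, j)) = symp_mat $$ (i, j)"
proof -
  note A = Sp4D[OF assms(1)]
  then show ?thesis
    using mat_congruence_index[of "transpose_mat A" i j] assms(2,3) A by (auto simp: symp_form_def)
qed

lemma symp_rows:
  fixes A :: "'a :: field mat"
  assumes "A \<in> carrier Sp4" "i < 4" "j < 4"
  shows "symp_form (\<lambda>k. A $$ (i, k)) (\<lambda>k. A $$ (j, k)) = symp_mat $$ (i, j)"
  using mat_congruence_index[OF Sp4D(1)[OF assms(1)] assms(2,3)] transpose_Sp4[OF assms(1)] by simp

lemma symp_mat_act: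
  assumes "A \<in> carrier Sp4"
  shows "symp_form (mat_act A a) (mat_act A b) = symp_form a b"
proof -
  have "symp_form (mat_act A a) (mat_act A b) =
      (\<Sum>i<4. \<Sum>j<4. a i * b j * symp_form (\<lambda>k. A $$ (k, i)) (\<lambda>k. A $$ (k, j)))"
    unfolding symp_form_def mat_act_def sum_less4 by (simp add: algebra_simps)
  also have "\<dots> = (\<Sum>i<4. \<Sum>j<4. a i * b j * symp_mat $$ (i, j))"
    using symp_columns[OF assms] by (intro sum.cong refl) auto
  also have "\<dots> = symp_form a b" unfolding symp_form_def sum_less4 by (simp add: symp_mat_index)
  finally show ?thesis .
qed

text \<open>
  The isomorphism between covectors and vectors is equivariant; this uses the rows of a symplectic
  matrix, whereas invariance of the form itself uses its columns.
\<close>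

lemma mat_act_sharp:
  assumes "A \<in> carrier Sp4" "i < 4"
  shows "mat_act A (sharp (transp_act A c)) i = sharp c i"
proof -
  have "mat_act A (sharp (transp_act A c)) i =
      - (\<Sum>j<4. c j * symp_form (\<lambda>k. A $$ (i, k)) (\<lambda>k. A $$ (j, k)))"
    unfolding symp_form_def mat_act_def sum_less4
    by (simp add: sharp_simps transp_act_def sum_less4 algebra_simps)
  also have "\<dots> = - (\<Sum>j<4. c j * symp_mat $$ (i, j))"
    using symp_rows[OF assms] by (intro arg_cong[of _ _ uminus] sum.cong refl) auto
  also have "\<dots> = sharp c i"
    using assms(2) unfolding sum_less4 less4_cases
    by (elim disjE) (simp_all add: symp_mat_index sharp_simps)
  finally show ?thesis .
qed

lemma wedge_mat_act:
  assumes "A \<in> carrier_mat 4 4"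
  shows "mat4 (wedge (mat_act A a) (mat_act A b)) = A * mat4 (wedge a b) * transpose_mat A"
proof (rule eq_matI)
  fix i j assume "i < dim_row (A * mat4 (wedge a b) * transpose_mat A)"
    "j < dim_col (A * mat4 (wedge a b) * transpose_mat A)"
  then have ij: "i < 4" "j < 4" using assms by auto
  have "(A * mat4 (wedge a b) * transpose_mat A) $$ (i, j) =
      (\<Sum>l<4. (\<Sum>k<4. A $$ (i, k) * wedge a b k l) * A $$ (j, l))"
    using assms ij by (simp add: scalar_prod_def lessThan_atLeast0)
  also have "\<dots> = wedge (mat_act A a) (mat_act A b) i j"
    unfolding wedge_def mat_act_def sum_less4 by (simp add: algebra_simps)
  finally show "mat4 (wedge (mat_act A a) (mat_act A b)) $$ (i, j) =
      (A * mat4 (wedge a b) * transpose_mat A) $$ (i, j)"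
    using ij by simp
qed (use assms in auto)

lemma eq_uminus_self_imp_zero:
  fixes x :: "'a :: field_char_0"
  assumes "x = - x"
  shows "x = 0"
proof -
  have "x + x = 0" using assms by (metis add.right_inverse)
  then show ?thesis by (simp flip: mult_2)
qed

lemma primitive_mat4_iff:
  fixes M :: "nat \<Rightarrow> nat \<Rightarrow> 'a :: field_char_0"
  shows "mat4 M \<in> primitive_bivectors \<longleftrightarrow>
    (\<forall>i<4. \<forall>j<4. M j i = - M i j) \<and> M 0 2 + M 1 3 = 0"
proof -
  have alt: "transpose_mat (mat4 M) = - mat4 M \<longleftrightarrow> (\<forall>i<4. \<forall>j<4. M j i = - M i j)"
    by (auto simp: mat_eq_iff)
  have diag: "(\<forall>i<4. mat4 M $$ (i, i) = 0)" if a: "\<forall>i<4. \<forall>j<4. M j i = - M i j"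
    using a eq_uminus_self_imp_zero by (metis (no_types, lifting) index_mat(1) case_prod_conv)
  have contr: "(\<Sum>i<4. \<Sum>j<4. symp_mat $$ (i, j) * mat4 M $$ (i, j)) =
      M 0 2 + M 1 3 - M 2 0 - M 3 1"
    unfolding sum_less4 by (simp add: symp_mat_index)
  show ?thesis
  proof (cases "\<forall>i<4. \<forall>j<4. M j i = - M i j")
    case True
    have "M 2 0 = - M 0 2" "M 3 1 = - M 1 3"
      using True[rule_format, of 0 2] True[rule_format, of 1 3] by simp_all
    then have "(\<Sum>i<4. \<Sum>j<4. symp_mat $$ (i, j) * mat4 M $$ (i, j)) = 2 * (M 0 2 + M 1 3)"
      unfolding contr by simp
    moreover have "mat4 M \<in> primitive_bivectors \<longleftrightarrow>
        (\<Sum>i<4. \<Sum>j<4. symp_mat $$ (i, j) * mat4 M $$ (i, j)) = 0"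
      unfolding primitive_bivectors_def using alt[THEN iffD2, OF True] diag[OF True] by simp
    moreover have "2 * x = 0 \<longleftrightarrow> x = 0" for x :: 'a by simp
    ultimately have "mat4 M \<in> primitive_bivectors \<longleftrightarrow> M 0 2 + M 1 3 = 0"
      by (simp only:)
    then show ?thesis using True by blast
  next
    case False
    then show ?thesis using alt unfolding primitive_bivectors_def by blast
  qed
qed

lemma wedge_primitive_iff:
  "mat4 (wedge a b) \<in> primitive_bivectors \<longleftrightarrow> symp_form a b = (0 :: 'a :: field_char_0)"
proof -
  have "wedge a b j i = - wedge a b i j" for i j unfolding wedge_def by simp
  moreover have "wedge a b 0 2 + wedge a b 1 3 = symp_form a b" unfolding wedge_def symp_form_def by simp
  ultimately show ?thesis unfolding primitive_mat4_iff by metis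
qed

lemma pf_wedge: "pf (mat4 (wedge a b)) = 0"
  unfolding pf_def wedge_def by (simp add: algebra_simps)

text \<open>
  For indices \<open>0, 1, 2, 3\<close> this is the vanishing of the Pfaffian; the other cases reduce to it or to
  trivial identities by antisymmetry.
\<close>

lemma alternating_pluecker:
  fixes M :: "nat \<Rightarrow> nat \<Rightarrow> 'a :: field_char_0"
  assumes M: "\<And>i j. i < 4 \<Longrightarrow> j < 4 \<Longrightarrow> M j i = - M i j"
    and pf: "pf (mat4 M) = 0" and ijkl: "i < 4" "j < 4" "k < 4" "l < 4"
  shows "M i k * M j l - M j k * M i l = M i j * M k l"
proof -
  have diag: "M i i = 0" if "i < 4" for i
    using M[OF that that] by (rule eq_uminus_self_imp_zero)
  have d: "M 0 0 = 0" "M 1 1 = 0" "M 2 2 = 0" "M 3 3 = 0" using diag by simp_all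
  have a: "M 1 0 = - M 0 1" "M 2 0 = - M 0 2" "M 3 0 = - M 0 3"
    "M 2 1 = - M 1 2" "M 3 1 = - M 1 3" "M 3 2 = - M 2 3"
    using M[of 0 1] M[of 0 2] M[of 0 3] M[of 1 2] M[of 1 3] M[of 2 3] by simp_all
  have p: "M 0 2 * M (Suc 0) 3 = M 0 (Suc 0) * M 2 3 + M 0 3 * M (Suc 0) 2"
    using pf unfolding pf_def by (simp add: algebra_simps)
  have "\<forall>i\<in>{0,1,2,3}. \<forall>j\<in>{0,1,2,3}. \<forall>k\<in>{0,1,2,3}. \<forall>l\<in>{0,1,2,3}.
      M i k * M j l - M j k * M i l = M i j * M k l"
    unfolding ball_simps
    by (intro conjI) (simp_all only: d a, (simp_all add: p algebra_simps)?)
  then show ?thesis using ijkl unfolding less4_cases by blast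
qed

text \<open>
  For the bivector of a plane, any two covectors give two vectors of the plane, and this formula
  recovers the bivector from them. It is the contraction of the Pluecker relations with the two
  covectors.
\<close>

lemma wedge_contract:
  fixes M :: "nat \<Rightarrow> nat \<Rightarrow> 'a :: field_char_0"
  assumes M: "\<And>i j. i < 4 \<Longrightarrow> j < 4 \<Longrightarrow> M j i = - M i j" and pf: "pf (mat4 M) = 0"
    and ij: "i < 4" "j < 4"
  shows "wedge (contract M a) (contract M b) i j = dot a (contract M b) * M i j"
proof -
  have "wedge (contract M a) (contract M b) i j =
      (\<Sum>k<4. \<Sum>l<4. a k * b l * (M i k * M j l - M j k * M i l))"
    unfolding wedge_def contract_def by (simp add: sum_product sum_subtractf algebra_simps)
  also have "\<dots> = (\<Sum>k<4. \<Sum>l<4. a k * b l * (M i j * M k l))"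
    using alternating_pluecker[OF M pf ij] by (intro sum.cong refl) simp
  also have "\<dots> = dot a (contract M b) * M i j"
    unfolding dot_def contract_def by (simp add: sum_distrib_left sum_distrib_right mult_ac)
  finally show ?thesis .
qed

lemma dot_contract_alternating:
  fixes M :: "nat \<Rightarrow> nat \<Rightarrow> 'a :: field_char_0"
  assumes M: "\<And>i j. i < 4 \<Longrightarrow> j < 4 \<Longrightarrow> M j i = - M i j"
  shows "dot a (contract M b) = - dot b (contract M a)"
proof -
  have "dot a (contract M b) = (\<Sum>i<4. \<Sum>j<4. - (b j * (M j i * a i)))"
    unfolding dot_def contract_def sum_distrib_left
  proof (intro sum.cong refl)
    fix i j :: nat assume "i \<in> {..<4}" "j \<in> {..<4}"
    then have "M i j = - M j i" using M[of j i] by simp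
    then show "a i * (M i j * b j) = - (b j * (M j i * a i))" by simp
  qed
  also have "\<dots> = (\<Sum>j<4. \<Sum>i<4. - (b j * (M j i * a i)))" by (rule sum.swap)
  also have "\<dots> = - dot b (contract M a)"
    unfolding dot_def contract_def sum_distrib_left sum_negf ..
  finally show ?thesis .
qed

text \<open>
  The symplectic form of two vectors is the sum of the entries \<open>(0, 2)\<close> and \<open>(1, 3)\<close> of their wedge,
  and primitivity is the vanishing of this sum. As \<open>wedge_contract\<close> makes the wedge of two vectors
  of the plane a multiple of its bivector, the plane of a primitive bivector is Lagrangian.
\<close>

lemma symp_contract_primitive:
  fixes M :: "nat \<Rightarrow> nat \<Rightarrow> 'a :: field_char_0"
  assumes M: "mat4 M \<in> primitive_bivectors" and pf: "pf (mat4 M) = 0"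
  shows "symp_form (contract M a) (contract M b) = 0"
proof -
  have alt: "\<And>i j. i < 4 \<Longrightarrow> j < 4 \<Longrightarrow> M j i = - M i j" and tr: "M 0 2 + M 1 3 = 0"
    using M unfolding primitive_mat4_iff by blast+
  have "symp_form (contract M a) (contract M b) =
      wedge (contract M a) (contract M b) 0 2 + wedge (contract M a) (contract M b) 1 3"
    unfolding symp_form_def wedge_def by simp
  also have "\<dots> = dot a (contract M b) * (M 0 2 + M 1 3)"
    using wedge_contract[of M, OF alt pf] by (simp add: distrib_left)
  finally show ?thesis using tr by simp
qed


section \<open>The quadric of Lagrangian planes and frames of its tautological bundle\<close>

lemma bihom_poly_fst_only:
  assumes "bihom_poly n m d b (\<lambda>x y. f x)"
  shows "hom_poly n d f"
proof -
  have "hom_poly n (d * 1 + b * 0) (\<lambda>z. f z)"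
  proof (rule bihom_poly_subst[OF assms, where Y = "\<lambda>z. 0\<^sub>v m"])
    show "hom_poly n 0 (\<lambda>z::'a vec. (0\<^sub>v m :: 'a vec) $ i)" if "i < m" for i
      by (rule hom_poly.const)
  qed (rule hom_poly.coord)
  then show ?thesis by simp
qed

lemma bihom_poly_dot:
  assumes "\<And>i. i < 4 \<Longrightarrow> bihom_poly n m a b (\<lambda>x y. f x y i)"
    "\<And>i. i < 4 \<Longrightarrow> bihom_poly n m a' b' (\<lambda>x y. g x y i)" "d = a + a'" "d' = b + b'"
  shows "bihom_poly n m d d' (\<lambda>x y. dot (f x y) (g x y))"
  unfolding dot_def using assms
  by (intro bihom_poly_sum bihom_poly_mult_deg[OF assms(1,2)]) (auto simp: lessThan_empty_iff)

lemma bihom_poly_symp: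
  assumes "\<And>i. i < 4 \<Longrightarrow> bihom_poly n m a b (\<lambda>x y. f x y i)"
    "\<And>i. i < 4 \<Longrightarrow> bihom_poly n m a' b' (\<lambda>x y. g x y i)" "d = a + a'" "d' = b + b'"
  shows "bihom_poly n m d d' (\<lambda>x y. symp_form (f x y) (g x y))"
  unfolding symp_form_def
  by (intro bihom_poly_diff bihom_poly.add bihom_poly_mult_deg[OF assms(1,2)] assms(3,4)) auto

lemma bihom_poly_wedge:
  assumes "\<And>i. i < 4 \<Longrightarrow> bihom_poly n m a b (\<lambda>x y. f x y i)"
    "\<And>i. i < 4 \<Longrightarrow> bihom_poly n m a' b' (\<lambda>x y. g x y i)" "d = a + a'" "d' = b + b'" "i < 4" "j < 4"
  shows "bihom_poly n m d d' (\<lambda>x y. wedge (f x y) (g x y) i j)"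
  unfolding wedge_def
  by (intro bihom_poly_diff bihom_poly_mult_deg[OF assms(1,2)] assms)

lemma bihom_poly_contract:
  assumes "\<And>i j. i < 4 \<Longrightarrow> j < 4 \<Longrightarrow> bihom_poly n m a b (\<lambda>x y. M x y i j)"
    "\<And>i. i < 4 \<Longrightarrow> bihom_poly n m a' b' (\<lambda>x y. g x y i)" "d = a + a'" "d' = b + b'" "i < 4"
  shows "bihom_poly n m d d' (\<lambda>x y. contract (M x y) (g x y) i)"
  unfolding contract_def using assms
  by (intro bihom_poly_sum bihom_poly_mult_deg[OF assms(1,2)]) (auto simp: lessThan_empty_iff)

lemma bihom_poly_sharp:
  assumes "\<And>i. i < 4 \<Longrightarrow> bihom_poly n m a b (\<lambda>x y. f x y i)" "i < 4"
  shows "bihom_poly n m a b (\<lambda>x y. sharp (f x y) i)"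
proof (cases "i < 2")
  case True
  then show ?thesis using bihom_poly_cmult[OF assms(1)[of "i + 2"], of "- 1"] by (simp add: sharp_def)
next
  case False
  then show ?thesis using assms(1)[of "i - 2"] assms(2) by (simp add: sharp_def)
qed

text \<open>
  The isometry between primitive bivectors and \<open>k\<^sup>5\<close> and its inverse, in coordinates. Explicit
  coefficient arrays make both maps visibly linear on all matrices and vectors.
\<close>

definition from_mat :: "(nat \<Rightarrow> nat \<Rightarrow> nat \<Rightarrow> 'a :: field) \<Rightarrow> (nat \<Rightarrow> nat \<Rightarrow> 'a) \<Rightarrow> 'a vec" where
  "from_mat \<alpha> M = vec 5 (\<lambda>k. \<Sum>i<4. \<Sum>j<4. \<alpha> k i j * M i j)"

definition to_mat :: "(nat \<Rightarrow> nat \<Rightarrow> nat \<Rightarrow> 'a :: field) \<Rightarrow> 'a vec \<Rightarrow> nat \<Rightarrow> nat \<Rightarrow> 'a" where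
  "to_mat \<beta> x i j = (\<Sum>k<5. \<beta> i j k * x $ k)"

lemma from_mat_scale:
  assumes "\<And>i j. i < 4 \<Longrightarrow> j < 4 \<Longrightarrow> M i j = c * M' i j"
  shows "from_mat \<alpha> M = c \<cdot>\<^sub>v from_mat \<alpha> M'"
  unfolding from_mat_def using assms
  by (intro eq_vecI) (simp_all add: sum_distrib_left mult_ac)

lemma to_mat_scale: "x \<in> carrier_vec 5 \<Longrightarrow> to_mat \<beta> (c \<cdot>\<^sub>v x) i j = c * to_mat \<beta> x i j"
  unfolding to_mat_def by (simp add: sum_distrib_left mult_ac)

text \<open>
  The point \<open>(v, t)\<close> of \<open>W \<oplus> k\<close>. The extra coordinate homogenizes functions on \<open>W\<close> and is fixed by
  the group.
\<close>

definition cone :: "(nat \<Rightarrow> 'a) \<Rightarrow> 'a \<Rightarrow> 'a vec" where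
  "cone v t = vec 5 (\<lambda>i. if i < 4 then v i else t)"

lemma mat_act_cong: "(\<And>j. j < 4 \<Longrightarrow> v j = v' j) \<Longrightarrow> mat_act B v i = mat_act B v' i"
  unfolding mat_act_def by simp

lemma sharp_cong: "(\<And>j. j < 4 \<Longrightarrow> c j = c' j) \<Longrightarrow> i < 4 \<Longrightarrow> sharp c i = sharp c' i"
  unfolding sharp_def by simp

lemma bihom_poly_from_mat:
  assumes "\<And>i j. i < 4 \<Longrightarrow> j < 4 \<Longrightarrow> bihom_poly n m a b (\<lambda>x y. M x y i j)" "k < 5"
  shows "bihom_poly n m a b (\<lambda>x y. from_mat \<alpha> (M x y) $ k)"
  unfolding from_mat_def using assms
  by (auto intro!: bihom_poly_sum bihom_poly_cmult simp: lessThan_empty_iff)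

lemma bihom_poly_to_mat:
  assumes "\<And>k. k < 5 \<Longrightarrow> bihom_poly n m a b (\<lambda>x y. X x y $ k)"
  shows "bihom_poly n m a b (\<lambda>x y. to_mat \<beta> (X x y) i j)"
  unfolding to_mat_def using assms
  by (auto intro!: bihom_poly_sum bihom_poly_cmult simp: lessThan_empty_iff)

lemma bihom_poly_cone:
  assumes "\<And>i. i < 4 \<Longrightarrow> bihom_poly n m a b (\<lambda>x y. v x y i)" "bihom_poly n m a b t" "k < 5"
  shows "bihom_poly n m a b (\<lambda>x y. cone (v x y) (t x y) $ k)"
  unfolding cone_def using assms by (cases "k < 4") auto

text \<open>
  The data left after choosing a splitting: a group acting by \<open>S\<close> on \<open>W\<close> and by \<open>A\<close> on the space of
  the quadric, with an identification of that space with the primitive bivectors that is equivariant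
  and turns \<open>q\<close> into the Pfaffian.
\<close>

locale quadric_of_lagrangians = group G for G :: "('g, 'b) monoid_scheme" (structure) +
  fixes S A :: "'g \<Rightarrow> 'k :: field_char_0 mat" and q :: "'k vec \<Rightarrow> 'k"
    and \<alpha> \<beta> :: "nat \<Rightarrow> nat \<Rightarrow> nat \<Rightarrow> 'k"
  assumes S: "matrix_rep G 4 S" and S_Sp4: "g \<in> carrier G \<Longrightarrow> S g \<in> carrier Sp4"
    and A: "matrix_rep G 5 A"
    and to_mat_primitive: "x \<in> carrier_vec 5 \<Longrightarrow> mat4 (to_mat \<beta> x) \<in> primitive_bivectors"
    and from_to_mat: "x \<in> carrier_vec 5 \<Longrightarrow> from_mat \<alpha> (to_mat \<beta> x) = x"
    and to_from_mat: "\<lbrakk>mat4 M \<in> primitive_bivectors; i < 4; j < 4\<rbrakk> \<Longrightarrow>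
      to_mat \<beta> (from_mat \<alpha> M) i j = M i j"
    and q_from_mat: "mat4 M \<in> primitive_bivectors \<Longrightarrow> q (from_mat \<alpha> M) = pf (mat4 M)"
    and equivariant_from_mat: "\<lbrakk>g \<in> carrier G; mat4 M \<in> primitive_bivectors;
      mat4 M' \<in> primitive_bivectors; mat4 M' = S g * mat4 M * transpose_mat (S g)\<rbrakk> \<Longrightarrow> from_mat \<alpha> M' = A g *\<^sub>v from_mat \<alpha> M"

text \<open>
  Two equivariant families of covectors over the space of the quadric, and an invariant \<open>N\<close> of the same
  degree. Dividing by \<open>N\<close> makes the coordinates \<open>\<langle>v, c\<^sub>i\<rangle>\<close> independent of the vector that represents
  a point of the quadric.
\<close>

locale quadric_frame = quadric_of_lagrangians G S A q \<alpha> \<beta>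
  for G :: "('g, 'b) monoid_scheme" (structure) and S A :: "'g \<Rightarrow> 'k :: field_char_0 mat"
    and q :: "'k vec \<Rightarrow> 'k" and \<alpha> \<beta> :: "nat \<Rightarrow> nat \<Rightarrow> nat \<Rightarrow> 'k" +
  fixes D :: nat and N :: "'k vec \<Rightarrow> 'k" and c1 c2 :: "'k vec \<Rightarrow> nat \<Rightarrow> 'k"
  assumes N_poly: "hom_poly 5 D N"
    and c1_poly: "i < 4 \<Longrightarrow> hom_poly 5 D (\<lambda>x. c1 x i)"
    and c2_poly: "i < 4 \<Longrightarrow> hom_poly 5 D (\<lambda>x. c2 x i)"
    and N_invariant: "\<lbrakk>g \<in> carrier G; x \<in> carrier_vec 5\<rbrakk> \<Longrightarrow> N (A g *\<^sub>v x) = N x"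
    and c1_equivariant: "\<lbrakk>g \<in> carrier G; x \<in> carrier_vec 5; i < 4\<rbrakk> \<Longrightarrow>
      transp_act (S g) (c1 (A g *\<^sub>v x)) i = c1 x i"
    and c2_equivariant: "\<lbrakk>g \<in> carrier G; x \<in> carrier_vec 5; i < 4\<rbrakk> \<Longrightarrow>
      transp_act (S g) (c2 (A g *\<^sub>v x)) i = c2 x i"
begin

text \<open>
  The families \<open>c1\<close>, \<open>c2\<close> form a frame of the dual tautological bundle where \<open>gam\<close> does not vanish, and
  up to this factor \<open>frame p r x\<close> is the vector of the plane \<open>x\<close> with coordinates \<open>p\<close> and \<open>r\<close>, see
  \<open>dot_frame\<close>.
\<close>

definition "gam x = dot (c1 x) (contract (to_mat \<beta> x) (c2 x))"


definition "frame p r x i = p * contract (to_mat \<beta> x) (c2 x) i - r * contract (to_mat \<beta> x) (c1 x) i"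

lemma gam_scale:
  assumes x: "x \<in> carrier_vec 5"
  shows "gam (c \<cdot>\<^sub>v x) = c ^ (2 * D + 1) * gam x"
proof -
  have "contract (to_mat \<beta> (c \<cdot>\<^sub>v x)) (c2 (c \<cdot>\<^sub>v x)) i = c ^ (D + 1) * contract (to_mat \<beta> x) (c2 x) i" for i
    unfolding contract_def to_mat_scale[OF x] using hom_poly_scale[OF c2_poly x]
    by (simp add: sum_distrib_left mult_ac)
  then have "gam (c \<cdot>\<^sub>v x) = dot (\<lambda>i. c ^ D * c1 x i) (\<lambda>i. c ^ (D + 1) * contract (to_mat \<beta> x) (c2 x) i)"
    unfolding gam_def using hom_poly_scale[OF c1_poly x] by (intro dot_cong) auto
  also have "\<dots> = c ^ (2 * D + 1) * gam x"
    unfolding gam_def dot_def mult_2 power_add by (simp add: sum_distrib_left mult_ac)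
  finally show ?thesis .
qed

lemma bihom_poly_gam:
  assumes "\<And>k. k < 5 \<Longrightarrow> bihom_poly n m a b (\<lambda>x y. X x y $ k)"
  shows "bihom_poly n m ((2 * D + 1) * a) ((2 * D + 1) * b) (\<lambda>x y. gam (X x y))"
  unfolding gam_def
  by (rule bihom_poly_dot[OF bihom_poly_compose[OF c1_poly assms]
        bihom_poly_contract[OF bihom_poly_to_mat[OF assms] bihom_poly_compose[OF c2_poly assms]]])
    (auto simp: algebra_simps)

lemma symp_frame:
  assumes x: "x \<in> carrier_vec 5" and qx: "q x = 0"
  shows "symp_form (frame p r x) (frame p' r' x) = 0"
proof -
  have prim: "mat4 (to_mat \<beta> x) \<in> primitive_bivectors" using to_mat_primitive[OF x] .
  have pf: "pf (mat4 (to_mat \<beta> x)) = 0" using q_from_mat[OF prim] from_to_mat[OF x] qx by simp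
  have lin: "symp_form (\<lambda>i. p * a i - r * b i) (\<lambda>i. p' * a i - r' * b i) =
      p * p' * symp_form a a - p * r' * symp_form a b - r * p' * symp_form b a + r * r' * symp_form b b"
    for a b :: "nat \<Rightarrow> 'k"
    unfolding symp_form_def by (simp add: algebra_simps)
  show ?thesis
    unfolding frame_def lin symp_contract_primitive[OF prim pf] by simp
qed

lemma wedge_frame:
  assumes x: "x \<in> carrier_vec 5" and qx: "q x = 0" and ij: "i < 4" "j < 4"
  shows "wedge (frame p r x) (frame p' r' x) i j = (p * r' - r * p') * gam x * to_mat \<beta> x i j"
proof -
  let ?M = "to_mat \<beta> x"
  have prim: "mat4 ?M \<in> primitive_bivectors" using to_mat_primitive[OF x] .
  then have alt: "\<And>i j. i < 4 \<Longrightarrow> j < 4 \<Longrightarrow> ?M j i = - ?M i j" unfolding primitive_mat4_iff by blast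
  have pf: "pf (mat4 ?M) = 0" using q_from_mat[OF prim] from_to_mat[OF x] qx by simp
  have "wedge (frame p r x) (frame p' r' x) i j =
      (p * r' - r * p') * wedge (contract ?M (c1 x)) (contract ?M (c2 x)) i j"
    unfolding wedge_def frame_def by (simp add: algebra_simps)
  also have "wedge (contract ?M (c1 x)) (contract ?M (c2 x)) i j = gam x * ?M i j"
    unfolding gam_def by (rule wedge_contract[of ?M, OF alt pf ij])
  finally show ?thesis by simp
qed

lemma dot_frame:
  assumes x: "x \<in> carrier_vec 5"
  shows "dot (frame p r x) (c1 x) = p * gam x" "dot (frame p r x) (c2 x) = r * gam x"
proof -
  let ?M = "to_mat \<beta> x"
  have alt: "\<And>i j. i < 4 \<Longrightarrow> j < 4 \<Longrightarrow> ?M j i = - ?M i j"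
    using to_mat_primitive[OF x] unfolding primitive_mat4_iff by blast
  note anti = dot_contract_alternating[of ?M, OF alt]
  have self: "dot a (contract ?M a) = 0" for a
    using anti[of a a] by (rule eq_uminus_self_imp_zero)
  have lin: "dot (frame p r x) c = p * dot c (contract ?M (c2 x)) - r * dot c (contract ?M (c1 x))" for c
    unfolding dot_def frame_def by (simp add: algebra_simps sum_subtractf sum_distrib_left)
  show "dot (frame p r x) (c1 x) = p * gam x" unfolding lin self gam_def by simp
  show "dot (frame p r x) (c2 x) = r * gam x"
    unfolding lin self gam_def using anti[of "c1 x" "c2 x"] by simp
qed

end

section \<open>The explicit birational map\<close>

text \<open>
  The third family of covectors, over \<open>W\<close> and homogenized by \<open>t\<close>, gives the direction along which \<open>W\<close>
  is projected to the orthogonal complement of \<open>v\<close>.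
\<close>

locale equivariant_trivialisation = quadric_frame G S A q \<alpha> \<beta> D N c1 c2
  for G :: "('g, 'b) monoid_scheme" (structure) and S A :: "'g \<Rightarrow> 'k :: field_char_0 mat"
    and q :: "'k vec \<Rightarrow> 'k" and \<alpha> \<beta> :: "nat \<Rightarrow> nat \<Rightarrow> nat \<Rightarrow> 'k"
    and D :: nat and N :: "'k vec \<Rightarrow> 'k" and c1 c2 :: "'k vec \<Rightarrow> nat \<Rightarrow> 'k" +
  fixes e :: nat and c0 :: "'k vec \<Rightarrow> nat \<Rightarrow> 'k"
  assumes c0_poly: "i < 4 \<Longrightarrow> hom_poly 5 e (\<lambda>x. c0 x i)"
    and c0_equivariant: "\<lbrakk>g \<in> carrier G; i < 4\<rbrakk> \<Longrightarrow>
      transp_act (S g) (c0 (cone (mat_act (S g) v) t)) i = c0 (cone v t) i"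
begin

text \<open>
  The vector \<open>w\<^sub>0(v)\<close> is \<open>dual v t\<close>, and \<open>height v t\<close> is its pairing with \<open>v\<close>. The projection of \<open>w\<close>
  to the complement of \<open>v\<close> along \<open>w\<^sub>0(v)\<close>, multiplied by \<open>height v t\<close> to be polynomial, is
  \<open>lagr v w t\<close>.
\<close>

definition "height v t = dot v (c0 (cone v t))"
definition "dual v t = sharp (c0 (cone v t))"
definition "lagr v w t i = height v t * w i - symp_form v w * dual v t i"
text \<open>
  A vector of \<open>W \<oplus> W \<oplus> k\<close> has nine coordinates, \<open>(v, w, t)\<close> with \<open>t\<close> in position 8. It is sent to
  the bivector \<open>v \<and> lagr v w t\<close> of a Lagrangian plane together with the coordinates of \<open>v\<close> and
  \<open>lagr v w t\<close> in the frame, the value \<open>\<omega>(v, w)\<close> that the projection forgets, and \<open>t\<close>. The powers of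
  \<open>t\<close> and the factors \<open>N\<close> bring the six fibre coordinates to a common degree.
\<close>

definition "first_part z i = (z :: 'k vec) $ i"
definition "second_part z i = (z :: 'k vec) $ (4 + i)"
definition "lagr_part z = lagr (first_part z) (second_part z) (z $ 8)"

definition "quadric_part z = from_mat \<alpha> (wedge (first_part z) (lagr_part z))"

definition "fibre_part z = (let x = quadric_part z; t = z $ 8 in
  vec 6 (\<lambda>k. [t ^ (e + 1) * dot (first_part z) (c1 x), t ^ (e + 1) * dot (first_part z) (c2 x),
    dot (lagr_part z) (c1 x), dot (lagr_part z) (c2 x),
    t ^ e * symp_form (first_part z) (second_part z) * N x, t ^ (e + 2) * N x] ! k))"

definition "forward_denom z =
  z $ 8 * height (first_part z) (z $ 8) * N (quadric_part z) * gam (quadric_part z)"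

text \<open>
  The inverse. Here \<open>inv_v\<close> and \<open>inv_t\<close> recover \<open>(v, t)\<close> up to a common factor from the first two
  coordinates in the frame and the last one. From the next two coordinates one gets \<open>lagr v w t\<close>, and
  adding the multiple of \<open>w\<^sub>0(v)\<close> prescribed by coordinate 4 and dividing by the height gives \<open>w\<close>.
  Instead of dividing \<open>w\<close> by the height \<open>inv_h\<close>, the vector \<open>v\<close> and the scalar \<open>t\<close> are multiplied by it.
\<close>

definition "inv_v x y i = N x * frame (y $ 0) (y $ 1) x i"
definition "inv_t x y = gam x * y $ 5"
definition "inv_h x y = height (inv_v x y) (inv_t x y)"
definition "inv_w x y i = inv_t x y * (inv_t x y ^ e * N x * frame (y $ 2) (y $ 3) x i +
  gam x * y $ 4 * dual (inv_v x y) (inv_t x y) i)"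

definition "backward x y = vec 9 (\<lambda>k. if k < 4 then inv_h x y * inv_v x y k
  else if k < 8 then inv_w x y (k - 4) else inv_t x y * inv_h x y)"

definition "backward_denom x y =
  gam x * N x * y $ 5 * inv_h x y * (y $ 0 * y $ 3 - y $ 1 * y $ 2)"

lemma cone_scale:
  assumes "\<And>i. i < 4 \<Longrightarrow> v' i = c * v i" "t' = c * t"
  shows "cone v' t' = c \<cdot>\<^sub>v cone v t"
  unfolding cone_def using assms by (intro eq_vecI) auto

lemma cone_carrier [simp]: "cone v t \<in> carrier_vec 5"
  unfolding cone_def by simp

lemma c0_scale:
  assumes "\<And>i. i < 4 \<Longrightarrow> v' i = c * v i" "t' = c * t" "i < 4"
  shows "c0 (cone v' t') i = c ^ e * c0 (cone v t) i"
proof -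
  have "cone v' t' = c \<cdot>\<^sub>v cone v t" using assms(1,2) by (rule cone_scale)
  then show ?thesis using hom_poly_scale[OF c0_poly[OF assms(3)] cone_carrier] by simp
qed

lemma dual_scale:
  assumes "\<And>i. i < 4 \<Longrightarrow> v' i = c * v i" "t' = c * t" "i < 4"
  shows "dual v' t' i = c ^ e * dual v t i"
  unfolding dual_def sharp_def using assms(3) c0_scale[of v' c v t', OF assms(1,2)] by auto

lemma height_scale:
  assumes "\<And>i. i < 4 \<Longrightarrow> v' i = c * v i" "t' = c * t"
  shows "height v' t' = c ^ (e + 1) * height v t"
proof -
  have "height v' t' = dot (\<lambda>i. c * v i) (\<lambda>i. c ^ e * c0 (cone v t) i)"
    unfolding height_def using assms c0_scale[of v' c v t', OF assms] by (intro dot_cong) auto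
  then show ?thesis unfolding height_def dot_def by (simp add: sum_distrib_left mult_ac)
qed

lemma symp_dual: "symp_form v (dual v t) = height v t"
  unfolding dual_def height_def symp_sharp ..

lemma symp_lagr: "symp_form v (lagr v w t) = 0"
proof -
  have "symp_form v (lagr v w t) = height v t * symp_form v w - symp_form v w * symp_form v (dual v t)"
    unfolding lagr_def symp_form_def by (simp add: algebra_simps)
  then show ?thesis unfolding symp_dual by simp
qed

lemma fibre_part_index:
  "fibre_part z $ 0 = (z $ 8) ^ (e + 1) * dot (first_part z) (c1 (quadric_part z))"
  "fibre_part z $ 1 = (z $ 8) ^ (e + 1) * dot (first_part z) (c2 (quadric_part z))"
  "fibre_part z $ 2 = dot (lagr_part z) (c1 (quadric_part z))"
  "fibre_part z $ 3 = dot (lagr_part z) (c2 (quadric_part z))"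
  "fibre_part z $ 4 = (z $ 8) ^ e * symp_form (first_part z) (second_part z) * N (quadric_part z)"
  "fibre_part z $ 5 = (z $ 8) ^ (e + 2) * N (quadric_part z)"
  unfolding fibre_part_def Let_def by (simp_all add: eval_nat_numeral)

lemma quadric_part_properties:
  fixes z
  defines "M \<equiv> wedge (first_part z) (lagr_part z)"
  shows "mat4 M \<in> primitive_bivectors" "quadric_part z \<in> carrier_vec 5" "q (quadric_part z) = 0"
    "i < 4 \<Longrightarrow> j < 4 \<Longrightarrow> to_mat \<beta> (quadric_part z) i j = M i j"
    "i < 4 \<Longrightarrow> contract (to_mat \<beta> (quadric_part z)) c i =
      first_part z i * dot (lagr_part z) c - lagr_part z i * dot (first_part z) c"
proof -
  show prim: "mat4 M \<in> primitive_bivectors"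
    unfolding M_def wedge_primitive_iff lagr_part_def by (rule symp_lagr)
  show "quadric_part z \<in> carrier_vec 5" unfolding quadric_part_def from_mat_def by simp
  show "q (quadric_part z) = 0"
    using q_from_mat[OF prim] pf_wedge unfolding quadric_part_def M_def by metis
  show *: "to_mat \<beta> (quadric_part z) i j = M i j" if "i < 4" "j < 4" for i j
    using to_from_mat[OF prim that] unfolding quadric_part_def M_def .
  show "contract (to_mat \<beta> (quadric_part z)) c i =
      first_part z i * dot (lagr_part z) c - lagr_part z i * dot (first_part z) c" if "i < 4"
  proof -
    have "contract (to_mat \<beta> (quadric_part z)) c i = contract M c i"
      using *[OF that] by (intro contract_cong) auto
    then show ?thesis unfolding M_def contract_wedge .
  qed
qed

text \<open>
  The image \<open>(x, y)\<close> of \<open>z = (v, w, t)\<close> satisfies \<open>inv_v = \<theta> v\<close> and \<open>inv_t = \<theta> t\<close> with the same factor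
  \<open>\<theta> = N \<gamma> t\<^sup>e\<^sup>+\<^sup>1\<close>. Homogeneity then determines all other ingredients, and the composite is
  multiplication by \<open>\<theta>\<^sup>e\<^sup>+\<^sup>2\<close> times the height.
\<close>

lemma backward_forward:
  assumes z: "z \<in> carrier_vec 9" and P: "forward_denom z \<noteq> 0"
  shows "quadric_part z \<noteq> 0\<^sub>v 5" "fibre_part z \<noteq> 0\<^sub>v 6"
    "backward_denom (quadric_part z) (fibre_part z) \<noteq> 0"
    "\<exists>c. c \<noteq> 0 \<and> backward (quadric_part z) (fibre_part z) = c \<cdot>\<^sub>v z"
proof -
  define x where "x = quadric_part z"
  define y where "y = fibre_part z"
  define t where "t = z $ 8"
  define v where "v = first_part z"
  define w where "w = second_part z"
  define l where "l = lagr_part z"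
  define h where "h = height v t"
  define p1 where "p1 = dot v (c1 x)" define p2 where "p2 = dot v (c2 x)"
  define r1 where "r1 = dot l (c1 x)" define r2 where "r2 = dot l (c2 x)"
  have nz: "t \<noteq> 0" "h \<noteq> 0" "N x \<noteq> 0" "gam x \<noteq> 0"
    using P unfolding forward_denom_def x_def t_def h_def v_def by auto
  have l: "l i = h * w i - symp_form v w * dual v t i" for i
    unfolding l_def lagr_part_def lagr_def h_def v_def w_def t_def ..
  have y: "y $ 0 = t ^ (e + 1) * p1" "y $ 1 = t ^ (e + 1) * p2" "y $ 2 = r1" "y $ 3 = r2"
    "y $ 4 = t ^ e * symp_form v w * N x" "y $ 5 = t ^ (e + 2) * N x"
    unfolding y_def fibre_part_index p1_def p2_def r1_def r2_def x_def t_def v_def w_def l_def by simp_all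
  have con: "contract (to_mat \<beta> x) c i = v i * dot l c - l i * dot v c" if "i < 4" for c i
    unfolding x_def v_def l_def using quadric_part_properties(5)[OF that] .
  have gam: "gam x = p1 * r2 - r1 * p2"
  proof -
    have "gam x = dot (c1 x) (\<lambda>i. v i * r2 - l i * p2)"
      unfolding gam_def r2_def p2_def using con by (intro dot_cong) auto
    also have "\<dots> = dot v (c1 x) * r2 - dot l (c1 x) * p2"
      unfolding dot_def by (simp add: sum_subtractf sum_distrib_left sum_distrib_right algebra_simps)
    finally show ?thesis unfolding p1_def r1_def .
  qed
  have frame_v: "frame (y $ 0) (y $ 1) x i = t ^ (e + 1) * gam x * v i" if "i < 4" for i
    unfolding frame_def con[OF that] y gam p1_def[symmetric] p2_def[symmetric] r1_def[symmetric] r2_def[symmetric]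
    by (simp add: algebra_simps)
  have frame_w: "frame (y $ 2) (y $ 3) x i = gam x * l i" if "i < 4" for i
    unfolding frame_def con[OF that] y gam p1_def[symmetric] p2_def[symmetric] r1_def[symmetric] r2_def[symmetric]
    by (simp add: algebra_simps)
  define \<theta> where "\<theta> = N x * gam x * t ^ (e + 1)"
  have \<theta>: "\<theta> \<noteq> 0" unfolding \<theta>_def using nz by simp
  have V: "inv_v x y i = \<theta> * v i" if "i < 4" for i
    unfolding inv_v_def frame_v[OF that] \<theta>_def by simp
  have T: "inv_t x y = \<theta> * t" unfolding inv_t_def y \<theta>_def by simp
  have H: "inv_h x y = \<theta> ^ (e + 1) * h"
    unfolding inv_h_def h_def using height_scale[of "inv_v x y", OF V T] .
  have dual: "dual (inv_v x y) (\<theta> * t) i = \<theta> ^ e * dual v t i" if "i < 4" for i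
    using dual_scale[of "inv_v x y", OF V refl that] .
  have W: "inv_w x y i = \<theta> ^ (e + 2) * h * w i" if "i < 4" for i
  proof -
    have "inv_w x y i = \<theta> * t * ((\<theta> * t) ^ e * N x * (gam x * l i) +
        gam x * (t ^ e * symp_form v w * N x) * (\<theta> ^ e * dual v t i))"
      unfolding inv_w_def frame_w[OF that] T dual[OF that] y(5) ..
    also have "\<dots> = \<theta> * \<theta> ^ e * (N x * gam x * t ^ (e + 1)) * (l i + symp_form v w * dual v t i)"
      by (simp add: power_mult_distrib algebra_simps)
    also have "\<dots> = \<theta> ^ (e + 2) * h * w i"
      unfolding \<theta>_def[symmetric] l by simp
    finally show ?thesis .
  qed
  have \<Delta>: "y $ 0 * y $ 3 - y $ 1 * y $ 2 = t ^ (e + 1) * gam x"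
    unfolding y gam by (simp add: algebra_simps)
  show Q: "backward_denom (quadric_part z) (fibre_part z) \<noteq> 0"
    unfolding x_def[symmetric] y_def[symmetric] backward_denom_def \<Delta> H y(6) using nz \<theta> by simp
  show "quadric_part z \<noteq> 0\<^sub>v 5"
  proof
    assume "quadric_part z = 0\<^sub>v 5"
    then have "to_mat \<beta> x i j = 0" for i j unfolding x_def to_mat_def by simp
    then have "gam x = 0" unfolding gam_def contract_def dot_def by simp
    then show False using nz by simp
  qed
  show "fibre_part z \<noteq> 0\<^sub>v 6"
  proof
    assume "fibre_part z = 0\<^sub>v 6"
    then have "y $ 5 = 0" unfolding y_def by simp
    then show False unfolding y using nz by simp
  qed
  have "backward x y = (\<theta> ^ (e + 2) * h) \<cdot>\<^sub>v z"
  proof (rule eq_vecI)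
    fix k assume "k < dim_vec ((\<theta> ^ (e + 2) * h) \<cdot>\<^sub>v z)"
    then have k: "k < 9" using z by simp
    then consider "k < 4" | "4 \<le> k" "k < 8" | "k = 8" by linarith
    then have "backward x y $ k = \<theta> ^ (e + 2) * h * z $ k"
    proof cases
      case 1
      then show ?thesis using k unfolding backward_def by (simp add: H V v_def first_part_def)
    next
      case 2
      then have "inv_w x y (k - 4) = \<theta> ^ (e + 2) * h * z $ k"
        using W[of "k - 4"] unfolding w_def second_part_def by simp
      then show ?thesis using 2 k unfolding backward_def by simp
    next
      case 3
      then show ?thesis unfolding backward_def by (simp add: H T t_def)
    qed
    then show "backward x y $ k = ((\<theta> ^ (e + 2) * h) \<cdot>\<^sub>v z) $ k" using k z by simp
  qed (use z in \<open>simp add: backward_def\<close>)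
  then show "\<exists>c. c \<noteq> 0 \<and> backward (quadric_part z) (fibre_part z) = c \<cdot>\<^sub>v z"
    using \<theta> nz unfolding x_def y_def by (intro exI[of _ "\<theta> ^ (e + 2) * h"]) simp
qed

text \<open>
  The vectors \<open>f\<close> and \<open>f'\<close> of the plane of \<open>x\<close> with the coordinates prescribed by \<open>y\<close> are orthogonal
  and their wedge is \<open>\<Delta> \<gamma>\<close> times the bivector of \<open>x\<close>. So \<open>f'\<close> is already in the complement of \<open>f\<close>,
  the projection returns it up to a factor, and the bivector of \<open>x\<close> reappears multiplied by \<open>\<kappa>\<close>. The
  determinant \<open>\<Delta>\<close> of the four frame coordinates has to be nonzero for the two vectors to span the
  plane.
\<close>

lemma forward_backward:
  assumes x: "x \<in> carrier_vec 5" "q x = 0" and y: "y \<in> carrier_vec 6" and Q: "backward_denom x y \<noteq> 0"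
  shows "backward x y \<noteq> 0\<^sub>v 9" "forward_denom (backward x y) \<noteq> 0"
    "\<exists>a b. a \<noteq> 0 \<and> b \<noteq> 0 \<and> quadric_part (backward x y) = a \<cdot>\<^sub>v x \<and> fibre_part (backward x y) = b \<cdot>\<^sub>v y"
proof -
  define z where "z = backward x y"
  define H where "H = inv_h x y"
  define T where "T = inv_t x y"
  define \<Delta> where "\<Delta> = y $ 0 * y $ 3 - y $ 1 * y $ 2"
  define f where "f = frame (y $ 0) (y $ 1) x"
  define f' where "f' = frame (y $ 2) (y $ 3) x"
  define d where "d = dual (inv_v x y) T"
  have nz: "gam x \<noteq> 0" "N x \<noteq> 0" "y $ 5 \<noteq> 0" "H \<noteq> 0" "\<Delta> \<noteq> 0" "T \<noteq> 0"
    using Q unfolding backward_denom_def H_def \<Delta>_def T_def inv_t_def by auto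
  have v: "first_part z i = H * inv_v x y i" if "i < 4" for i
    using that unfolding z_def first_part_def backward_def H_def by simp
  have w: "second_part z i = T * (T ^ e * N x * f' i + gam x * y $ 4 * d i)" if "i < 4" for i
    using that unfolding z_def second_part_def backward_def inv_w_def T_def f'_def d_def by simp
  have t: "z $ 8 = H * T" unfolding z_def backward_def H_def T_def by simp
  have V: "inv_v x y i = N x * f i" for i unfolding inv_v_def f_def ..
  have h: "height (first_part z) (z $ 8) = H ^ (e + 2)"
    using height_scale[of "first_part z" H "inv_v x y", OF v t] unfolding T_def inv_h_def[symmetric] H_def
    by simp
  have dual: "dual (first_part z) (z $ 8) i = H ^ e * d i" if "i < 4" for i
    using dual_scale[of "first_part z" H "inv_v x y", OF v t that] unfolding d_def .
  have "symp_form (first_part z) (second_part z) =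
      symp_form (\<lambda>i. H * (N x * f i)) (\<lambda>i. T * (T ^ e * N x * f' i + gam x * y $ 4 * d i))"
    using v w unfolding V by (intro symp_cong) auto
  also have "\<dots> = H * T * (T ^ e * N x * N x * symp_form f f' + gam x * y $ 4 * symp_form (\<lambda>i. N x * f i) d)"
    unfolding symp_form_def by (simp add: algebra_simps)
  also have "symp_form f f' = 0" unfolding f_def f'_def by (rule symp_frame[OF x])
  also have "symp_form (\<lambda>i. N x * f i) d = H"
    unfolding V[symmetric] d_def H_def inv_h_def T_def by (rule symp_dual)
  finally have s: "symp_form (first_part z) (second_part z) = H * T * gam x * y $ 4 * H" by simp
  have l: "lagr_part z i = H ^ (e + 2) * T ^ (e + 1) * N x * f' i" if "i < 4" for i
    unfolding lagr_part_def lagr_def h s dual[OF that] w[OF that] by (simp add: algebra_simps)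
  define \<kappa> where "\<kappa> = H ^ (e + 3) * T ^ (e + 1) * N x ^ 2 * \<Delta> * gam x"
  have \<kappa>: "\<kappa> \<noteq> 0" unfolding \<kappa>_def using nz by simp
  have "wedge (first_part z) (lagr_part z) i j = \<kappa> * to_mat \<beta> x i j" if ij: "i < 4" "j < 4" for i j
  proof -
    have "wedge (first_part z) (lagr_part z) i j = H ^ (e + 3) * T ^ (e + 1) * N x ^ 2 * wedge f f' i j"
      unfolding wedge_def v[OF ij(1)] v[OF ij(2)] l[OF ij(1)] l[OF ij(2)] V
      by (simp add: algebra_simps power2_eq_square eval_nat_numeral)
    also have "wedge f f' i j = \<Delta> * gam x * to_mat \<beta> x i j"
      unfolding f_def f'_def \<Delta>_def by (rule wedge_frame[OF x ij])
    finally show ?thesis unfolding \<kappa>_def by simp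
  qed
  then have "quadric_part z = \<kappa> \<cdot>\<^sub>v from_mat \<alpha> (to_mat \<beta> x)"
    unfolding quadric_part_def by (rule from_mat_scale)
  then have x': "quadric_part z = \<kappa> \<cdot>\<^sub>v x" unfolding from_to_mat[OF x(1)] .
  have N': "N (quadric_part z) = \<kappa> ^ D * N x" unfolding x' by (rule hom_poly_scale[OF N_poly x(1)])
  have c1': "c1 (quadric_part z) i = \<kappa> ^ D * c1 x i" if "i < 4" for i
    unfolding x' by (rule hom_poly_scale[OF c1_poly[OF that] x(1)])
  have c2': "c2 (quadric_part z) i = \<kappa> ^ D * c2 x i" if "i < 4" for i
    unfolding x' by (rule hom_poly_scale[OF c2_poly[OF that] x(1)])
  have dot_v: "dot (first_part z) (c (quadric_part z)) = H * N x * \<kappa> ^ D * dot f (c x)"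
    if "\<And>i. i < 4 \<Longrightarrow> c (quadric_part z) i = \<kappa> ^ D * c x i" for c
  proof -
    have "dot (first_part z) (c (quadric_part z)) = dot (\<lambda>i. H * (N x * f i)) (\<lambda>i. \<kappa> ^ D * c x i)"
      using v that unfolding V by (intro dot_cong) auto
    then show ?thesis unfolding dot_def by (simp add: sum_distrib_left mult_ac)
  qed
  have dot_l: "dot (lagr_part z) (c (quadric_part z)) = H ^ (e + 2) * T ^ (e + 1) * N x * \<kappa> ^ D * dot f' (c x)"
    if "\<And>i. i < 4 \<Longrightarrow> c (quadric_part z) i = \<kappa> ^ D * c x i" for c
  proof -
    have "dot (lagr_part z) (c (quadric_part z)) =
        dot (\<lambda>i. H ^ (e + 2) * T ^ (e + 1) * N x * f' i) (\<lambda>i. \<kappa> ^ D * c x i)"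
      using l that by (intro dot_cong) auto
    then show ?thesis unfolding dot_def by (simp add: sum_distrib_left mult_ac)
  qed
  define \<mu> where "\<mu> = \<kappa> ^ D * H ^ (e + 2) * T ^ (e + 1) * N x * gam x"
  have \<mu>: "\<mu> \<noteq> 0" unfolding \<mu>_def using nz \<kappa> by simp
  have y': "fibre_part z $ 0 = \<mu> * y $ 0" "fibre_part z $ 1 = \<mu> * y $ 1"
    "fibre_part z $ 2 = \<mu> * y $ 2" "fibre_part z $ 3 = \<mu> * y $ 3"
    "fibre_part z $ 4 = \<mu> * y $ 4" "fibre_part z $ 5 = \<mu> * y $ 5"
  proof -
    have dots: "dot (first_part z) (c1 (quadric_part z)) = H * N x * \<kappa> ^ D * dot f (c1 x)"
      "dot (first_part z) (c2 (quadric_part z)) = H * N x * \<kappa> ^ D * dot f (c2 x)"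
      "dot (lagr_part z) (c1 (quadric_part z)) = H ^ (e + 2) * T ^ (e + 1) * N x * \<kappa> ^ D * dot f' (c1 x)"
      "dot (lagr_part z) (c2 (quadric_part z)) = H ^ (e + 2) * T ^ (e + 1) * N x * \<kappa> ^ D * dot f' (c2 x)"
      using dot_v[of c1] dot_v[of c2] dot_l[of c1] dot_l[of c2] c1' c2' by blast+
    show "fibre_part z $ 0 = \<mu> * y $ 0"
      unfolding fibre_part_index t dots(1) f_def dot_frame[OF x(1)] \<mu>_def
      by (simp add: power_mult_distrib mult_ac)
    show "fibre_part z $ 1 = \<mu> * y $ 1"
      unfolding fibre_part_index t dots(2) f_def dot_frame[OF x(1)] \<mu>_def
      by (simp add: power_mult_distrib mult_ac)
    show "fibre_part z $ 2 = \<mu> * y $ 2"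
      unfolding fibre_part_index dots(3) f'_def dot_frame[OF x(1)] \<mu>_def by (simp add: mult_ac)
    show "fibre_part z $ 3 = \<mu> * y $ 3"
      unfolding fibre_part_index dots(4) f'_def dot_frame[OF x(1)] \<mu>_def by (simp add: mult_ac)
    show "fibre_part z $ 4 = \<mu> * y $ 4"
      unfolding fibre_part_index t s N' \<mu>_def by (simp add: power_mult_distrib mult_ac)
    have "T = gam x * y $ 5" unfolding T_def inv_t_def ..
    then have "T ^ (e + 2) = T ^ (e + 1) * (gam x * y $ 5)" by simp
    then show "fibre_part z $ 5 = \<mu> * y $ 5"
      unfolding fibre_part_index t N' \<mu>_def power_mult_distrib by (simp only: mult_ac)
  qed
  have fibre: "fibre_part z = \<mu> \<cdot>\<^sub>v y"
  proof (rule eq_vecI)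
    fix k assume "k < dim_vec (\<mu> \<cdot>\<^sub>v y)"
    then have "k < 6" using y by simp
    moreover from this have "k = 0 \<or> k = 1 \<or> k = 2 \<or> k = 3 \<or> k = 4 \<or> k = 5" by linarith
    ultimately show "fibre_part z $ k = (\<mu> \<cdot>\<^sub>v y) $ k" using y y' by auto
  qed (use y in \<open>simp add: fibre_part_def Let_def\<close>)
  show "forward_denom (backward x y) \<noteq> 0"
    unfolding z_def[symmetric] forward_denom_def h N' unfolding x' gam_scale[OF x(1)] t
    using nz \<kappa> by simp
  have "z $ 8 \<noteq> 0" unfolding t using nz by simp
  then show "backward x y \<noteq> 0\<^sub>v 9" unfolding z_def[symmetric] by auto
  show "\<exists>a b. a \<noteq> 0 \<and> b \<noteq> 0 \<and> quadric_part (backward x y) = a \<cdot>\<^sub>v x \<and> fibre_part (backward x y) = b \<cdot>\<^sub>v y"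
    using \<kappa> \<mu> x' fibre unfolding z_def by blast
qed

end


section \<open>The map is polynomial and equivariant\<close>

context equivariant_trivialisation
begin

lemma bihom_poly_dual:
  assumes "\<And>i. i < 4 \<Longrightarrow> bihom_poly n m a b (\<lambda>x y. v x y i)" "bihom_poly n m a b t" "i < 4"
  shows "bihom_poly n m (e * a) (e * b) (\<lambda>x y. dual (v x y) (t x y) i)"
  unfolding dual_def
  by (rule bihom_poly_sharp[OF bihom_poly_compose[OF c0_poly bihom_poly_cone] assms(3)])
    (use assms in auto)

lemma bihom_poly_height:
  assumes "\<And>i. i < 4 \<Longrightarrow> bihom_poly n m a b (\<lambda>x y. v x y i)" "bihom_poly n m a b t"
  shows "bihom_poly n m ((e + 1) * a) ((e + 1) * b) (\<lambda>x y. height (v x y) (t x y))"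
  unfolding height_def
  by (rule bihom_poly_dot[OF assms(1) bihom_poly_compose[OF c0_poly bihom_poly_cone]])
    (use assms in auto)

lemma bihom_poly_first_part: "i < 4 \<Longrightarrow> bihom_poly 9 0 1 0 (\<lambda>z y. first_part z i)"
  unfolding first_part_def by (rule bihom_poly.fst) simp

lemma bihom_poly_second_part: "i < 4 \<Longrightarrow> bihom_poly 9 0 1 0 (\<lambda>z y. second_part z i)"
  unfolding second_part_def by (rule bihom_poly.fst) simp

lemma bihom_poly_last: "bihom_poly 9 0 1 0 (\<lambda>z y. z $ 8)"
  by (rule bihom_poly.fst) simp

text \<open>
  The forward map depends on one block of variables. It is treated as bihomogeneous of degree 0 in an
  empty second block, so that the same closure lemmas serve both directions.
\<close>

lemma bihom_poly_lagr_part: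
  assumes "i < 4"
  shows "bihom_poly 9 0 (e + 2) 0 (\<lambda>z y. lagr_part z i)"
  unfolding lagr_part_def lagr_def
  by (intro bihom_poly_diff
      bihom_poly_mult_deg[OF bihom_poly_height[OF bihom_poly_first_part bihom_poly_last]
        bihom_poly_second_part[OF assms]]
      bihom_poly_mult_deg[OF bihom_poly_symp[OF bihom_poly_first_part bihom_poly_second_part refl refl]
        bihom_poly_dual[OF bihom_poly_first_part bihom_poly_last assms]]) auto

lemma bihom_poly_quadric_part:
  assumes "k < 5"
  shows "bihom_poly 9 0 (e + 3) 0 (\<lambda>z y. quadric_part z $ k)"
  unfolding quadric_part_def
  by (rule bihom_poly_from_mat[OF bihom_poly_wedge[OF bihom_poly_first_part bihom_poly_lagr_part] assms])
    auto

lemma bihom_poly_fibre_part: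
  assumes k: "k < 6"
  shows "bihom_poly 9 0 (e + 2 + D * (e + 3)) 0 (\<lambda>z y. fibre_part z $ k)"
proof -
  note on_quadric = bihom_poly_compose[OF _ bihom_poly_quadric_part]
  have t: "bihom_poly 9 0 j 0 (\<lambda>z y. (z $ 8) ^ j)" for j
    by (rule bihom_poly_power[OF bihom_poly_last]) auto
  have v: "bihom_poly 9 0 (1 + D * (e + 3)) 0 (\<lambda>z y. dot (first_part z) (c (quadric_part z)))"
    and l: "bihom_poly 9 0 (e + 2 + D * (e + 3)) 0 (\<lambda>z y. dot (lagr_part z) (c (quadric_part z)))"
    if "\<And>i. i < 4 \<Longrightarrow> hom_poly 5 D (\<lambda>x. c x i)" for c
    by (rule bihom_poly_dot[OF bihom_poly_first_part on_quadric[OF that]];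
        simp)
      (rule bihom_poly_dot[OF bihom_poly_lagr_part on_quadric[OF that]]; simp)
  have s: "bihom_poly 9 0 2 0 (\<lambda>z y. symp_form (first_part z) (second_part z))"
    by (rule bihom_poly_symp[OF bihom_poly_first_part bihom_poly_second_part]) auto
  have N: "bihom_poly 9 0 (D * (e + 3)) 0 (\<lambda>z y. N (quadric_part z))"
    using on_quadric[OF N_poly] by simp
  have "k = 0 \<or> k = 1 \<or> k = 2 \<or> k = 3 \<or> k = 4 \<or> k = 5" using k by linarith
  then show ?thesis
  proof (elim disjE)
    assume k: "k = 0"
    show ?thesis unfolding k fibre_part_index
      by (rule bihom_poly_mult_deg[OF t v[OF c1_poly]]) auto
  next
    assume k: "k = 1"
    show ?thesis unfolding k fibre_part_index
      by (rule bihom_poly_mult_deg[OF t v[OF c2_poly]]) auto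
  next
    assume k: "k = 2"
    show ?thesis unfolding k fibre_part_index by (rule l[OF c1_poly])
  next
    assume k: "k = 3"
    show ?thesis unfolding k fibre_part_index by (rule l[OF c2_poly])
  next
    assume k: "k = 4"
    show ?thesis unfolding k fibre_part_index
      by (rule bihom_poly_mult_deg[OF bihom_poly_mult_deg[OF t s refl refl] N]) auto
  next
    assume k: "k = 5"
    show ?thesis unfolding k fibre_part_index
      by (rule bihom_poly_mult_deg[OF t N]) auto
  qed
qed

lemma hom_poly_forward_denom: "\<exists>d. hom_poly 9 d forward_denom"
proof -
  have N: "bihom_poly 9 0 (D * (e + 3)) (D * 0) (\<lambda>z y. N (quadric_part z))"
    by (rule bihom_poly_compose[OF N_poly bihom_poly_quadric_part])
  show ?thesis
    unfolding forward_denom_def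
    by (rule exI, rule bihom_poly_fst_only[of _ 0],
        rule bihom_poly_mult_deg[OF bihom_poly_mult_deg[OF bihom_poly_mult_deg[OF bihom_poly_last
            bihom_poly_height[OF bihom_poly_first_part bihom_poly_last] refl refl] N refl refl]
          bihom_poly_gam[OF bihom_poly_quadric_part] refl refl])
qed

lemma bihom_poly_frame:
  assumes "bihom_poly 5 6 0 1 p" "bihom_poly 5 6 0 1 r" "i < 4"
  shows "bihom_poly 5 6 (D + 1) 1 (\<lambda>x y. frame (p x y) (r x y) x i)"
proof -
  have x: "bihom_poly 5 6 1 0 (\<lambda>x y :: 'k vec. x $ k)" if "k < 5" for k
    by (rule bihom_poly.fst[OF that])
  have c: "bihom_poly 5 6 (D + 1) 0 (\<lambda>x y. contract (to_mat \<beta> x) (c x) i)"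
    if "\<And>i. i < 4 \<Longrightarrow> hom_poly 5 D (\<lambda>x. c x i)" for c
    by (rule bihom_poly_contract[OF bihom_poly_to_mat[OF x] bihom_poly_compose[OF that x]])
      (use assms in auto)
  show ?thesis
    unfolding frame_def
    by (intro bihom_poly_diff bihom_poly_mult_deg[OF assms(1) c[OF c2_poly]]
        bihom_poly_mult_deg[OF assms(2) c[OF c1_poly]]) auto
qed

lemma bihom_poly_N: "bihom_poly 5 6 D 0 (\<lambda>x y. N x)"
  using bihom_poly_compose[OF N_poly bihom_poly.fst, of 5 6] by simp

lemma bihom_poly_gam_fst: "bihom_poly 5 6 (2 * D + 1) 0 (\<lambda>x y. gam x)"
  using bihom_poly_gam[OF bihom_poly.fst, of 5 6] by simp

lemma bihom_poly_inv_v: "i < 4 \<Longrightarrow> bihom_poly 5 6 (2 * D + 1) 1 (\<lambda>x y. inv_v x y i)"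
  unfolding inv_v_def
  by (rule bihom_poly_mult_deg[OF bihom_poly_N bihom_poly_frame[OF bihom_poly.snd bihom_poly.snd]]) auto

lemma bihom_poly_inv_t: "bihom_poly 5 6 (2 * D + 1) 1 (\<lambda>x y. inv_t x y)"
  unfolding inv_t_def by (rule bihom_poly_mult_deg[OF bihom_poly_gam_fst bihom_poly.snd]) auto

lemma bihom_poly_inv_h: "bihom_poly 5 6 ((e + 1) * (2 * D + 1)) (e + 1) (\<lambda>x y. inv_h x y)"
  using bihom_poly_height[OF bihom_poly_inv_v bihom_poly_inv_t] unfolding inv_h_def by simp

lemma bihom_poly_inv_w:
  assumes i: "i < 4"
  shows "bihom_poly 5 6 ((e + 2) * (2 * D + 1)) (e + 2) (\<lambda>x y. inv_w x y i)"
proof -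
  have T: "bihom_poly 5 6 (e * (2 * D + 1)) e (\<lambda>x y. inv_t x y ^ e)"
    by (rule bihom_poly_power[OF bihom_poly_inv_t]) auto
  have f: "bihom_poly 5 6 (D + 1) 1 (\<lambda>x y. frame (y $ 2) (y $ 3) x i)"
    by (rule bihom_poly_frame[OF bihom_poly.snd bihom_poly.snd i]) auto
  have w: "bihom_poly 5 6 ((e + 1) * (2 * D + 1)) (e + 1) (\<lambda>x y. inv_t x y ^ e * N x * frame (y $ 2) (y $ 3) x i)"
    by (rule bihom_poly_mult_deg[OF bihom_poly_mult_deg[OF T bihom_poly_N refl refl] f]) auto
  have d: "bihom_poly 5 6 ((e + 1) * (2 * D + 1)) (e + 1)
      (\<lambda>x y. gam x * y $ 4 * dual (inv_v x y) (inv_t x y) i)"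
    by (rule bihom_poly_mult_deg[OF bihom_poly_mult_deg[OF bihom_poly_gam_fst bihom_poly.snd refl refl]
          bihom_poly_dual[OF bihom_poly_inv_v bihom_poly_inv_t i]]) auto
  show ?thesis
    unfolding inv_w_def
    by (rule bihom_poly_mult_deg[OF bihom_poly_inv_t bihom_poly.add[OF w d]]) auto
qed

lemma bihom_poly_backward:
  assumes k: "k < 9"
  shows "bihom_poly 5 6 ((e + 2) * (2 * D + 1)) (e + 2) (\<lambda>x y. backward x y $ k)"
proof -
  consider "k < 4" | "4 \<le> k" "k < 8" | "k = 8" using k by linarith
  then show ?thesis
  proof cases
    case 1
    have "bihom_poly 5 6 ((e + 2) * (2 * D + 1)) (e + 2) (\<lambda>x y. inv_h x y * inv_v x y k)"
      by (rule bihom_poly_mult_deg[OF bihom_poly_inv_h bihom_poly_inv_v[OF 1]]) auto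
    then show ?thesis using 1 k unfolding backward_def by simp
  next
    case 2
    then have "bihom_poly 5 6 ((e + 2) * (2 * D + 1)) (e + 2) (\<lambda>x y. inv_w x y (k - 4))"
      by (intro bihom_poly_inv_w) simp
    then show ?thesis using 2 k unfolding backward_def by simp
  next
    case 3
    have "bihom_poly 5 6 ((e + 2) * (2 * D + 1)) (e + 2) (\<lambda>x y. inv_t x y * inv_h x y)"
      by (rule bihom_poly_mult_deg[OF bihom_poly_inv_t bihom_poly_inv_h]) auto
    then show ?thesis using 3 unfolding backward_def by simp
  qed
qed

lemma bihom_poly_backward_denom: "\<exists>a b. bihom_poly 5 6 a b backward_denom"
proof -
  have y: "bihom_poly 5 6 0 1 (\<lambda>x y :: 'k vec. y $ k)" if "k < 6" for k
    by (rule bihom_poly.snd[OF that])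
  have "bihom_poly 5 6 (0 + 0) (1 + 1) (\<lambda>x y :: 'k vec. y $ 0 * y $ 3 - y $ 1 * y $ 2)"
    by (intro bihom_poly_diff bihom_poly.mult y) auto
  then have "bihom_poly 5 6 (2 * D + 1 + D + 0 + (e + 1) * (2 * D + 1) + (0 + 0))
      (0 + 0 + 1 + (e + 1) + (1 + 1)) backward_denom"
    unfolding backward_denom_def
    by (intro bihom_poly.mult bihom_poly_gam_fst bihom_poly_N bihom_poly_inv_h y) auto
  then show ?thesis by blast
qed

text \<open>
  The representation \<open>W \<oplus> W \<oplus> k\<close>; its last two blocks are the representation \<open>W \<oplus> k\<close> on which the
  homogenized family \<open>c0\<close> lives.
\<close>

definition "rep g = block_diag (S g) (block_diag (S g) (1\<^sub>m 1))"

lemma matrix_rep_rep: "matrix_rep G 9 rep"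
  using matrix_rep_block_diag[OF S matrix_rep_block_diag[OF S matrix_rep_trivial[of G 1]]]
  unfolding rep_def[abs_def] by simp

lemma rep_parts:
  assumes g: "g \<in> carrier G" and z: "z \<in> carrier_vec 9"
  shows "i < 4 \<Longrightarrow> first_part (rep g *\<^sub>v z) i = mat_act (S g) (first_part z) i"
    "i < 4 \<Longrightarrow> second_part (rep g *\<^sub>v z) i = mat_act (S g) (second_part z) i"
    "(rep g *\<^sub>v z) $ 8 = z $ 8"
proof -
  note Sg = matrix_repD(2)[OF S g]
  have B: "block_diag (S g) (1\<^sub>m 1) \<in> carrier_mat 5 5" using block_diag_carrier[OF Sg, of "1\<^sub>m 1" 1] by simp
  have z': "z \<in> carrier_vec (4 + 5)" using z by simp
  note parts = block_diag_mult_vec[OF Sg B z', folded rep_def]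
  show "first_part (rep g *\<^sub>v z) i = mat_act (S g) (first_part z) i" if "i < 4"
    unfolding first_part_def mat_act_def parts(1)[OF that] ..
  have sum5: "(\<Sum>j<5. F j) = (\<Sum>j<4. F j) + F (4::nat)" for F :: "nat \<Rightarrow> 'k"
    using sum.lessThan_Suc[of F 4] by simp
  show "second_part (rep g *\<^sub>v z) i = mat_act (S g) (second_part z) i" if "i < 4"
    unfolding second_part_def mat_act_def using parts(2)[of i] that Sg
    by (simp add: sum5 block_diag_def)
  show "(rep g *\<^sub>v z) $ 8 = z $ 8"
    using parts(2)[of 4] Sg by (simp add: sum5 block_diag_def)
qed

lemma dot_equivariant:
  assumes g: "g \<in> carrier G" and x: "x \<in> carrier_vec 5"
    and v: "\<And>i. i < 4 \<Longrightarrow> v' i = mat_act (S g) v i"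
    and c: "\<And>i. i < 4 \<Longrightarrow> transp_act (S g) c' i = c i"
  shows "dot v' c' = dot v c"
proof -
  have "dot v' c' = dot (mat_act (S g) v) c'" using v by (intro dot_cong) auto
  also have "\<dots> = dot v c" unfolding dot_transp_act using c by (intro dot_cong) auto
  finally show ?thesis .
qed

lemma height_equivariant: "g \<in> carrier G \<Longrightarrow> height (mat_act (S g) v) t = height v t"
  unfolding height_def dot_transp_act using c0_equivariant by (intro dot_cong) auto

lemma dual_equivariant:
  assumes "g \<in> carrier G" "i < 4"
  shows "dual (mat_act (S g) v) t i = mat_act (S g) (dual v t) i"
proof -
  have "dual (mat_act (S g) v) t i =
      mat_act (S g) (sharp (transp_act (S g) (c0 (cone (mat_act (S g) v) t)))) i"
    unfolding dual_def mat_act_sharp[OF S_Sp4[OF assms(1)] assms(2)] ..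
  also have "\<dots> = mat_act (S g) (dual v t) i"
    unfolding dual_def using c0_equivariant[OF assms(1)] by (intro mat_act_cong sharp_cong)
  finally show ?thesis .
qed

lemma lagr_equivariant:
  assumes "g \<in> carrier G" "i < 4"
  shows "lagr (mat_act (S g) v) (mat_act (S g) w) t i = mat_act (S g) (lagr v w t) i"
  unfolding lagr_def height_equivariant[OF assms(1)] symp_mat_act[OF S_Sp4[OF assms(1)]]
    dual_equivariant[OF assms]
  unfolding mat_act_def by (simp add: sum_subtractf sum_distrib_left algebra_simps)

lemma lagr_cong:
  assumes "\<And>i. i < 4 \<Longrightarrow> v i = v' i" "\<And>i. i < 4 \<Longrightarrow> w i = w' i" "i < 4"
  shows "lagr v w t i = lagr v' w' t i"
proof -
  have "cone v t = cone v' t" unfolding cone_def using assms(1) by auto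
  then show ?thesis
    unfolding lagr_def height_def dual_def using assms symp_cong[of v v' w w'] dot_cong[of v v'] by simp
qed

text \<open>
  Pairings of equivariant vectors with equivariant covectors are invariant, so the fibre coordinates do
  not move, whereas the bivector of the plane is moved by the group.
\<close>

lemma parts_equivariant:
  assumes g: "g \<in> carrier G" and z: "z \<in> carrier_vec 9"
  shows "quadric_part (rep g *\<^sub>v z) = A g *\<^sub>v quadric_part z"
    and "fibre_part (rep g *\<^sub>v z) = fibre_part z"
proof -
  let ?z = "rep g *\<^sub>v z"
  note r = rep_parts[OF g z]
  have l: "lagr_part ?z i = mat_act (S g) (lagr_part z) i" if "i < 4" for i
    unfolding lagr_part_def r(3) lagr_equivariant[OF g that, symmetric]
    using r(1,2) that by (intro lagr_cong)
  have "mat4 (wedge (first_part ?z) (lagr_part ?z)) =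
      mat4 (wedge (mat_act (S g) (first_part z)) (mat_act (S g) (lagr_part z)))"
    using r(1) l unfolding wedge_def by (intro eq_matI) auto
  then show x: "quadric_part ?z = A g *\<^sub>v quadric_part z"
    unfolding quadric_part_def wedge_mat_act[OF matrix_repD(2)[OF S g]]
    by (rule equivariant_from_mat[OF g quadric_part_properties(1)
          quadric_part_properties(1)])
  let ?x = "quadric_part z"
  have xc: "?x \<in> carrier_vec 5" by (rule quadric_part_properties(2))
  have v1: "dot (first_part ?z) (c1 (A g *\<^sub>v ?x)) = dot (first_part z) (c1 ?x)"
    using r(1) c1_equivariant[OF g xc] by (rule dot_equivariant[OF g xc])
  have v2: "dot (first_part ?z) (c2 (A g *\<^sub>v ?x)) = dot (first_part z) (c2 ?x)"
    using r(1) c2_equivariant[OF g xc] by (rule dot_equivariant[OF g xc])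
  have l1: "dot (lagr_part ?z) (c1 (A g *\<^sub>v ?x)) = dot (lagr_part z) (c1 ?x)"
    using l c1_equivariant[OF g xc] by (rule dot_equivariant[OF g xc])
  have l2: "dot (lagr_part ?z) (c2 (A g *\<^sub>v ?x)) = dot (lagr_part z) (c2 ?x)"
    using l c2_equivariant[OF g xc] by (rule dot_equivariant[OF g xc])
  have s: "symp_form (first_part ?z) (second_part ?z) = symp_form (first_part z) (second_part z)"
  proof -
    have "symp_form (first_part ?z) (second_part ?z) =
        symp_form (mat_act (S g) (first_part z)) (mat_act (S g) (second_part z))"
      using r(1,2) by (rule symp_cong)
    then show ?thesis unfolding symp_mat_act[OF S_Sp4[OF g]] .
  qed
  show "fibre_part ?z = fibre_part z"
    unfolding fibre_part_def Let_def x r(3) v1 v2 l1 l2 s N_invariant[OF g xc] ..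
qed

theorem equivariantly_birational_quadric:
  assumes q: "hom_poly 5 2 q" and act: "\<And>g. g \<in> carrier G \<Longrightarrow> act g = proj_act (A g)"
    and z0: "z0 \<in> carrier_vec 9" "forward_denom z0 \<noteq> 0"
  defines "X \<equiv> proj_zero_locus 5 {q}"
  shows "equivariantly_birational G 9 (proj_space 9) (\<lambda>g. proj_act (rep g))
    (5 * 6) (segre_product X (proj_space 6)) (left_act X (proj_space 6) act)"
proof -
  obtain d where P: "hom_poly 9 d forward_denom" using hom_poly_forward_denom by blast
  obtain a b where Q: "bihom_poly 5 6 a b backward_denom" using bihom_poly_backward_denom by blast
  have qX: "q x = 0" if "proj_point x \<in> X" for x
    using that proj_point_self[of x] unfolding X_def proj_zero_locus_def by blast
  show ?thesis
  proof (rule equivariantly_birational_segreI[where j = 5 and B = backward and fx = quadric_part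
        and fy = fibre_part and \<rho> = rep and A = A and ?z0.0 = z0])
    show "X \<subseteq> proj_space 5" unfolding X_def proj_zero_locus_def by blast
    show "quadric_part z \<in> carrier_vec 5" for z by (rule quadric_part_properties(2))
    show "hom_poly 9 (e + 3) (\<lambda>z. quadric_part z $ i)" if "i < 5" for i
      by (rule bihom_poly_fst_only[OF bihom_poly_quadric_part[OF that]])
    show "fibre_part z \<in> carrier_vec 6" for z unfolding fibre_part_def Let_def by simp
    show "hom_poly 9 (e + 2 + D * (e + 3)) (\<lambda>z. fibre_part z $ i)" if "i < 6" for i
      by (rule bihom_poly_fst_only[OF bihom_poly_fibre_part[OF that]])
    show "backward x y \<in> carrier_vec 9" for x y unfolding backward_def by simp
    show "bihom_poly 5 6 ((e + 2) * (2 * D + 1)) (e + 2) (\<lambda>x y. backward x y $ i)" if "i < 9" for i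
      by (rule bihom_poly_backward[OF that])
    show "hom_poly 9 d forward_denom" by (rule P)
    show "bihom_poly 5 6 a b backward_denom" by (rule Q)
    show "quadric_part z \<noteq> 0\<^sub>v 5 \<and> proj_point (quadric_part z) \<in> X \<and> fibre_part z \<noteq> 0\<^sub>v 6 \<and>
        backward_denom (quadric_part z) (fibre_part z) \<noteq> 0 \<and>
        (\<exists>c. c \<noteq> 0 \<and> backward (quadric_part z) (fibre_part z) = c \<cdot>\<^sub>v z)"
      if z: "z \<in> carrier_vec 9" "forward_denom z \<noteq> 0" for z
    proof -
      note * = backward_forward[OF z]
      have "proj_point (quadric_part z) \<in> X"
        unfolding X_def using proj_point_in_zero_locus[OF quadric_part_properties(2) *(1), of "{q}"]
          q quadric_part_properties(3) by auto
      then show ?thesis using * by blast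
    qed
    show "y $ 5 \<noteq> 0 \<and> backward x y \<noteq> 0\<^sub>v 9 \<and> forward_denom (backward x y) \<noteq> 0 \<and>
        (\<exists>a b. a \<noteq> 0 \<and> b \<noteq> 0 \<and> quadric_part (backward x y) = a \<cdot>\<^sub>v x \<and>
          fibre_part (backward x y) = b \<cdot>\<^sub>v y)"
      if "x \<in> carrier_vec 5" "proj_point x \<in> X" "y \<in> carrier_vec 6" "backward_denom x y \<noteq> 0" for x y
      using forward_backward[OF that(1) qX[OF that(2)] that(3,4)] that(4)
      unfolding backward_denom_def by auto
    show "z0 \<noteq> 0\<^sub>v 9" using z0(2) unfolding forward_denom_def by auto
    show "quadric_part (rep g *\<^sub>v z) = A g *\<^sub>v quadric_part z \<and> fibre_part (rep g *\<^sub>v z) = fibre_part z"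
      if "g \<in> carrier G" "z \<in> carrier_vec 9" for g z
      using parts_equivariant[OF that] by blast
  qed (use z0 act matrix_repD(2)[OF A] matrix_repD(2)[OF matrix_rep_rep] in auto)
qed

end


section \<open>Existence of equivariant trivialisations\<close>

lemma mat_apply_one: "x \<in> carrier_vec n \<Longrightarrow> mat_apply (1\<^sub>m n) x = x"
  using mat_apply_eq[of "1\<^sub>m n" n n x] by simp

text \<open>
  Only the summand of the neutral element survives at \<open>x\<close>, hence the average has a prescribed value
  there.
\<close>

lemma (in group) average_at_free_point:
  assumes fin: "finite (carrier G)" and R: "matrix_rep G n R" and S: "matrix_rep G 4 S"
    and x: "x \<in> carrier_vec n" and f: "\<And>g. g \<in> carrier G - {\<one>} \<Longrightarrow> f (R g *\<^sub>v x) = 0"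
  shows "average_form G R f x = f x" "i < 4 \<Longrightarrow> average_covector G R S f e x i = f x * e i"
proof -
  have *: "f (mat_apply (R g) x) = (if g = \<one> then f x else 0)" if "g \<in> carrier G" for g
    using that f[of g] mat_apply_eq[OF matrix_repD(2)[OF R that] x] matrix_repD(1)[OF R]
      mat_apply_one[OF x] by auto
  show "average_form G R f x = f x"
    unfolding average_form_def using * fin by simp
  have e: "transp_act (1\<^sub>m 4) e i = e i" if "i < 4"
    using that unfolding transp_act_def less4_cases sum_less4 by auto
  show "average_covector G R S f e x i = f x * e i" if i: "i < 4"
  proof -
    have "average_covector G R S f e x i =
        (\<Sum>g\<in>carrier G. if g = \<one> then f x * transp_act (S \<one>) e i else 0)"
      unfolding average_covector_def using * by (intro sum.cong) auto
    then show ?thesis using fin matrix_repD(1)[OF S] e[OF i] by simp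
  qed
qed

lemma sum_delta4:
  fixes F :: "nat \<Rightarrow> 'a :: comm_ring_1"
  assumes "m < 4"
  shows "(\<Sum>i<4. F i * (if i = m then 1 else 0)) = F m"
  using assms unfolding less4_cases sum_less4 by auto

lemma nonproportional_minor:
  fixes x y :: "'a :: field vec"
  assumes x: "x \<in> carrier_vec n" "x \<noteq> 0\<^sub>v n" and y: "y \<in> carrier_vec n" "y \<noteq> 0\<^sub>v n"
    and ne: "proj_point y \<noteq> proj_point x"
  shows "\<exists>i<n. \<exists>j<n. x $ i * y $ j \<noteq> x $ j * y $ i"
proof (rule ccontr)
  assume "\<not> ?thesis"
  then have *: "x $ i * y $ j = x $ j * y $ i" if "i < n" "j < n" for i j using that by blast
  obtain i where i: "i < n" "x $ i \<noteq> 0" using nonzero_vecE[OF x] .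
  have y_eq: "y = (y $ i / x $ i) \<cdot>\<^sub>v x"
    using x y *[OF i(1)] i by (intro eq_vecI) (auto simp: field_simps)
  moreover from this have "y $ i / x $ i \<noteq> 0" using y x by auto
  ultimately have "proj_point y = proj_point x" using proj_point_scale by metis
  then show False using ne by simp
qed

lemma (in group) matrix_rep_nonzero:
  assumes R: "matrix_rep G n R" and g: "g \<in> carrier G" and x: "x \<in> carrier_vec n" "x \<noteq> 0\<^sub>v n"
  shows "R g *\<^sub>v x \<noteq> 0\<^sub>v n"
proof
  assume 0: "R g *\<^sub>v x = 0\<^sub>v n"
  have "R (inv g) * R g = 1\<^sub>m n" using matrix_repD[OF R] g by (metis inv_closed l_inv)
  then have "x = R (inv g) *\<^sub>v (R g *\<^sub>v x)"
    using assoc_mult_mat_vec[of "R (inv g)" n n "R g" n x] matrix_repD(2)[OF R] g x by simp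
  also have "\<dots> = 0\<^sub>v n"
    unfolding 0 using matrix_repD(2)[OF R inv_closed[OF g]] by (intro eq_vecI) auto
  finally show False using x by simp
qed

text \<open>
  At a point \<open>x0\<close> of the quadric with trivial stabilizer the families may be chosen to be multiples of
  any two covectors. Taking the basis covectors of a nonzero entry \<open>M\<^sub>k\<^sub>l\<close> of its bivector, \<open>gam\<close>
  is a nonzero multiple of that entry at \<open>x0\<close>.
\<close>

lemma (in quadric_of_lagrangians) exists_quadric_frame:
  assumes fin: "finite (carrier G)" and x0: "x0 \<in> carrier_vec 5" "x0 \<noteq> 0\<^sub>v 5"
    and free: "\<And>g. g \<in> carrier G \<Longrightarrow> proj_point (A g *\<^sub>v x0) = proj_point x0 \<Longrightarrow> g = \<one>"
  obtains D N c1 c2 where "quadric_frame G S A q \<alpha> \<beta> D N c1 c2" "N x0 \<noteq> 0"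
    "quadric_frame.gam \<beta> c1 c2 x0 \<noteq> 0"
proof -
  have "\<exists>i<5. \<exists>j<5. x0 $ i * (A g *\<^sub>v x0) $ j \<noteq> x0 $ j * (A g *\<^sub>v x0) $ i" if g: "g \<in> carrier G - {\<one>}" for g
    using nonproportional_minor[OF x0, of "A g *\<^sub>v x0"] free[of g] g matrix_repD(2)[OF A, of g] x0(1)
      matrix_rep_nonzero[OF A _ x0] by (metis DiffD1 DiffD2 mult_mat_vec_carrier singletonI)
  then obtain D f where f: "hom_poly 5 D f" "f x0 \<noteq> 0" "\<And>g. g \<in> carrier G - {\<one>} \<Longrightarrow> f (A g *\<^sub>v x0) = 0"
    using exists_separating_form[of "carrier G - {\<one>}" 5 x0 "\<lambda>g. A g *\<^sub>v x0"] fin by auto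
  let ?M = "to_mat \<beta> x0"
  have "\<exists>k<4. \<exists>l<4. ?M k l \<noteq> 0"
  proof (rule ccontr)
    assume "\<not> ?thesis"
    then have "from_mat \<alpha> ?M = 0\<^sub>v 5" unfolding from_mat_def by (intro eq_vecI) auto
    then show False using from_to_mat[OF x0(1)] x0(2) by simp
  qed
  then obtain k l where kl: "k < 4" "l < 4" "?M k l \<noteq> 0" by blast
  define N where "N = average_form G A f"
  define \<epsilon> where "\<epsilon> m i = (if i = m then 1 else 0 :: 'k)" for m i :: nat
  define c1 where "c1 = average_covector G A S f (\<epsilon> k)"
  define c2 where "c2 = average_covector G A S f (\<epsilon> l)"
  have ne: "carrier G \<noteq> {}" using one_closed by blast
  have frame: "quadric_frame G S A q \<alpha> \<beta> D N c1 c2"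
  proof unfold_locales
    show "hom_poly 5 D N" unfolding N_def by (rule average_form_hom_poly[OF fin ne A f(1)])
    show "hom_poly 5 D (\<lambda>x. c1 x i)" "hom_poly 5 D (\<lambda>x. c2 x i)" for i
      unfolding c1_def c2_def by (rule average_covector_hom_poly[OF fin ne A f(1)])+
  qed (auto simp: N_def c1_def c2_def average_form_invariant[OF A] average_covector_equivariant[OF A S])
  interpret quadric_frame G S A q \<alpha> \<beta> D N c1 c2 by (rule frame)
  note at = average_at_free_point[where f = f, OF fin A S x0(1) f(3)]
  have c: "c1 x0 i = f x0 * \<epsilon> k i" "c2 x0 i = f x0 * \<epsilon> l i" if "i < 4" for i
    unfolding c1_def c2_def using at(2)[OF _ that] by auto
  have pick: "(\<Sum>i<4. F i * \<epsilon> m i) = F m" if "m < 4" for F m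
    using sum_delta4[OF that] unfolding \<epsilon>_def .
  have "contract ?M (c2 x0) i = f x0 * ?M i l" for i
  proof -
    have "contract ?M (c2 x0) i = (\<Sum>j<4. f x0 * ?M i j * \<epsilon> l j)"
      unfolding contract_def using c by (intro sum.cong) auto
    then show ?thesis using pick[OF kl(2)] by simp
  qed
  then have "gam x0 = (\<Sum>i<4. f x0 * (f x0 * ?M i l) * \<epsilon> k i)"
    unfolding gam_def dot_def using c by (intro sum.cong) auto
  then have "gam x0 = f x0 * (f x0 * ?M k l)" using pick[OF kl(1)] by simp
  then have "gam x0 \<noteq> 0" using f(2) kl(3) by simp
  moreover have "N x0 \<noteq> 0" unfolding N_def using at(1) f(2) by simp
  ultimately show ?thesis using that frame by blast
qed

text \<open>
  The family over \<open>W\<close> is built at a vector \<open>v\<close> with trivial stabilizer, and the same \<open>v\<close> must also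
  belong to a Lagrangian plane on which \<open>N\<close> and \<open>gam\<close> do not vanish, so that one point certifies that
  the domain of the birational map is nonempty. Both conditions are expressed by finitely many nonzero
  polynomials in \<open>v\<close>: a nonzero entry of \<open>S g - 1\<close> for each \<open>g \<noteq> 1\<close>, and the polynomial \<open>P\<close> below.
\<close>

lemma (in quadric_frame) exists_equivariant_trivialisation:
  assumes fin: "finite (carrier G)" and faithful: "\<And>g. g \<in> carrier G - {\<one>} \<Longrightarrow> S g \<noteq> 1\<^sub>m 4"
    and x0: "x0 \<in> carrier_vec 5" "q x0 = 0" "N x0 \<noteq> 0" "gam x0 \<noteq> 0"
  obtains e c0 z0 where "equivariant_trivialisation G S A q \<alpha> \<beta> D N c1 c2 e c0"
    "z0 \<in> carrier_vec 9" "equivariant_trivialisation.forward_denom \<alpha> \<beta> N c1 c2 c0 z0 \<noteq> 0"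
proof -
  define u where "u = contract (to_mat \<beta> x0) (c1 x0)"
  define y where "y = contract (to_mat \<beta> x0) (c2 x0)"
  have u_frame: "u = frame 0 (- 1) x0" and y_frame: "y = frame 1 0 x0"
    unfolding u_def y_def frame_def by auto
  have uy: "wedge u y i j = gam x0 * to_mat \<beta> x0 i j" if "i < 4" "j < 4" for i j
    unfolding u_frame y_frame wedge_frame[OF x0(1,2) that] by simp
  have symp_uy: "symp_form u y = 0" unfolding u_frame y_frame by (rule symp_frame[OF x0(1,2)])
  have "\<exists>m<4. u m \<noteq> 0"
  proof (rule ccontr)
    assume "\<not> ?thesis"
    then have "dot (c2 x0) u = 0" unfolding dot_def by auto
    moreover have "dot (c2 x0) (contract (to_mat \<beta> x0) (c1 x0)) = - gam x0"
    proof -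
      have "\<And>i j. i < 4 \<Longrightarrow> j < 4 \<Longrightarrow> to_mat \<beta> x0 j i = - to_mat \<beta> x0 i j"
        using to_mat_primitive[OF x0(1)] unfolding primitive_mat4_iff by blast
      then show ?thesis unfolding gam_def by (rule dot_contract_alternating)
    qed
    ultimately show False using x0(4) unfolding u_def by simp
  qed
  then obtain m where m: "m < 4" "u m \<noteq> 0" by blast
  define r where "r = sharp (\<lambda>i. if i = m then 1 else 0 :: 'k)"
  have ur: "symp_form u r = u m"
    unfolding r_def symp_sharp dot_def by (rule sum_delta4[OF m(1)])
  \<comment> \<open>Moving \<open>v\<close> away from \<open>u\<close> inside the Lagrangian pairs: \<open>partner v\<close> is orthogonal to \<open>v\<close>,
    depends linearly on it, and is a multiple of \<open>y\<close> at \<open>v = u\<close>.\<close>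
  define partner where "partner v i = symp_form v r * y i - symp_form v y * r i" for v i
  have symp_partner: "symp_form v (partner v) = 0" for v
    unfolding partner_def symp_form_def by (simp add: algebra_simps)
  define X where "X v = from_mat \<alpha> (wedge (\<lambda>i. v $ i) (partner (\<lambda>i. v $ i)))" for v :: "'k vec"
  \<comment> \<open>The value of \<open>N * gam\<close> at the plane spanned by \<open>v\<close> and \<open>partner v\<close>; it is nonzero at \<open>v = u\<close>,
    where this plane is the one of \<open>x0\<close>.\<close>
  define P where "P v = N (X v) * gam (X v)" for v
  have "\<exists>i j. i < 4 \<and> j < 4 \<and> S g $$ (i, j) \<noteq> (1\<^sub>m 4 :: 'k mat) $$ (i, j)"
    if g: "g \<in> carrier G - {\<one>}" for g
  proof (rule ccontr)
    assume *: "\<not> ?thesis"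
    have "S g = 1\<^sub>m 4"
    proof (rule eq_matI)
      fix i j assume "i < dim_row (1\<^sub>m 4 :: 'k mat)" "j < dim_col (1\<^sub>m 4 :: 'k mat)"
      then show "S g $$ (i, j) = (1\<^sub>m 4 :: 'k mat) $$ (i, j)" using * unfolding index_one_mat by blast
    qed (use matrix_repD(2)[OF S, of g] g in simp_all)
    then show False using faithful[OF g] by simp
  qed
  then obtain \<iota> \<kappa> where \<iota>: "\<iota> g < 4" "\<kappa> g < 4"
      "S g $$ (\<iota> g, \<kappa> g) \<noteq> (1\<^sub>m 4 :: 'k mat) $$ (\<iota> g, \<kappa> g)" if "g \<in> carrier G - {\<one>}" for g
    by metis
  define b where "b g v = (\<Sum>k<4. S g $$ (\<iota> g, k) * v $ k) - v $ \<iota> g" for g and v :: "'k vec"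
  have v_poly: "bihom_poly 4 0 1 0 (\<lambda>v y :: 'k vec. v $ i)" if "i < 4" for i
    by (rule bihom_poly.fst[OF that])
  have const: "bihom_poly 4 0 0 0 (\<lambda>v y :: 'k vec. c)" for c by (rule bihom_poly.const)
  have s_poly: "bihom_poly 4 0 1 0 (\<lambda>v y :: 'k vec. symp_form (\<lambda>i. v $ i) w)" for w
    by (rule bihom_poly_symp[OF v_poly const]) auto
  have "bihom_poly 4 0 1 0 (\<lambda>v y. partner (\<lambda>i. v $ i) i)" for i
    unfolding partner_def
    by (intro bihom_poly_diff bihom_poly_mult_deg[OF s_poly const]) auto
  then have "bihom_poly 4 0 2 0 (\<lambda>v y. X v $ k)" if "k < 5" for k
    unfolding X_def
    by (intro bihom_poly_from_mat[OF bihom_poly_wedge[OF v_poly] that]) auto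
  note X_poly = this
  have "hom_poly 4 (D * 2 + (2 * D + 1) * 2) P"
    unfolding P_def
    by (rule bihom_poly_fst_only[of _ 0], rule bihom_poly_mult_deg[OF bihom_poly_compose[OF N_poly X_poly]
          bihom_poly_gam[OF X_poly] refl refl])
  moreover have "P (vec 4 u) \<noteq> 0"
  proof -
    have vec_u: "symp_form (\<lambda>i. vec 4 u $ i) w = symp_form u w" for w by (intro symp_cong) auto
    have "wedge (\<lambda>i. vec 4 u $ i) (partner (\<lambda>i. vec 4 u $ i)) i j = u m * gam x0 * to_mat \<beta> x0 i j"
      if "i < 4" "j < 4" for i j
    proof -
      have "wedge (\<lambda>i. vec 4 u $ i) (partner (\<lambda>i. vec 4 u $ i)) i j = u m * wedge u y i j"
        using that unfolding partner_def vec_u ur symp_uy wedge_def by (simp add: algebra_simps)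
      then show ?thesis unfolding uy[OF that] by simp
    qed
    then have "X (vec 4 u) = (u m * gam x0) \<cdot>\<^sub>v from_mat \<alpha> (to_mat \<beta> x0)"
      unfolding X_def by (rule from_mat_scale)
    then have "X (vec 4 u) = (u m * gam x0) \<cdot>\<^sub>v x0" unfolding from_to_mat[OF x0(1)] .
    then show ?thesis
      unfolding P_def using m(2) x0 hom_poly_scale[OF N_poly x0(1)] gam_scale[OF x0(1)] by simp
  qed
  moreover have "hom_poly 4 1 (b g)" if g: "g \<in> carrier G - {\<one>}" for g
    unfolding b_def using \<iota>(1)[OF g]
    by (intro hom_poly_diff hom_poly_sum hom_poly_cmult hom_poly.coord) (auto simp: lessThan_empty_iff)
  moreover have "b g (unit_vec 4 (\<kappa> g)) \<noteq> 0" if g: "g \<in> carrier G - {\<one>}" for g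
  proof -
    have "(\<Sum>k<4. S g $$ (\<iota> g, k) * unit_vec 4 (\<kappa> g) $ k) =
        (\<Sum>k<4. S g $$ (\<iota> g, k) * (if k = \<kappa> g then 1 else 0))"
      using \<iota>(2)[OF g] by (intro sum.cong) auto
    also have "\<dots> = S g $$ (\<iota> g, \<kappa> g)" by (rule sum_delta4[OF \<iota>(2)[OF g]])
    finally show ?thesis unfolding b_def using \<iota>[OF g] by auto
  qed
  ultimately have family: "\<exists>d. hom_poly 4 d F" "\<exists>v\<in>carrier_vec 4. F v \<noteq> 0"
    if "F \<in> insert P (b ` (carrier G - {\<one>}))" for F
    using that vec_carrier[of 4 u] unit_vec_carrier[of 4] by blast+
  have "finite (insert P (b ` (carrier G - {\<one>})))" using fin by simp
  then obtain v where "v \<in> carrier_vec 4"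
      "\<And>F. F \<in> insert P (b ` (carrier G - {\<one>})) \<Longrightarrow> F v \<noteq> 0"
    using hom_poly_family_nonzero[of _ 4] family by blast
  then have v: "v \<in> carrier_vec 4" "P v \<noteq> 0" "\<And>g. g \<in> carrier G - {\<one>} \<Longrightarrow> b g v \<noteq> 0"
    by auto
  let ?v = "\<lambda>i. v $ i"
  have v_nz: "\<exists>m<4. v $ m \<noteq> 0"
  proof (rule ccontr)
    assume "\<not> ?thesis"
    then have 0: "?v i = 0" if "i < 4" for i using that by blast
    then have "symp_form ?v w = 0" for w unfolding symp_form_def by simp
    then have "wedge ?v (partner ?v) i j = 0" for i j unfolding wedge_def partner_def by simp
    then have "X v = 0\<^sub>v 5" unfolding X_def from_mat_def by (intro eq_vecI) auto
    then have "to_mat \<beta> (X v) i j = 0" for i j unfolding to_mat_def by simp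
    then have "gam (X v) = 0" unfolding gam_def contract_def dot_def by simp
    then show False using v(2) unfolding P_def by simp
  qed
  then obtain n where n: "n < 4" "v $ n \<noteq> 0" by blast
  define R where "R g = block_diag (S g) (1\<^sub>m 1)" for g
  have R: "matrix_rep G 5 R"
    using matrix_rep_block_diag[OF S matrix_rep_trivial[of G 1]] unfolding R_def[abs_def] by simp
  have R_cone: "R g *\<^sub>v cone w t = cone (mat_act (S g) w) t" if g: "g \<in> carrier G" for g w t
  proof (rule eq_vecI)
    have carr: "cone w t \<in> carrier_vec (4 + 1)" unfolding cone_def by simp
    note Sg = matrix_repD(2)[OF S g]
    note parts = block_diag_mult_vec[OF Sg one_carrier_mat carr, folded R_def]
    fix i assume "i < dim_vec (cone (mat_act (S g) w) t)"
    then have "i < 4 \<or> i = 4" unfolding cone_def by auto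
    then show "(R g *\<^sub>v cone w t) $ i = cone (mat_act (S g) w) t $ i"
    proof
      assume i: "i < 4"
      show ?thesis using parts(1)[OF i] i by (simp add: cone_def mat_act_def)
    next
      assume i: "i = 4"
      show ?thesis using parts(2)[of 0] i by (simp add: cone_def)
    qed
  qed (use matrix_repD(2)[OF R g] in \<open>simp add: cone_def\<close>)
  have cone_carr: "cone w t \<in> carrier_vec 5" for w :: "nat \<Rightarrow> 'k" and t unfolding cone_def by simp
  let ?x = "cone ?v 1"
  have "\<exists>i<5. \<exists>j<5. ?x $ i * (R g *\<^sub>v ?x) $ j \<noteq> ?x $ j * (R g *\<^sub>v ?x) $ i" if g: "g \<in> carrier G - {\<one>}" for g
  proof (intro exI conjI)
    show "\<iota> g < 5" "?x $ \<iota> g * (R g *\<^sub>v ?x) $ 4 \<noteq> ?x $ 4 * (R g *\<^sub>v ?x) $ \<iota> g"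
      using v(3)[OF g] g R_cone[of g] \<iota>(1)[OF g] unfolding b_def mat_act_def by (auto simp: cone_def)
  qed simp
  then obtain e f where f: "hom_poly 5 e f" "f ?x \<noteq> 0" "\<And>g. g \<in> carrier G - {\<one>} \<Longrightarrow> f (R g *\<^sub>v ?x) = 0"
    using exists_separating_form[of "carrier G - {\<one>}" 5 ?x "\<lambda>g. R g *\<^sub>v ?x"] fin by auto
  define c0 where "c0 = average_covector G R S f (\<lambda>i. if i = n then 1 else 0 :: 'k)"
  have ne: "carrier G \<noteq> {}" using one_closed by blast
  have triv: "equivariant_trivialisation G S A q \<alpha> \<beta> D N c1 c2 e c0"
  proof unfold_locales
    show "hom_poly 5 e (\<lambda>x. c0 x i)" for i
      unfolding c0_def by (rule average_covector_hom_poly[OF fin ne R f(1)])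
    show "transp_act (S g) (c0 (cone (mat_act (S g) w) t)) i = c0 (cone w t) i"
      if "g \<in> carrier G" "i < 4" for g i w t
      unfolding c0_def R_cone[OF that(1), symmetric]
      by (rule average_covector_equivariant[OF R S that(1) cone_carr that(2)])
  qed
  interpret equivariant_trivialisation G S A q \<alpha> \<beta> D N c1 c2 e c0 by (rule triv)
  have "c0 ?x i = f ?x * (if i = n then 1 else 0)" if "i < 4" for i
    unfolding c0_def by (rule average_at_free_point(2)[where f = f, OF fin R S cone_carr f(3) that])
  then have "height ?v 1 = (\<Sum>i<4. if i = n then v $ i * f ?x else 0)"
    unfolding height_def dot_def by (intro sum.cong) auto
  then have h: "height ?v 1 \<noteq> 0" using n f(2) by simp
  define z where "z = vec 9 (\<lambda>k. if k < 4 then v $ k else if k < 8 then partner ?v (k - 4) else 1)"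
  have z1: "first_part z i = ?v i" and z2: "second_part z i = partner ?v i" if "i < 4" for i
    using that unfolding first_part_def second_part_def z_def by auto
  have z3: "z $ 8 = 1" unfolding z_def by simp
  have "cone (first_part z) 1 = cone ?v 1" unfolding cone_def using z1 by auto
  then have h': "height (first_part z) 1 = height ?v 1"
    unfolding height_def using z1 by (intro dot_cong) auto
  \<comment> \<open>For the pair \<open>(v, partner v)\<close> the projection to the complement of \<open>v\<close> only rescales.\<close>
  have "symp_form (first_part z) (second_part z) = symp_form ?v (partner ?v)"
    using z1 z2 by (intro symp_cong)
  then have l: "lagr_part z i = height ?v 1 * partner ?v i" if "i < 4" for i
    unfolding lagr_part_def lagr_def z3 h' z2[OF that] symp_partner by simp
  have "quadric_part z = height ?v 1 \<cdot>\<^sub>v X v"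
    unfolding quadric_part_def X_def using z1 l
    by (intro from_mat_scale) (simp add: wedge_def algebra_simps)
  moreover have Xc: "X v \<in> carrier_vec 5" unfolding X_def from_mat_def by simp
  ultimately have "forward_denom z \<noteq> 0"
    unfolding forward_denom_def z3 h' using h v(2) hom_poly_scale[OF N_poly Xc] gam_scale[OF Xc]
    unfolding P_def by simp
  moreover have "z \<in> carrier_vec 9" unfolding z_def by simp
  ultimately show ?thesis using that triv by blast
qed


section \<open>Coordinates on the primitive bivectors\<close>

lemma mat4_eqI: "(\<And>i j. i < 4 \<Longrightarrow> j < 4 \<Longrightarrow> M i j = M' i j) \<Longrightarrow> mat4 M = mat4 M'"
  by (intro eq_matI) auto

text \<open>
  Additivity and homogeneity on primitive bivectors extend to finite linear combinations; these remain
  primitive because primitivity is a linear condition.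
\<close>

lemma isometry_linear_combination:
  fixes q :: "'a :: field_char_0 vec \<Rightarrow> 'a" and n :: nat
  assumes iso: "isometry_from_primitive q \<phi>"
    and B: "\<And>k. k < n \<Longrightarrow> mat4 (B k) \<in> primitive_bivectors"
  shows "mat4 (\<lambda>i j. \<Sum>k<n. x k * B k i j) \<in> primitive_bivectors \<and>
    \<phi> (mat4 (\<lambda>i j. \<Sum>k<n. x k * B k i j)) = vec 5 (\<lambda>l. \<Sum>k<n. x k * \<phi> (mat4 (B k)) $ l)"
  using B
proof (induction n)
  case 0
  let ?Z = "mat4 (\<lambda>i j. 0 :: 'a)"
  have Z: "?Z \<in> primitive_bivectors" unfolding primitive_mat4_iff by simp
  have "\<phi> (0 \<cdot>\<^sub>m ?Z) = 0 \<cdot>\<^sub>v \<phi> ?Z" using iso Z unfolding isometry_from_primitive_def by blast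
  moreover have "0 \<cdot>\<^sub>m ?Z = ?Z" by (intro eq_matI) auto
  moreover have "\<phi> ?Z \<in> carrier_vec 5"
    using iso Z unfolding isometry_from_primitive_def bij_betw_def by blast
  then have "0 \<cdot>\<^sub>v \<phi> ?Z = 0\<^sub>v 5" by (intro eq_vecI) auto
  ultimately have "\<phi> ?Z = 0\<^sub>v 5" by simp
  then show ?case using Z by (simp add: zero_vec_def case_prod_unfold)
next
  case (Suc n)
  note additive = iso[unfolded isometry_from_primitive_def, THEN conjunct2, THEN conjunct1, rule_format]
  note homogeneous = iso[unfolded isometry_from_primitive_def, THEN conjunct2, THEN conjunct2,
      THEN conjunct1, rule_format]
  let ?M = "\<lambda>i j. \<Sum>k<n. x k * B k i j"
  have IH: "mat4 ?M \<in> primitive_bivectors"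
    "\<phi> (mat4 ?M) = vec 5 (\<lambda>l. \<Sum>k<n. x k * \<phi> (mat4 (B k)) $ l)"
    using Suc by auto
  have Bn: "mat4 (B n) \<in> primitive_bivectors" using Suc.prems by simp
  have scaled: "x n \<cdot>\<^sub>m mat4 (B n) = mat4 (\<lambda>i j. x n * B n i j)" by (intro eq_matI) auto
  have xBn: "x n \<cdot>\<^sub>m mat4 (B n) \<in> primitive_bivectors"
    unfolding scaled primitive_mat4_iff
  proof (intro conjI allI impI)
    fix i j :: nat assume "i < 4" "j < 4"
    then have "B n j i = - B n i j" using Bn unfolding primitive_mat4_iff by blast
    then show "x n * B n j i = - (x n * B n i j)" by simp
  next
    have "B n 0 2 + B n 1 3 = 0" using Bn unfolding primitive_mat4_iff by blast
    then show "x n * B n 0 2 + x n * B n 1 3 = 0" by (metis distrib_left mult_zero_right)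
  qed
  have sum: "mat4 (\<lambda>i j. \<Sum>k<Suc n. x k * B k i j) = mat4 ?M + x n \<cdot>\<^sub>m mat4 (B n)"
    by (intro eq_matI) auto
  have "\<phi> (mat4 ?M + x n \<cdot>\<^sub>m mat4 (B n)) = \<phi> (mat4 ?M) + x n \<cdot>\<^sub>v \<phi> (mat4 (B n))"
    using additive[OF IH(1) xBn] homogeneous[OF Bn] by simp
  moreover have "\<phi> (mat4 (B n)) \<in> carrier_vec 5"
    using iso Bn unfolding isometry_from_primitive_def bij_betw_def by blast
  ultimately have val: "\<phi> (mat4 (\<lambda>i j. \<Sum>k<Suc n. x k * B k i j)) =
      vec 5 (\<lambda>l. \<Sum>k<Suc n. x k * \<phi> (mat4 (B k)) $ l)"
    unfolding sum IH(2) by (intro eq_vecI) auto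
  have "mat4 (\<lambda>i j. \<Sum>k<Suc n. x k * B k i j) \<in> primitive_bivectors"
    unfolding primitive_mat4_iff
  proof (intro conjI allI impI)
    fix i j :: nat assume ij: "i < 4" "j < 4"
    have "B k j i = - B k i j" if "k < Suc n" for k
      using Suc.prems[OF that] ij unfolding primitive_mat4_iff by blast
    then show "(\<Sum>k<Suc n. x k * B k j i) = - (\<Sum>k<Suc n. x k * B k i j)"
      unfolding sum_negf[symmetric] by (intro sum.cong) auto
  next
    have "B k 0 2 + B k 1 3 = 0" if "k < Suc n" for k
      using Suc.prems[OF that] unfolding primitive_mat4_iff by blast
    then have "(\<Sum>k<Suc n. x k * (B k 0 2 + B k 1 3)) = 0" by (intro sum.neutral) simp
    then show "(\<Sum>k<Suc n. x k * B k 0 2) + (\<Sum>k<Suc n. x k * B k 1 3) = 0"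
      by (simp add: distrib_left sum.distrib algebra_simps)
  qed
  then show ?case using val by blast
qed

text \<open>
  The matrix of the wedge of the basis vectors \<open>p\<close> and \<open>r\<close>.
\<close>

definition bivector :: "nat \<Rightarrow> nat \<Rightarrow> nat \<Rightarrow> nat \<Rightarrow> 'a :: ring_1" where
  "bivector p r i j = (if i = p \<and> j = r then 1 else if i = r \<and> j = p then - 1 else 0)"

text \<open>
  Primitivity expresses the entry \<open>(1, 3)\<close> as the negative of the entry \<open>(0, 2)\<close>, so four wedges of basis
  vectors and one difference of two wedges form a basis, and the coefficients of a bivector in this
  basis are entries of its matrix.
\<close>

lemma isometry_from_mat:
  fixes q :: "'a :: field_char_0 vec \<Rightarrow> 'a"
  assumes iso: "isometry_from_primitive q \<phi>"
  obtains \<alpha> where "\<And>M. mat4 M \<in> primitive_bivectors \<Longrightarrow> \<phi> (mat4 M) = from_mat \<alpha> M"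
proof -
  define B :: "nat \<Rightarrow> nat \<Rightarrow> nat \<Rightarrow> 'a" where "B k = [bivector 0 1, bivector 0 3, bivector 1 2, bivector 2 3,
    (\<lambda>i j. bivector 0 2 i j - bivector 1 3 i j)] ! k" for k
  define \<alpha> where "\<alpha> l i j = (if (i, j) = (0, 1) then \<phi> (mat4 (B 0)) $ l else
    if (i, j) = (0, 3) then \<phi> (mat4 (B 1)) $ l else if (i, j) = (1, 2) then \<phi> (mat4 (B 2)) $ l else
    if (i, j) = (2, 3) then \<phi> (mat4 (B 3)) $ l else if (i, j) = (0, 2) then \<phi> (mat4 (B 4)) $ l else 0)"
    for l i j :: nat
  have sum5: "(\<Sum>k<5. F k) = F 0 + F 1 + F 2 + F 3 + F (4::nat)" for F :: "nat \<Rightarrow> 'a"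
    by (simp add: numeral_eq_Suc add.assoc)
  have B_simps: "B 0 = bivector 0 1" "B 1 = bivector 0 3" "B 2 = bivector 1 2" "B 3 = bivector 2 3"
    "B 4 = (\<lambda>i j. bivector 0 2 i j - bivector 1 3 i j)"
    unfolding B_def by (simp_all add: eval_nat_numeral)
  have B: "mat4 (B k) \<in> primitive_bivectors" if "k < 5" for k
  proof -
    have "k = 0 \<or> k = 1 \<or> k = 2 \<or> k = 3 \<or> k = 4" using that by linarith
    then show ?thesis unfolding primitive_mat4_iff
      by (elim disjE) (simp_all add: B_simps B_simps(2)[unfolded One_nat_def] bivector_def)
  qed
  have "\<phi> (mat4 M) = from_mat \<alpha> M" if M: "mat4 M \<in> primitive_bivectors" for M
  proof -
    define x where "x k = [M 0 1, M 0 3, M 1 2, M 2 3, M 0 2] ! k" for k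
    have x_simps: "x 0 = M 0 1" "x 1 = M 0 3" "x 2 = M 1 2" "x 3 = M 2 3" "x 4 = M 0 2"
      unfolding x_def by (simp_all add: eval_nat_numeral)
    have alt: "\<And>i j. i < 4 \<Longrightarrow> j < 4 \<Longrightarrow> M j i = - M i j" and tr: "M 0 2 + M 1 3 = 0"
      using M unfolding primitive_mat4_iff by blast+
    have diag: "M i i = 0" if "i < 4" for i
      using alt[OF that that] by (rule eq_uminus_self_imp_zero)
    have d: "M 0 0 = 0" "M 1 1 = 0" "M 2 2 = 0" "M 3 3 = 0" using diag by simp_all
    have a: "M 1 0 = - M 0 1" "M 2 0 = - M 0 2" "M 3 0 = - M 0 3"
      "M 2 1 = - M 1 2" "M 3 1 = - M 1 3" "M 3 2 = - M 2 3" "M 1 3 = - M 0 2"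
      using alt[of 0 1] alt[of 0 2] alt[of 0 3] alt[of 1 2] alt[of 1 3] alt[of 2 3] tr
      by (simp_all add: add_eq_0_iff)
    have "M i j = (\<Sum>k<5. x k * B k i j)" if "i < 4" "j < 4" for i j
      using that unfolding sum5 B_simps x_simps less4_cases
      by (elim disjE) (simp_all add: bivector_def d[unfolded One_nat_def] a[unfolded One_nat_def])
    then have "mat4 M = mat4 (\<lambda>i j. \<Sum>k<5. x k * B k i j)" by (rule mat4_eqI)
    also have "\<phi> \<dots> = vec 5 (\<lambda>l. \<Sum>k<5. x k * \<phi> (mat4 (B k)) $ l)"
      using isometry_linear_combination[OF iso, of 5 B x] B by blast
    also have "\<dots> = from_mat \<alpha> M"
      unfolding from_mat_def sum5 sum_less4 x_simps by (intro eq_vecI) (simp_all add: \<alpha>_def mult.commute)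
    finally show ?thesis .
  qed
  then show ?thesis using that by blast
qed

lemma isometry_to_mat:
  fixes q :: "'a :: field_char_0 vec \<Rightarrow> 'a"
  assumes iso: "isometry_from_primitive q \<phi>"
  obtains \<beta> where "\<And>x. x \<in> carrier_vec 5 \<Longrightarrow> mat4 (to_mat \<beta> x) \<in> primitive_bivectors"
    "\<And>x. x \<in> carrier_vec 5 \<Longrightarrow> \<phi> (mat4 (to_mat \<beta> x)) = x"
proof -
  have "\<exists>M\<in>primitive_bivectors. \<phi> M = unit_vec 5 k" if "k < 5" for k
    using iso unit_vec_carrier[of 5 k] unfolding isometry_from_primitive_def bij_betw_def
    by (metis imageE)
  then obtain E where E: "\<And>k. k < 5 \<Longrightarrow> E k \<in> primitive_bivectors" "\<And>k. k < 5 \<Longrightarrow> \<phi> (E k) = unit_vec 5 k"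
    by metis
  define \<beta> where "\<beta> i j k = E k $$ (i, j)" for i j k
  have E_mat4: "E k = mat4 (\<lambda>i j. E k $$ (i, j))" if "k < 5" for k
    using E(1)[OF that] unfolding primitive_bivectors_def by (intro eq_matI) auto
  have *: "mat4 (to_mat \<beta> x) \<in> primitive_bivectors \<and> \<phi> (mat4 (to_mat \<beta> x)) = x"
    if x: "x \<in> carrier_vec 5" for x
  proof -
    have "to_mat \<beta> x = (\<lambda>i j. \<Sum>k<5. x $ k * E k $$ (i, j))"
      unfolding to_mat_def[abs_def] \<beta>_def by (simp add: mult.commute)
    moreover have "mat4 (\<lambda>i j. \<Sum>k<5. x $ k * E k $$ (i, j)) \<in> primitive_bivectors \<and>
        \<phi> (mat4 (\<lambda>i j. \<Sum>k<5. x $ k * E k $$ (i, j))) =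
        vec 5 (\<lambda>l. \<Sum>k<5. x $ k * \<phi> (mat4 (\<lambda>i j. E k $$ (i, j))) $ l)"
      using E(1) E_mat4 by (intro isometry_linear_combination[OF iso]) metis
    moreover have "vec 5 (\<lambda>l. \<Sum>k<5. x $ k * \<phi> (mat4 (\<lambda>i j. E k $$ (i, j))) $ l) = x"
    proof (rule eq_vecI)
      fix l assume "l < dim_vec x"
      then have l: "l < 5" using x by simp
      have "(\<Sum>k<5. x $ k * \<phi> (mat4 (\<lambda>i j. E k $$ (i, j))) $ l) = (\<Sum>k<5. if k = l then x $ k else 0)"
      proof (intro sum.cong refl)
        fix k :: nat assume "k \<in> {..<5}"
        then show "x $ k * \<phi> (mat4 (\<lambda>i j. E k $$ (i, j))) $ l = (if k = l then x $ k else 0)"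
          using E(2)[of k] E_mat4[of k, symmetric] l by simp
      qed
      then show "vec 5 (\<lambda>l. \<Sum>k<5. x $ k * \<phi> (mat4 (\<lambda>i j. E k $$ (i, j))) $ l) $ l = x $ l"
        using l by simp
    qed (use x in simp)
    ultimately show ?thesis by metis
  qed
  then show ?thesis using that by blast
qed

section \<open>Stable linearizability\<close>

lemma SO5_mult_one: "x \<otimes>\<^bsub>SO5 q\<^esub> y = x * y" "\<one>\<^bsub>SO5 q\<^esub> = 1\<^sub>m 5"
  unfolding SO5_def GL_def units_of_def ring_mat_def by simp_all

lemma Sp4_mult: "x \<otimes>\<^bsub>Sp4\<^esub> y = x * y"
  unfolding Sp4_def GL_def units_of_def ring_mat_def by simp

lemma SO5_D:
  assumes "x \<in> carrier (SO5 q)"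
  shows "x \<in> carrier_mat 5 5" "\<exists>y\<in>carrier_mat 5 5. x * y = 1\<^sub>m 5 \<and> y * x = 1\<^sub>m 5"
  using assms unfolding SO5_def GL_def units_of_def Units_def ring_mat_def by auto

text \<open>
  Right multiplication by an invertible matrix is injective on the finite set \<open>K\<close>, hence surjective;
  this provides inverses inside \<open>K\<close>.
\<close>

lemma finite_subgroup_SO5_group:
  assumes sub: "subgroup K (SO5 q)" and fin: "finite K"
  shows "group (SO5 q\<lparr>carrier := K\<rparr>)"
proof -
  have K: "x \<in> carrier_mat 5 5" "\<exists>y\<in>carrier_mat 5 5. x * y = 1\<^sub>m 5 \<and> y * x = 1\<^sub>m 5" if "x \<in> K" for x
    using SO5_D[of x q] subgroup.subset[OF sub] that by blast+
  have mult: "x * y \<in> K" if "x \<in> K" "y \<in> K" for x y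
    using subgroup.m_closed[OF sub that] by (simp add: SO5_mult_one)
  have one: "1\<^sub>m 5 \<in> K"
    using subgroup.one_closed[OF sub] by (simp add: SO5_mult_one)
  have inv: "\<exists>y\<in>K. y * x = 1\<^sub>m 5" if x: "x \<in> K" for x
  proof -
    obtain z where z: "z \<in> carrier_mat 5 5" "x * z = 1\<^sub>m 5" using K(2)[OF x] by blast
    have "inj_on (\<lambda>g. g * x) K"
    proof (rule inj_onI)
      fix g h assume g: "g \<in> K" and h: "h \<in> K" and eq: "g * x = h * x"
      have "g = (g * x) * z" using assoc_mult_mat[OF K(1)[OF g] K(1)[OF x] z(1)] z(2) K(1)[OF g] by simp
      also have "\<dots> = h" unfolding eq
        using assoc_mult_mat[OF K(1)[OF h] K(1)[OF x] z(1)] z(2) K(1)[OF h] by simp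
      finally show "g = h" .
    qed
    then have "(\<lambda>g. g * x) ` K = K" using mult x by (intro endo_inj_surj[OF fin]) auto
    then show ?thesis using one by (metis imageE)
  qed
  show ?thesis
  proof (rule groupI)
    fix x y z
    assume "x \<in> carrier (SO5 q\<lparr>carrier := K\<rparr>)" "y \<in> carrier (SO5 q\<lparr>carrier := K\<rparr>)"
      "z \<in> carrier (SO5 q\<lparr>carrier := K\<rparr>)"
    then have "x * y * z = x * (y * z)"
      using assoc_mult_mat[OF K(1) K(1) K(1)] by simp
    then show "x \<otimes>\<^bsub>SO5 q\<lparr>carrier := K\<rparr>\<^esub> y \<otimes>\<^bsub>SO5 q\<lparr>carrier := K\<rparr>\<^esub> z =
        x \<otimes>\<^bsub>SO5 q\<lparr>carrier := K\<rparr>\<^esub> (y \<otimes>\<^bsub>SO5 q\<lparr>carrier := K\<rparr>\<^esub> z)"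
      by (simp add: SO5_mult_one)
  qed (use mult one inv left_mult_one_mat[OF K(1)] in \<open>auto simp: SO5_mult_one\<close>)
qed

theorem theorem5p6:
  fixes X :: "'k :: {alg_closed_field, field_char_0} vec set set"
    and q :: "'k vec \<Rightarrow> 'k"
    and \<pi> :: "'k mat \<Rightarrow> 'k mat"
    and G :: "'k mat set"
  assumes quadratic_form: "hom_poly 5 2 q"
    and quadric: "X = proj_zero_locus 5 {q}"
    and smooth: "smooth_hypersurface 5 q"
    and cover: "exceptional_double_cover q \<pi>"
    and subgroup: "subgroup G (SO5 q)"
    and finite: "finite G"
    and gen_free: "generically_free (SO5 q\<lparr>carrier := G\<rparr>) 5 X proj_act"
    and splits: "extension_splits (Sp4\<lparr>carrier := cover_preimage \<pi> G\<rparr>) (SO5 q\<lparr>carrier := G\<rparr>) \<pi>"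
  shows "stably_linearizable (SO5 q\<lparr>carrier := G\<rparr>) 5 X proj_act"
proof -
  define \<Gamma> where "\<Gamma> = SO5 q\<lparr>carrier := G\<rparr>"
  have \<Gamma>_simps: "carrier \<Gamma> = G" "g \<otimes>\<^bsub>\<Gamma>\<^esub> h = g * h" "\<one>\<^bsub>\<Gamma>\<^esub> = 1\<^sub>m 5" for g h
    unfolding \<Gamma>_def by (simp_all add: SO5_mult_one)
  interpret group \<Gamma> unfolding \<Gamma>_def by (rule finite_subgroup_SO5_group[OF subgroup finite])
  have G: "g \<in> carrier_mat 5 5" if "g \<in> G" for g
    using SO5_D(1) subgroup.subset[OF subgroup] that by blast
  obtain \<phi> where iso: "isometry_from_primitive q \<phi>"
    and \<pi>: "\<And>g M. g \<in> carrier Sp4 \<Longrightarrow> M \<in> primitive_bivectors \<Longrightarrow> \<pi> g *\<^sub>v \<phi> M = \<phi> (g * M * transpose_mat g)"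
    using cover unfolding exceptional_double_cover_def by blast
  obtain s where s_hom: "s \<in> hom \<Gamma> (Sp4\<lparr>carrier := cover_preimage \<pi> G\<rparr>)"
    and \<pi>s: "\<And>g. g \<in> G \<Longrightarrow> \<pi> (s g) = g"
    using splits unfolding extension_splits_def \<Gamma>_def by auto
  have s: "s g \<in> carrier Sp4" if "g \<in> G" for g
    using hom_in_carrier[OF s_hom] that unfolding \<Gamma>_simps cover_preimage_def by simp
  have s_mult: "s (g * h) = s g * s h" if "g \<in> G" "h \<in> G" for g h
    using hom_mult[OF s_hom] that unfolding \<Gamma>_simps by (simp add: Sp4_mult)
  have one: "1\<^sub>m 5 \<in> G" using one_closed unfolding \<Gamma>_simps .
  have s_one: "s (1\<^sub>m 5) = 1\<^sub>m 4"
  proof -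
    let ?e = "s (1\<^sub>m 5)"
    have e: "?e \<in> carrier_mat 4 4" using Sp4D(1)[OF s[OF one]] .
    obtain B where B: "B \<in> carrier_mat 4 4" "B * ?e = 1\<^sub>m 4"
      using s[OF one] unfolding Sp4_def GL_def units_of_def Units_def ring_mat_def by auto
    have "?e * ?e = ?e" using s_mult[OF one one] by simp
    then have "B * (?e * ?e) = B * ?e" by simp
    then show ?thesis using assoc_mult_mat[OF B(1) e e] B(2) e by simp
  qed
  have S: "matrix_rep \<Gamma> 4 s"
    unfolding matrix_rep_def \<Gamma>_simps using s_one s_mult Sp4D(1)[OF s] by blast
  have A: "matrix_rep \<Gamma> 5 (\<lambda>g. g)" unfolding matrix_rep_def \<Gamma>_simps using G by blast
  obtain \<alpha> where \<alpha>: "\<And>M. mat4 M \<in> primitive_bivectors \<Longrightarrow> \<phi> (mat4 M) = from_mat \<alpha> M"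
    using isometry_from_mat[OF iso] by blast
  obtain \<beta> where \<beta>: "\<And>x. x \<in> carrier_vec 5 \<Longrightarrow> mat4 (to_mat \<beta> x) \<in> primitive_bivectors"
    "\<And>x. x \<in> carrier_vec 5 \<Longrightarrow> \<phi> (mat4 (to_mat \<beta> x)) = x"
    using isometry_to_mat[OF iso] by blast
  have inj: "inj_on \<phi> primitive_bivectors"
    using iso unfolding isometry_from_primitive_def bij_betw_def by blast
  interpret quadric_of_lagrangians \<Gamma> s "\<lambda>g. g" q \<alpha> \<beta>
  proof unfold_locales
    show "to_mat \<beta> (from_mat \<alpha> M) i j = M i j"
      if M: "mat4 M \<in> primitive_bivectors" and ij: "i < 4" "j < 4" for M i j
    proof -
      have x: "from_mat \<alpha> M \<in> carrier_vec 5" unfolding from_mat_def by simp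
      have "\<phi> (mat4 (to_mat \<beta> (from_mat \<alpha> M))) = \<phi> (mat4 M)" using \<beta>(2)[OF x] \<alpha>[OF M] by simp
      then have "mat4 (to_mat \<beta> (from_mat \<alpha> M)) = mat4 M"
        using inj \<beta>(1)[OF x] M unfolding inj_on_def by blast
      then have "mat4 (to_mat \<beta> (from_mat \<alpha> M)) $$ (i, j) = mat4 M $$ (i, j)" by simp
      then show ?thesis using ij by simp
    qed
    show "q (from_mat \<alpha> M) = pf (mat4 M)" if "mat4 M \<in> primitive_bivectors" for M
      using iso that \<alpha>[OF that] unfolding isometry_from_primitive_def by metis
    show "from_mat \<alpha> M' = g *\<^sub>v from_mat \<alpha> M"
      if g: "g \<in> carrier \<Gamma>" and M: "mat4 M \<in> primitive_bivectors"
        and M'_primitive: "mat4 M' \<in> primitive_bivectors"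
        and M': "mat4 M' = s g * mat4 M * transpose_mat (s g)" for g M M'
    proof -
      have g': "g \<in> G" using g unfolding \<Gamma>_simps .
      have "\<phi> (mat4 M') = g *\<^sub>v \<phi> (mat4 M)" using \<pi>[OF s[OF g'] M] \<pi>s[OF g'] M' by simp
      then show ?thesis using \<alpha>[OF M] \<alpha>[OF M'_primitive] by simp
    qed
  qed (use S A s \<beta> \<alpha> \<Gamma>_simps in auto)
  obtain p where p: "p \<in> X" and free: "\<And>g. g \<in> G \<Longrightarrow> proj_act g p = p \<Longrightarrow> g = 1\<^sub>m 5"
    using gen_free unfolding generically_free_def zariski_open_in_def \<Gamma>_def[symmetric] \<Gamma>_simps by blast
  obtain x0 where x0: "x0 \<in> carrier_vec 5" "x0 \<noteq> 0\<^sub>v 5" "p = proj_point x0"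
    using p unfolding quadric proj_zero_locus_def by (blast elim: proj_spaceE)
  have qx0: "q x0 = 0" using p proj_point_self[of x0] unfolding quadric proj_zero_locus_def x0(3) by blast
  have free': "g = \<one>\<^bsub>\<Gamma>\<^esub>" if "g \<in> carrier \<Gamma>" "proj_point (g *\<^sub>v x0) = proj_point x0" for g
    using free[of g] that proj_act_point[OF G x0(1)] unfolding x0(3) \<Gamma>_simps by metis
  have fin: "Finite_Set.finite (carrier \<Gamma>)" unfolding \<Gamma>_simps by (rule finite)
  obtain D N c1 c2 where frame: "quadric_frame \<Gamma> s (\<lambda>g. g) q \<alpha> \<beta> D N c1 c2"
    and N0: "N x0 \<noteq> 0" and gam0: "quadric_frame.gam \<beta> c1 c2 x0 \<noteq> 0"
    using exists_quadric_frame[OF fin x0(1,2) free'] .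
  interpret quadric_frame \<Gamma> s "\<lambda>g. g" q \<alpha> \<beta> D N c1 c2 by (rule frame)
  \<comment> \<open>A section of \<open>\<pi>\<close> is injective.\<close>
  have faithful: "s g \<noteq> 1\<^sub>m 4" if "g \<in> carrier \<Gamma> - {\<one>\<^bsub>\<Gamma>\<^esub>}" for g
    using that \<pi>s[of g] \<pi>s[OF one] s_one unfolding \<Gamma>_simps by auto
  obtain e c0 z0 where triv: "equivariant_trivialisation \<Gamma> s (\<lambda>g. g) q \<alpha> \<beta> D N c1 c2 e c0"
    and z0: "z0 \<in> carrier_vec 9" "equivariant_trivialisation.forward_denom \<alpha> \<beta> N c1 c2 c0 z0 \<noteq> 0"
    using exists_equivariant_trivialisation[OF fin faithful x0(1) qx0 N0 gam0] .
  interpret equivariant_trivialisation \<Gamma> s "\<lambda>g. g" q \<alpha> \<beta> D N c1 c2 e c0 by (rule triv)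
  have "equivariantly_birational \<Gamma> 9 (proj_space 9) (\<lambda>g. proj_act (rep g))
      (5 * 6) (segre_product X (proj_space 6)) (left_act X (proj_space 6) proj_act)"
    unfolding quadric by (rule equivariantly_birational_quadric[OF quadratic_form refl z0])
  then have "linearizable \<Gamma> (5 * (5 + 1)) (segre_product X (proj_space (5 + 1)))
      (left_act X (proj_space (5 + 1)) proj_act)"
    unfolding linearizable_def using matrix_rep_hom_GL[OF matrix_rep_rep] by auto
  then show ?thesis unfolding stably_linearizable_def \<Gamma>_def by blast
qed

end
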